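(* Let $(B,\phi)$ be a $C^\ast$-probability space and consider the map $\mu:B_{\mathrm{sa}}\times\mathcal{P}_2(B)\to\operatorname{Prob}(\mathbb{R})$, $(b_0,\eta)\mapsto\mu_{(b_0,\eta)}$, assigning to each data pair its density of states. Then: (i) For each $\eta\in\mathcal{P}_2(B)$, for all $b_{0,0},b_{0,1}\in B_{\mathrm{sa}}$ and all $\epsilon>0$, $$\frac{1}{\pi}\int_{-\infty}^\infty\big|\mathcal{G}_{\mu_{(b_{0,1},\eta)}}(s+i\epsilon)-\mathcal{G}_{\mu_{(b_{0,0},\eta)}}(s+i\epsilon)\big|\,ds\leq\frac{1}{\epsilon}\,\|b_{0,1}-b_{0,0}\|.$$ (ii) For each $b_0\in B_{\mathrm{sa}}$, for all $\eta_0,\eta_1\in\mathcal{P}_2(B)$ and all $\epsilon>0$, $$\frac{1}{\pi}\int_{-\infty}^\infty\big|\mathcal{G}_{\mu_{(b_0,\eta_1)}}(s+i\epsilon)-\mathcal{G}_{\mu_{(b_0,\eta_0)}}(s+i\epsilon)\big|\,ds\leq\frac{1}{\epsilon^2}\,\|\eta_1-\eta_0\|.$$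
   Context: A $C^\ast$-probability space $(B,\phi)$ is a unital $C^\ast$-algebra $B$ (unit $\mathbf{1}$) with a distinguished state $\phi$ (not necessarily tracial). $B_{\mathrm{sa}}=\{b\in B:b^\ast=b\}$; $\operatorname{Im}(b)=\frac{1}{2i}(b-b^\ast)$; $\mathbb{H}^\pm(B)=\{b\in B:\exists\,\epsilon>0,\ \pm\operatorname{Im}(b)\geq\epsilon\mathbf{1}\}$; $\mathbb{C}^\pm$ are the open upper/lower half-planes. $\operatorname{Prob}(\mathbb{R})$ is the set of Borel probability measures on $\mathbb{R}$, and the Cauchy transform of $\mu\in\operatorname{Prob}(\mathbb{R})$ is $\mathcal{G}_\mu:\mathbb{C}^+\to\mathbb{C}^-$, $\mathcal{G}_\mu(z)=\int_{\mathbb{R}}\frac{1}{z-t}\,d\mu(t)$. A map $\eta:B\to B$ is positive if it is $\mathbb{C}$-linear and maps positive elements to positive elements (automatically bounded); it is $2$-positive if its entrywise amplification $\eta^{(2)}:M_2(B)\to M_2(B)$ is positive. $\mathcal{P}_2(B)$ is the set of $2$-positive maps; $\|\eta\|=\sup_{\|b\|\leq1}\|\eta(b)\|$. For each positive $\eta$ there is a unique function $G_\eta:\mathbb{H}^+(B)\to\mathbb{H}^-(B)$ satisfying the Dyson equation $bG_\eta(b)=\mathbf{1}+\eta(G_\eta(b))G_\eta(b)$ for all $b\in\mathbb{H}^+(B)$; it is holomorphic. For a data pair $\rho=(b_0,\eta)$ with $b_0\in B_{\mathrm{sa}}$ and $\eta$ positive, the density of states $\mu_\rho$ is the unique Borel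 probability measure on $\mathbb{R}$ with $\mathcal{G}_{\mu_\rho}(z)=\phi(G_\eta(z\mathbf{1}-b_0))$ for all $z\in\mathbb{C}^+$. *)

theory Defs
  imports "HOL-Probability.Probability"
begin

text \<open>
  Unital \<open>C\<^sup>*\<close>-algebras. The superclasses supply \<open>norm 1 = 1\<close>, so the zero algebra (which
  carries no state) is excluded, and \<open>norm (x * y) \<le> norm x * norm y\<close>.
\<close>

class cstar_algebra = real_normed_algebra_1 + banach +
  fixes scaleC :: "complex \<Rightarrow> 'a \<Rightarrow> 'a" (infixr \<open>*\<^sub>C\<close> 75)
    and star :: "'a \<Rightarrow> 'a"
  assumes scaleC_add_right: "c *\<^sub>C (x + y) = c *\<^sub>C x + c *\<^sub>C y"
    and scaleC_add_left: "(c + d) *\<^sub>C x = c *\<^sub>C x + d *\<^sub>C x"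
    and scaleC_scaleC: "c *\<^sub>C d *\<^sub>C x = (c * d) *\<^sub>C x"
    and scaleR_scaleC: "r *\<^sub>R x = complex_of_real r *\<^sub>C x"
    and mult_scaleC_left: "(c *\<^sub>C x) * y = c *\<^sub>C (x * y)"
    and mult_scaleC_right: "x * (c *\<^sub>C y) = c *\<^sub>C (x * y)"
    and norm_scaleC: "norm (c *\<^sub>C x) = cmod c * norm x"
    and star_star: "star (star x) = x"
    and star_add: "star (x + y) = star x + star y"
    and star_scaleC: "star (c *\<^sub>C x) = cnj c *\<^sub>C star x"
    and star_mult: "star (x * y) = star y * star x"
    and norm_star_mult: "norm (star x * x) = (norm x)\<^sup>2"

instantiation complex :: cstar_algebra
begin

definition scaleC_complex :: "complex \<Rightarrow> complex \<Rightarrow> complex" where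
  "scaleC_complex c x = c * x"

definition star_complex :: "complex \<Rightarrow> complex" where
  "star_complex = cnj"

instance
  by standard
    (auto simp: scaleC_complex_def star_complex_def algebra_simps scaleR_conv_of_real
      norm_mult power2_eq_square)

end

definition clinear :: "('a::cstar_algebra \<Rightarrow> 'b::cstar_algebra) \<Rightarrow> bool" where
  "clinear f \<longleftrightarrow> (\<forall>x y. f (x + y) = f x + f y) \<and> (\<forall>c x. f (c *\<^sub>C x) = c *\<^sub>C f x)"

definition selfadjoint_elems :: "'b::cstar_algebra set" where
  "selfadjoint_elems = {b. star b = b}"

definition pos_elem :: "'b::cstar_algebra \<Rightarrow> bool" where
  "pos_elem b \<longleftrightarrow> (\<exists>x. b = star x * x)"

definition cs_le :: "'b::cstar_algebra \<Rightarrow> 'b \<Rightarrow> bool" where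
  "cs_le a b \<longleftrightarrow> pos_elem (b - a)"

definition im_part :: "'b::cstar_algebra \<Rightarrow> 'b" where
  "im_part b = (1 / (2 * \<i>)) *\<^sub>C (b - star b)"

definition upper_half :: "'b::cstar_algebra set" where
  "upper_half = {b. \<exists>e>0. cs_le (e *\<^sub>R 1) (im_part b)}"

definition lower_half :: "'b::cstar_algebra set" where
  "lower_half = {b. \<exists>e>0. cs_le (e *\<^sub>R 1) (- im_part b)}"

definition state :: "('b::cstar_algebra \<Rightarrow> complex) \<Rightarrow> bool" where
  "state \<phi> \<longleftrightarrow> clinear \<phi> \<and> (\<forall>b. pos_elem b \<longrightarrow> \<phi> b \<in> \<real>\<^sub>\<ge>\<^sub>0) \<and> \<phi> 1 = 1"

text \<open>
  \<open>M\<^sub>2(B)\<close> is represented by \<open>'b ^ 2 ^ 2\<close> with the matrix product \<open>**\<close> (the type's own \<open>*\<close> is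
  componentwise). As in \<open>pos_elem\<close>, its positive elements are those of the form \<open>X\<^sup>* X\<close>, so that
  its \<open>C\<^sup>*\<close>-norm need not be constructed.
\<close>

definition mat_star :: "'b::cstar_algebra ^ 2 ^ 2 \<Rightarrow> 'b ^ 2 ^ 2" where
  "mat_star A = (\<chi> i j. star (A $ j $ i))"

definition pos_mat :: "'b::cstar_algebra ^ 2 ^ 2 \<Rightarrow> bool" where
  "pos_mat A \<longleftrightarrow> (\<exists>X. A = mat_star X ** X)"

definition amplification :: "('b \<Rightarrow> 'b) \<Rightarrow> 'b::cstar_algebra ^ 2 ^ 2 \<Rightarrow> 'b ^ 2 ^ 2" where
  "amplification \<eta> A = (\<chi> i j. \<eta> (A $ i $ j))"

definition two_positive_maps :: "('b::cstar_algebra \<Rightarrow> 'b) set" where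
  "two_positive_maps =
     {\<eta>. clinear \<eta> \<and> (\<forall>A. pos_mat A \<longrightarrow> pos_mat (amplification \<eta> A))}"

definition dyson_solution :: "('b::cstar_algebra \<Rightarrow> 'b) \<Rightarrow> 'b \<Rightarrow> 'b" where
  "dyson_solution \<eta> =
     (THE G. G \<in> upper_half \<rightarrow>\<^sub>E lower_half \<and>
        (\<forall>b\<in>upper_half. b * G b = 1 + \<eta> (G b) * G b))"

definition cauchy_transform :: "real measure \<Rightarrow> complex \<Rightarrow> complex" where
  "cauchy_transform M z = (LINT t|M. 1 / (z - complex_of_real t))"

text \<open>The locale predicate \<open>real_distribution\<close> describes the Borel probability measures on the
  real line.\<close>

definition density_of_states ::
  "('b::cstar_algebra \<Rightarrow> complex) \<Rightarrow> 'b \<times> ('b \<Rightarrow> 'b) \<Rightarrow> real measure" where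
  "density_of_states \<phi> = (\<lambda>(b0, \<eta>).
     THE M. real_distribution M \<and>
       (\<forall>z. Im z > 0 \<longrightarrow> cauchy_transform M z = \<phi> (dyson_solution \<eta> (z *\<^sub>C 1 - b0))))"

end

theory Submission
  imports Defs "HOL-Complex_Analysis.Complex_Analysis" "HOL-Real_Asymp.Real_Asymp"
begin

text \<open>
  The proof is finite-difference and order-theoretic. Let \<open>G\<^sub>1\<close> and \<open>G\<^sub>0\<close> solve the Dyson equation for the
  same \<open>\<eta>\<close> at \<open>b\<^sub>1\<close> and \<open>b\<^sub>0\<close>, and let \<open>Y\<^sub>i = - Im G\<^sub>i\<close>. With \<open>h = b\<^sub>0 - b\<^sub>1\<close>, the difference \<open>r = G\<^sub>1 - G\<^sub>0\<close> and the
  imaginary parts satisfy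
  \<open>r = G\<^sub>1 (h + \<eta> r) G\<^sub>0\<close>, \<open>Y\<^sub>1 = G\<^sub>1 (Im b\<^sub>1 + \<eta> Y\<^sub>1) G\<^sub>1\<^sup>*\<close>, \<open>Y\<^sub>0 = G\<^sub>0\<^sup>* (Im b\<^sub>0 + \<eta> Y\<^sub>0) G\<^sub>0\<close>.
  These are the entries of one affine map acting on two by two blocks, and it preserves the order of
  blocks because \<open>\<eta>\<close> is 2-positive. Comparing \<open>r\<close> with \<open>K Y\<^sub>1\<close> and \<open>K Y\<^sub>0\<close> on the diagonal and iterating,
  the constant \<open>K\<close> improves geometrically to \<open>norm h / \<epsilon>\<close> if \<open>Im b\<^sub>i \<ge> \<epsilon>\<close> (\<open>pos_block_step\<close>,
  \<open>dyson_linear_bound\<close>). A state turns the resulting block inequality into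
  \<open>2 cmod (\<phi> r) \<le> (norm h / \<epsilon>) (\<phi> Y\<^sub>1 + \<phi> Y\<^sub>0)\<close>. On the line \<open>\<real> + \<i> \<epsilon>\<close> each \<open>\<phi> Y\<^sub>i\<close> is \<open>- Im\<close> of the Cauchy
  transform of a probability measure and has integral \<open>\<pi>\<close>; this is the first estimate.

  For the second estimate, a solution for \<open>\<eta>\<^sub>1\<close> at \<open>b\<close> is a solution for \<open>\<eta>\<^sub>0\<close> at \<open>b - (\<eta>\<^sub>1 - \<eta>\<^sub>0) G\<close>, and
  \<open>norm G \<le> 1 / \<epsilon>\<close>. The same bound applies with a slightly smaller \<open>\<epsilon>\<close>, and the loss disappears if the
  segment from \<open>\<eta>\<^sub>0\<close> to \<open>\<eta>\<^sub>1\<close> is cut into many short steps (\<open>resolvent_dist_small_step\<close>,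
  \<open>resolvent_dist_maps\<close>).

  The definite descriptions for the Dyson solution and for the density of states must also be shown to
  denote. The step that improves \<open>K\<close> contracts the Picard iteration, hence gives existence and pointwise
  uniqueness of the solution (\<open>dyson_eq_exists\<close>, \<open>dyson_eq_unique\<close>). It also bounds the difference
  quotients, so that \<open>z \<mapsto> \<phi> (G (z - b\<^sub>0))\<close> is holomorphic (\<open>phi_G_holomorphic\<close>). The measure is then
  obtained from Cauchy's theorem on half planes and Helly's selection theorem
  (\<open>cauchy_transform_exists\<close>), and its uniqueness from Levy's theorem (\<open>cauchy_transform_unique\<close>).
\<close>

section \<open>Elementary facts, square roots and Kaplansky's theorem\<close>

lemma scaleC_one [simp]: "1 *\<^sub>C x = (x::'a::cstar_algebra)"
  using scaleR_scaleC[of 1 x] by simp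

lemma scaleC_zero_left [simp]: "0 *\<^sub>C x = (0::'a::cstar_algebra)"
  using scaleR_scaleC[of 0 x] by simp

lemma scaleC_zero_right [simp]: "c *\<^sub>C (0::'a::cstar_algebra) = 0"
  using norm_scaleC[of c "0::'a"] by simp

lemma scaleC_minus_right [simp]: "c *\<^sub>C (- x) = - (c *\<^sub>C (x::'a::cstar_algebra))"
  using scaleC_add_right[of c "- x" x] by (simp add: eq_neg_iff_add_eq_0)

lemma scaleC_minus_left [simp]: "(- c) *\<^sub>C x = - (c *\<^sub>C (x::'a::cstar_algebra))"
  using scaleC_add_left[of "- c" c x] by (simp add: eq_neg_iff_add_eq_0)

lemma scaleC_diff_right: "c *\<^sub>C (x - y) = c *\<^sub>C x - c *\<^sub>C (y::'a::cstar_algebra)"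
  using scaleC_add_right[of c x "- y"] by simp

lemma star_zero [simp]: "star (0::'a::cstar_algebra) = 0"
  using star_scaleC[of 0 "0::'a"] by simp

lemma star_minus [simp]: "star (- x) = - star (x::'a::cstar_algebra)"
  using star_add[of "- x" x] by (simp add: eq_neg_iff_add_eq_0)

lemma star_diff: "star (x - y) = star x - star (y::'a::cstar_algebra)"
  using star_add[of x "- y"] by simp

lemma star_one [simp]: "star (1::'a::cstar_algebra) = 1"
  using star_mult[of "star 1 :: 'a" 1] by (simp add: star_star)

lemma star_scaleR [simp]: "star (r *\<^sub>R x) = r *\<^sub>R star (x::'a::cstar_algebra)"
  by (simp add: scaleR_scaleC star_scaleC)

lemma scaleC_scaleR: "c *\<^sub>C (r *\<^sub>R x) = r *\<^sub>R (c *\<^sub>C (x::'a::cstar_algebra))"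
  by (simp add: scaleR_scaleC scaleC_scaleC mult.commute)

lemma norm_star [simp]: "norm (star x) = norm (x::'a::cstar_algebra)"
proof -
  have le: "norm y \<le> norm (star y)" for y :: 'a
  proof (cases "norm y = 0")
    case False
    have "norm y * norm y \<le> norm (star y) * norm y"
      by (metis norm_mult_ineq norm_star_mult power2_eq_square)
    then show ?thesis using False by (simp add: mult_le_cancel_right)
  qed simp
  show ?thesis using le[of x] le[of "star x"] by (simp add: star_star)
qed

lemmas scaleC_simps = scaleC_add_right scaleC_diff_right mult_scaleC_left mult_scaleC_right
  scaleC_scaleC scaleC_scaleR

lemma tendsto_star: "((f :: 'b \<Rightarrow> 'a::cstar_algebra) \<longlongrightarrow> l) F \<Longrightarrow> ((\<lambda>x. star (f x)) \<longlongrightarrow> star l) F"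
  by (simp add: tendsto_iff dist_norm flip: star_diff)

lemma tendsto_scaleC: "((f :: 'b \<Rightarrow> 'a::cstar_algebra) \<longlongrightarrow> l) F \<Longrightarrow> ((\<lambda>x. c *\<^sub>C f x) \<longlongrightarrow> c *\<^sub>C l) F"
proof -
  assume "(f \<longlongrightarrow> l) F"
  then have "((\<lambda>x. cmod c * norm (f x - l)) \<longlongrightarrow> cmod c * 0) F"
    by (intro tendsto_intros tendsto_norm_zero) (simp add: LIM_zero_iff)
  then show ?thesis
    by (subst tendsto_dist_iff) (simp add: dist_norm norm_scaleC flip: scaleC_diff_right)
qed

lemma norm_selfadjoint_square:
  "star a = a \<Longrightarrow> norm (a * a) = (norm (a::'a::cstar_algebra))\<^sup>2"
  using norm_star_mult[of a] by simp

lemma star_mult_self_eq_0: "star x * x = 0 \<Longrightarrow> x = (0::'a::cstar_algebra)"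
  using norm_star_mult[of x] by simp

text \<open>
  With \<open>y = 1 - u\<close> the equation \<open>u\<^sup>2 = 1 - x\<close> reads \<open>y = (x + y\<^sup>2) / 2\<close>. The iteration of this map
  from \<open>0\<close> is dominated by the same iteration at the number \<open>norm x\<close>, which increases and stays
  below \<open>1\<close>; so it converges even when \<open>norm x = 1\<close>.
\<close>
lemma sqrt_one_minus:
  fixes x :: "'a::cstar_algebra"
  assumes sx: "star x = x" and nx: "norm x \<le> 1"
  obtains u where "star u = u" "u * u = 1 - x" "norm (1 - u) \<le> 1" "\<And>z. z * x = x * z \<Longrightarrow> z * u = u * z"
proof -
  define y where "y = rec_nat (0::'a) (\<lambda>_ y. (1/2) *\<^sub>R (x + y * y))"
  define s where "s = rec_nat (0::real) (\<lambda>_ s. (1/2) * (norm x + s * s))"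
  have y0: "y 0 = 0" and yS: "y (Suc n) = (1/2) *\<^sub>R (x + y n * y n)" for n
    by (simp_all add: y_def)
  have s0: "s 0 = 0" and sS: "s (Suc n) = (1/2) * (norm x + s n * s n)" for n
    by (simp_all add: s_def)
  have sbd: "0 \<le> s n \<and> s n \<le> 1" for n
  proof (induction n)
    case (Suc n)
    have "s n * s n \<le> 1" using Suc by (simp add: mult_le_one)
    then show ?case using nx by (simp add: sS)
  qed (simp add: s0)
  have ycomm: "z * y n = y n * z" if "z * x = x * z" for z n
  proof (induction n)
    case (Suc n)
    have "z * (y n * y n) = (y n * y n) * z" by (metis Suc mult.assoc)
    then show ?case using that by (simp add: yS algebra_simps)
  qed (simp add: y0)
  have yx: "x * y n = y n * x" for n using ycomm[of x n] by simp
  have yy: "y m * y n = y n * y m" for m n using ycomm[of "y m" n] yx[of m] by simp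
  have ystar: "star (y n) = y n" for n
    by (induction n) (simp_all add: y0 yS star_add star_mult sx)
  have ny: "norm (y n) \<le> s n" for n
  proof (induction n)
    case (Suc n)
    have "norm (x + y n * y n) \<le> norm x + norm (y n) * norm (y n)"
      by (meson add_left_mono norm_mult_ineq norm_triangle_le)
    also have "\<dots> \<le> norm x + s n * s n" using Suc sbd by (simp add: mult_mono')
    finally show ?case by (simp add: yS sS)
  qed (simp add: y0 s0)
  have step: "norm (y (Suc n) - y n) \<le> s (Suc n) - s n" for n
  proof (induction n)
    case 0
    then show ?case by (simp add: y0 s0 yS sS)
  next
    case (Suc n)
    have eq: "y (Suc (Suc n)) - y (Suc n) = (1/2) *\<^sub>R ((y (Suc n) + y n) * (y (Suc n) - y n))"
    proof -
      have "y (Suc (Suc n)) - y (Suc n)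
          = (1/2) *\<^sub>R (x + y (Suc n) * y (Suc n)) - (1/2) *\<^sub>R (x + y n * y n)"
        by (rule arg_cong2[where f = "(-)"]) (rule yS)+
      then show ?thesis by (simp add: algebra_simps yy[of n "Suc n"])
    qed
    have "norm ((y (Suc n) + y n) * (y (Suc n) - y n)) \<le> norm (y (Suc n) + y n) * norm (y (Suc n) - y n)"
      by (rule norm_mult_ineq)
    also have "\<dots> \<le> (s (Suc n) + s n) * (s (Suc n) - s n)"
      by (intro mult_mono Suc order.trans[OF norm_triangle_ineq] add_mono ny) (use sbd in auto)
    also have "\<dots> = 2 * (s (Suc (Suc n)) - s (Suc n))"
    proof -
      have "s (Suc (Suc n)) - s (Suc n)
          = (1/2) * (norm x + s (Suc n) * s (Suc n)) - (1/2) * (norm x + s n * s n)"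
        by (rule arg_cong2[where f = "(-)"]) (rule sS)+
      then show ?thesis by (simp add: algebra_simps)
    qed
    finally show ?case unfolding eq norm_scaleR by simp
  qed
  have smono: "incseq s"
    by (rule incseq_SucI) (smt (verit) norm_ge_zero step)
  have diff: "norm (y m - y n) \<le> s m - s n" if "n \<le> m" for m n
    using that
  proof (induction rule: dec_induct)
    case (step k)
    have "norm (y (Suc k) - y n) \<le> norm (y (Suc k) - y k) + norm (y k - y n)"
      by (rule order.trans[OF _ norm_triangle_ineq]) simp
    then show ?case using step \<open>norm (y (Suc k) - y k) \<le> s (Suc k) - s k\<close>[OF] by simp
  qed simp
  have "convergent s"
    using smono sbd by (intro Bseq_mono_convergent BseqI') (auto simp: incseq_def intro!: exI[of _ 1])
  then have cs: "Cauchy s" by (rule convergent_Cauchy)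
  have "Cauchy y"
  proof (rule metric_CauchyI)
    fix e :: real assume "e > 0"
    then obtain M where M: "\<And>m n. m \<ge> M \<Longrightarrow> n \<ge> M \<Longrightarrow> dist (s m) (s n) < e"
      using metric_CauchyD[OF cs] by blast
    have "dist (y m) (y n) < e" if "m \<ge> M" "n \<ge> M" for m n
    proof (cases "n \<le> m")
      case True
      then show ?thesis using diff[OF True] M[OF that] by (simp add: dist_norm)
    next
      case False
      then show ?thesis using diff[of m n] M[OF that] by (simp add: dist_norm norm_minus_commute)
    qed
    then show "\<exists>M. \<forall>m\<ge>M. \<forall>n\<ge>M. dist (y m) (y n) < e" by blast
  qed
  then obtain l where l: "y \<longlonglongrightarrow> l" using Cauchy_convergent convergentD by blast
  have "(\<lambda>n. y (Suc n)) \<longlonglongrightarrow> l" using l by (rule LIMSEQ_Suc)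
  moreover have "(\<lambda>n. y (Suc n)) \<longlonglongrightarrow> (1/2) *\<^sub>R (x + l * l)"
    unfolding yS by (intro tendsto_intros l)
  ultimately have fp: "l = (1/2) *\<^sub>R (x + l * l)" by (rule LIMSEQ_unique)
  have "star (1 - l) = 1 - l"
    using LIMSEQ_unique[OF tendsto_star[OF l]] l by (simp add: ystar star_diff)
  moreover have "(1 - l) * (1 - l) = 1 - x"
  proof -
    have "l + l = x + l * l" using fp by (metis scaleR_half_double scaleR_right_distrib)
    then show ?thesis by (simp add: algebra_simps)
  qed
  moreover have "z * (1 - l) = (1 - l) * z" if "z * x = x * z" for z
  proof -
    have "(\<lambda>n. z * y n) \<longlonglongrightarrow> z * l" by (intro tendsto_intros l)
    moreover have "(\<lambda>n. z * y n) \<longlonglongrightarrow> l * z"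
      unfolding ycomm[OF that] by (intro tendsto_intros l)
    ultimately have "z * l = l * z" by (rule LIMSEQ_unique)
    then show ?thesis by (simp add: algebra_simps)
  qed
  moreover have "norm (1 - (1 - l)) \<le> 1"
    unfolding diff_diff_eq2 add_diff_cancel_left' using LIMSEQ_le_const2[OF tendsto_norm[OF l], of 1] ny sbd by (meson order.trans)
  ultimately show ?thesis using that by blast
qed

text \<open>
  A form of positivity that refers to the norm only: in terms of spectra, \<open>a\<close> lies in the disc of
  radius \<open>t\<close> around \<open>t\<close>. Sums are immediate in this form. Its agreement with
  \<^const>\<open>pos_elem\<close> is Kaplansky's theorem, proved at the end of this section.
\<close>
definition ball_pos :: "'a::cstar_algebra \<Rightarrow> bool" where
  "ball_pos a \<longleftrightarrow> star a = a \<and> (\<exists>t\<ge>0. norm (t *\<^sub>R 1 - a) \<le> t)"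

lemma ball_pos_scaleR:
  fixes a :: "'a::cstar_algebra"
  assumes "ball_pos a" "r \<ge> 0"
  shows "ball_pos (r *\<^sub>R a)"
proof -
  obtain t where t: "star a = a" "t \<ge> 0" "norm (t *\<^sub>R 1 - a) \<le> t"
    using assms by (auto simp: ball_pos_def)
  have "norm ((r * t) *\<^sub>R 1 - r *\<^sub>R a) = r * norm (t *\<^sub>R 1 - a)"
    using assms(2) by (metis abs_of_nonneg norm_scaleR scaleR_right_diff_distrib scaleR_scaleR)
  then show ?thesis using t assms(2)
    unfolding ball_pos_def by (intro conjI exI[of _ "r * t"]) (simp_all add: mult_left_mono)
qed

lemma ball_pos_sqrt:
  fixes a :: "'a::cstar_algebra"
  assumes "ball_pos a"
  obtains u where "ball_pos u" "star u = u" "u * u = a" "\<And>z. z * a = a * z \<Longrightarrow> z * u = u * z"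
proof -
  obtain t where t: "star a = a" "t \<ge> 0" "norm (t *\<^sub>R 1 - a) \<le> t"
    using assms by (auto simp: ball_pos_def)
  show ?thesis
  proof (cases "t = 0")
    case True
    then show ?thesis using t by (intro that[of 0]) (auto simp: ball_pos_def)
  next
    case False
    with t have tp: "t > 0" by simp
    define x where "x = (1/t) *\<^sub>R (t *\<^sub>R 1 - a)"
    have "star x = x" by (simp add: x_def t star_diff)
    moreover have "norm x \<le> 1" using t tp by (simp add: x_def)
    ultimately obtain v where v: "star v = v" "v * v = 1 - x" "norm (1 - v) \<le> 1" "\<And>z. z * x = x * z \<Longrightarrow> z * v = v * z"
      by (rule sqrt_one_minus) blast
    have "1 - x = (1/t) *\<^sub>R a" using tp by (simp add: x_def algebra_simps)
    then have a: "a = t *\<^sub>R (1 - x)" using tp by simp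
    show ?thesis
    proof (rule that[of "sqrt t *\<^sub>R v"])
      have "ball_pos v" unfolding ball_pos_def using v(1,3) by (intro conjI exI[of _ 1]) simp_all
      then show "ball_pos (sqrt t *\<^sub>R v)" using tp by (intro ball_pos_scaleR) auto
      show "star (sqrt t *\<^sub>R v) = sqrt t *\<^sub>R v" by (simp add: v(1))
      show "sqrt t *\<^sub>R v * sqrt t *\<^sub>R v = a" using tp v(2) a by simp
      fix z assume "z * a = a * z"
      then have "z * x = x * z" by (simp add: x_def algebra_simps)
      then show "z * sqrt t *\<^sub>R v = sqrt t *\<^sub>R v * z" using v(4)[of z] by simp
    qed
  qed
qed

text \<open>
  The element \<open>u + \<i> v\<close> is unitary, and its real and imaginary parts are averages of elements of norm
  \<open>1\<close>.
\<close>
lemma norm_le_of_sum_squares: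
  fixes u v :: "'a::cstar_algebra"
  assumes "star u = u" "star v = v" "u * v = v * u" "u * u + v * v = 1"
  shows "norm u \<le> 1" "norm v \<le> 1"
proof -
  define w where "w = u + \<i> *\<^sub>C v"
  have sw: "star w = u - \<i> *\<^sub>C v" by (simp add: w_def star_add star_scaleC assms)
  have "star w * w = 1"
    unfolding sw unfolding w_def using assms(3,4)
    by (simp add: algebra_simps scaleC_simps)
  then have nw: "norm w = 1" using norm_star_mult[of w] by (simp add: power2_eq_1_iff) (smt (verit) norm_ge_zero)
  have "w + star w = 2 *\<^sub>R u" unfolding sw by (simp add: w_def scaleR_2)
  then have "2 * norm u \<le> norm w + norm (star w)" by (metis norm_scaleR norm_triangle_ineq abs_numeral)
  then show "norm u \<le> 1" using nw by simp
  have "w - star w = 2 *\<^sub>R (\<i> *\<^sub>C v)" unfolding sw by (simp add: w_def scaleR_2)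
  then have "2 * norm v \<le> norm w + norm (star w)"
    by (metis norm_scaleR norm_triangle_ineq4 abs_numeral norm_scaleC norm_ii mult_1)
  then show "norm v \<le> 1" using nw by simp
qed

text \<open>
  After scaling, \<open>a = cos \<theta>\<close>: with \<open>v = sqrt (1 - a\<^sup>2)\<close> the element \<open>a + \<i> v\<close> is unitary, so its
  imaginary part \<open>v\<close>, and with it \<open>1 - a\<^sup>2 = v\<^sup>2\<close>, has norm at most \<open>1\<close>.
\<close>
lemma norm_minus_square_le:
  fixes a :: "'a::cstar_algebra"
  assumes sa: "star a = a"
  shows "norm ((norm a)\<^sup>2 *\<^sub>R 1 - a * a) \<le> (norm a)\<^sup>2"
proof (cases "a = 0")
  case False
  define c where "c = (1 / norm a) *\<^sub>R a"
  have c: "star c = c" "norm c = 1" using False by (simp_all add: c_def sa)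
  have "star (c * c) = c * c" "norm (c * c) \<le> 1"
    using c by (simp_all add: star_mult norm_selfadjoint_square)
  then obtain v where v: "star v = v" "v * v = 1 - c * c"
      "\<And>z. z * (c * c) = (c * c) * z \<Longrightarrow> z * v = v * z"
    by (rule sqrt_one_minus) blast
  have "c * v = v * c" by (rule v(3)) (simp add: mult.assoc)
  then have "norm v \<le> 1" using norm_le_of_sum_squares[OF c(1) v(1)] v(2) by simp
  then have "norm (1 - c * c) \<le> 1"
    using norm_selfadjoint_square[OF v(1)] by (simp add: v(2) power_le_one)
  moreover have "(norm a)\<^sup>2 *\<^sub>R 1 - a * a = (norm a)\<^sup>2 *\<^sub>R (1 - c * c)"
    using False by (simp add: c_def algebra_simps power2_eq_square)
  ultimately show ?thesis by (simp add: mult_left_le)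
qed simp

lemma ball_pos_square: "star a = a \<Longrightarrow> ball_pos (a * a)" for a :: "'a::cstar_algebra"
  using norm_minus_square_le[of a] by (auto simp: ball_pos_def star_mult intro!: exI[of _ "(norm a)\<^sup>2"])

lemma ball_pos_norm:
  fixes a :: "'a::cstar_algebra"
  shows "ball_pos a \<longleftrightarrow> star a = a \<and> norm (norm a *\<^sub>R 1 - a) \<le> norm a"
proof
  assume a: "ball_pos a"
  then obtain u where u: "star u = u" "u * u = a" by (rule ball_pos_sqrt) blast
  then show "star a = a \<and> norm (norm a *\<^sub>R 1 - a) \<le> norm a"
    using norm_minus_square_le[OF u(1)] norm_selfadjoint_square[OF u(1)] a by (simp add: ball_pos_def)
next
  assume "star a = a \<and> norm (norm a *\<^sub>R 1 - a) \<le> norm a"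
  then show "ball_pos a" unfolding ball_pos_def by (intro conjI exI[of _ "norm a"]) simp_all
qed

lemma ball_pos_add:
  fixes a b :: "'a::cstar_algebra"
  assumes "ball_pos a" "ball_pos b"
  shows "ball_pos (a + b)"
proof -
  obtain t where t: "star a = a" "t \<ge> 0" "norm (t *\<^sub>R 1 - a) \<le> t"
    using assms(1) unfolding ball_pos_def by blast
  obtain s where s: "star b = b" "s \<ge> 0" "norm (s *\<^sub>R 1 - b) \<le> s"
    using assms(2) unfolding ball_pos_def by blast
  have "(t + s) *\<^sub>R 1 - (a + b) = (t *\<^sub>R 1 - a) + (s *\<^sub>R 1 - b)"
    by (simp add: algebra_simps)
  then have "norm ((t + s) *\<^sub>R 1 - (a + b)) \<le> t + s"
    using norm_triangle_mono[OF t(3) s(3)] by (simp only:)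
  moreover have "star (a + b) = a + b" by (simp add: star_add t s)
  moreover have "0 \<le> t + s" using t s by simp
  ultimately show ?thesis unfolding ball_pos_def by blast
qed

text \<open>
  If \<open>a = u\<^sup>2\<close> and \<open>- a = v\<^sup>2\<close>, then \<open>u\<close> and \<open>v\<close> commute and \<open>x = u + \<i> v\<close> satisfies
  \<open>x\<^sup>* x = u\<^sup>2 + v\<^sup>2 = 0\<close>.
\<close>
lemma ball_pos_antisym:
  fixes a :: "'a::cstar_algebra"
  assumes "ball_pos a" "ball_pos (- a)"
  shows "a = 0"
proof -
  obtain u where u: "star u = u" "u * u = a" "\<And>z. z * a = a * z \<Longrightarrow> z * u = u * z"
    using assms(1) by (rule ball_pos_sqrt) blast
  obtain v where v: "star v = v" "v * v = - a" "\<And>z. z * (- a) = (- a) * z \<Longrightarrow> z * v = v * z"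
    using assms(2) by (rule ball_pos_sqrt) blast
  have "v * a = a * v" 
  proof -
    have "v * (- a) = (- a) * v" unfolding v(2)[symmetric] by (simp add: mult.assoc)
    then show ?thesis by simp
  qed
  then have uv: "v * u = u * v" by (rule u(3))
  define x where "x = u + \<i> *\<^sub>C v"
  have sx: "star x = u - \<i> *\<^sub>C v" by (simp add: x_def star_add star_scaleC u v)
  have "star x * x = 0"
    unfolding sx unfolding x_def using uv u(2) v(2)
    by (simp add: algebra_simps scaleC_simps)
  then have "x = 0" by (rule star_mult_self_eq_0)
  then have "x + star x = 0" by simp
  then have "2 *\<^sub>R u = 0" unfolding sx by (simp add: x_def scaleR_2)
  then show ?thesis using u(2) by auto
qed

text \<open>
  With \<open>x = u + \<i> v\<close> (up to a sign of \<open>v\<close>) the sum is \<open>2 (u\<^sup>2 + v\<^sup>2)\<close>.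
\<close>
lemma star_mult_add_mult_star:
  fixes x :: "'a::cstar_algebra"
  shows "ball_pos (star x * x + x * star x)"
proof -
  define u v where "u = (1/2) *\<^sub>R (x + star x)" and "v = (1/2) *\<^sub>R (\<i> *\<^sub>C (x - star x))"
  have "star u = u" by (simp add: u_def star_add star_star add.commute)
  moreover have "star v = v"
    by (simp add: v_def star_diff star_star star_scaleC scaleC_diff_right)
  ultimately have "ball_pos (2 *\<^sub>R (u * u + v * v))"
    by (intro ball_pos_scaleR ball_pos_add ball_pos_square) auto
  moreover have "2 *\<^sub>R (u * u + v * v) = star x * x + x * star x"
  proof -
    have "u * u = (1/4) *\<^sub>R ((x + star x) * (x + star x))" by (simp add: u_def)
    moreover have "v * v = - ((1/4) *\<^sub>R ((x - star x) * (x - star x)))"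
      by (simp add: v_def mult_scaleC_left mult_scaleC_right scaleC_scaleC scaleC_scaleR)
    ultimately have "2 *\<^sub>R (u * u + v * v)
        = (1/2) *\<^sub>R ((x + star x) * (x + star x) - (x - star x) * (x - star x))"
      by (simp add: scaleR_diff_right)
    also have "(x + star x) * (x + star x) - (x - star x) * (x - star x) = 2 *\<^sub>R (star x * x + x * star x)"
      by (simp add: algebra_simps scaleR_2)
    finally show ?thesis by simp
  qed
  ultimately show ?thesis by simp
qed

text \<open>
  Kaplansky's argument without spectra. For \<open>c = sqrt (- y\<^sup>* y)\<close> and \<open>z = y c\<close> both \<open>z\<^sup>* z = - c\<^sup>4\<close> and
  \<open>z z\<^sup>* = - (y y\<^sup>*)\<^sup>2\<close> are negative, while their sum is positive; so \<open>c = 0\<close>.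
\<close>
lemma star_mult_self_neg_imp_0:
  fixes y :: "'a::cstar_algebra"
  assumes "ball_pos (- (star y * y))"
  shows "y = 0"
proof -
  obtain c where c: "star c = c" "c * c = - (star y * y)"
    using assms by (rule ball_pos_sqrt) blast
  define z where "z = y * c"
  have e1: "star z * z = - ((c * c) * (c * c))"
  proof -
    have "star z * z = c * (star y * y) * c" by (simp add: z_def star_mult c(1) mult.assoc)
    also have "star y * y = - (c * c)" by (simp only: c(2) minus_minus)
    finally show ?thesis by (simp add: mult.assoc)
  qed
  have e2: "z * star z = - ((y * star y) * (y * star y))"
  proof -
    have "z * star z = y * (c * c) * star y" by (simp add: z_def star_mult c(1) mult.assoc)
    also have "\<dots> = - ((y * star y) * (y * star y))" by (simp only: c(2)) (simp add: mult.assoc)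
    finally show ?thesis .
  qed
  have p1: "ball_pos ((c * c) * (c * c))" by (rule ball_pos_square) (simp only: star_mult c(1))
  have p2: "ball_pos ((y * star y) * (y * star y))" by (rule ball_pos_square) (simp add: star_mult star_star)
  have "ball_pos (star z * z + z * star z)" by (rule star_mult_add_mult_star)
  with p2 have "ball_pos (- ((c * c) * (c * c)))"
    using ball_pos_add[OF _ p2, of "star z * z + z * star z"] unfolding e1 e2 by (simp only: add.assoc left_minus add_0_right)
  with p1 have "(c * c) * (c * c) = 0" by (intro ball_pos_antisym)
  then have "c * c = 0" using star_mult_self_eq_0[of "c * c"] by (simp only: star_mult c(1))
  then have "star y * y = 0" using c(2) by simp
  then show ?thesis by (rule star_mult_self_eq_0)
qed

text \<open>
  Let \<open>a = x\<^sup>* x\<close>, let \<open>p\<close> be the absolute value of \<open>a\<close>, and let \<open>q = p - a\<close>, which is twice the negative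
  part. Then \<open>(x q)\<^sup>* (x q) = q a q = - q p q\<close> is negative, so that \<open>x q = 0\<close> by the previous lemma; this
  forces \<open>q = 0\<close>, that is \<open>a = p\<close>.
\<close>
theorem ball_pos_star_mult_self:
  fixes x :: "'a::cstar_algebra"
  shows "ball_pos (star x * x)"
proof -
  define a where "a = star x * x"
  have sa: "star a = a" by (simp add: a_def star_mult star_star)
  obtain p where p: "ball_pos p" "star p = p" "p * p = a * a" "\<And>z. z * (a * a) = (a * a) * z \<Longrightarrow> z * p = p * z"
    using ball_pos_square[OF sa] by (rule ball_pos_sqrt) blast
  obtain s where s: "star s = s" "s * s = p" "\<And>z. z * p = p * z \<Longrightarrow> z * s = s * z"
    using p(1) by (rule ball_pos_sqrt) blast
  have ap: "a * p = p * a" by (rule p(4)) (simp add: mult.assoc)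
  define q where "q = p - a"
  have sq: "star q = q" by (simp add: q_def star_diff sa p)
  have qp: "q * p = p * q" by (simp add: q_def algebra_simps ap)
  have qs: "q * s = s * q" by (rule s(3)[OF qp])
  have qsqs: "(q * s) * (q * s) = q * (q * p)"
  proof -
    have "(q * s) * (q * s) = q * (s * q) * s" by (simp add: mult.assoc)
    also have "s * q = q * s" using qs by simp
    also have "q * (q * s) * s = q * (q * p)" by (simp add: mult.assoc flip: s(2))
    finally show ?thesis .
  qed
  have qa: "q * a = - (q * p)" by (simp add: q_def algebra_simps ap p(3))
  have qq: "q * q = 2 *\<^sub>R (q * p)" 
    using qa by (subst (2) q_def) (simp add: algebra_simps scaleR_2)
  have sqs: "star (q * s) = q * s" by (simp add: star_mult sq s qs)
  have "star (x * q) * (x * q) = q * a * q" by (simp add: a_def star_mult sq mult.assoc)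
  also have "\<dots> = - ((q * s) * (q * s))"
    unfolding qa qsqs by (simp add: mult.assoc flip: qp)
  finally have "ball_pos (- (star (x * q) * (x * q)))"
    by (simp only: minus_minus ball_pos_square[OF sqs])
  then have xq: "x * q = 0" by (rule star_mult_self_neg_imp_0)
  then have "a * q = 0" by (simp add: a_def mult.assoc)
  then have "star (a * q) = 0" by simp
  then have "q * a = 0" by (simp only: star_mult sa sq)
  then have qp0: "q * p = 0" unfolding qa by (simp only: neg_equal_0_iff_equal)
  have "star q * q = 0" unfolding sq qq qp0 by (rule scaleR_zero_right)
  then have "q = 0" by (rule star_mult_self_eq_0)
  then have "p = a" unfolding q_def by (simp only: right_minus_eq)
  with p(1) show ?thesis unfolding a_def by (simp only:)
qed

section \<open>Order, norm and inverses\<close>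

lemma pos_elem_iff_ball_pos: "pos_elem a \<longleftrightarrow> ball_pos (a :: 'a::cstar_algebra)"
proof
  assume "ball_pos a"
  then obtain u where "star u = u" "u * u = a" by (rule ball_pos_sqrt) blast
  then show "pos_elem a" by (metis pos_elem_def)
qed (auto simp: pos_elem_def ball_pos_star_mult_self)

lemma pos_elem_sqrt:
  fixes a :: "'a::cstar_algebra"
  assumes "pos_elem a"
  obtains u where "star u = u" "u * u = a" "\<And>z. z * a = a * z \<Longrightarrow> z * u = u * z"
  using assms ball_pos_sqrt unfolding pos_elem_iff_ball_pos by metis

lemma pos_elem_star: "pos_elem a \<Longrightarrow> star a = (a :: 'a::cstar_algebra)"
  by (simp add: pos_elem_iff_ball_pos ball_pos_def)

lemma pos_elem_add: "pos_elem a \<Longrightarrow> pos_elem b \<Longrightarrow> pos_elem (a + b :: 'a::cstar_algebra)"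
  by (simp add: pos_elem_iff_ball_pos ball_pos_add)

lemma pos_elem_scaleR: "pos_elem a \<Longrightarrow> r \<ge> 0 \<Longrightarrow> pos_elem (r *\<^sub>R a :: 'a::cstar_algebra)"
  by (simp add: pos_elem_iff_ball_pos ball_pos_scaleR)

lemma pos_elem_star_mult: "pos_elem (star x * x :: 'a::cstar_algebra)"
  by (auto simp: pos_elem_def)

lemma pos_elem_mult_star: "pos_elem (x * star x :: 'a::cstar_algebra)"
  using pos_elem_star_mult[of "star x"] by (simp add: star_star)

lemma pos_elem_zero [simp]: "pos_elem (0 :: 'a::cstar_algebra)"
  using pos_elem_star_mult[of "0::'a"] by simp

lemma pos_elem_one [simp]: "pos_elem (1 :: 'a::cstar_algebra)"
  using pos_elem_star_mult[of "1::'a"] by simp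

lemma pos_elem_const: "r \<ge> 0 \<Longrightarrow> pos_elem (r *\<^sub>R (1 :: 'a::cstar_algebra))"
  by (simp add: pos_elem_scaleR)

lemma pos_elem_conj:
  assumes "pos_elem (a :: 'a::cstar_algebra)"
  shows "pos_elem (star x * a * x)"
proof -
  obtain y where "a = star y * y" using assms by (auto simp: pos_elem_def)
  then have "star x * a * x = star (y * x) * (y * x)" by (simp add: star_mult mult.assoc)
  then show ?thesis by (simp only: pos_elem_star_mult)
qed

lemma pos_elem_conj': "pos_elem (a :: 'a::cstar_algebra) \<Longrightarrow> pos_elem (x * a * star x)"
  using pos_elem_conj[of a "star x"] by (simp add: star_star)

lemma pos_elem_closed:
  fixes f :: "'b \<Rightarrow> 'a::cstar_algebra"
  assumes "F \<noteq> bot" "(f \<longlongrightarrow> l) F" "eventually (\<lambda>x. pos_elem (f x)) F"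
  shows "pos_elem l"
proof -
  have ev: "eventually (\<lambda>x. star (f x) = f x \<and> norm (norm (f x) *\<^sub>R 1 - f x) \<le> norm (f x)) F"
    using assms(3) by (simp add: pos_elem_iff_ball_pos ball_pos_norm)
  have "((\<lambda>x. star (f x)) \<longlongrightarrow> star l) F" by (rule tendsto_star[OF assms(2)])
  then have "(f \<longlongrightarrow> star l) F"
    by (rule Lim_transform_eventually) (use ev in \<open>auto elim: eventually_mono\<close>)
  then have "star l = l" using assms(1,2) tendsto_unique by blast
  moreover have "norm (norm l *\<^sub>R 1 - l) \<le> norm l"
    by (rule tendsto_le[OF assms(1), of "\<lambda>x. norm (f x)" _ "\<lambda>x. norm (norm (f x) *\<^sub>R 1 - f x)"])
       (use ev in \<open>auto intro!: tendsto_intros assms(2) elim: eventually_mono\<close>)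
  ultimately show ?thesis by (simp add: pos_elem_iff_ball_pos ball_pos_norm)
qed

lemma pos_elem_norm_minus:
  assumes "star a = (a :: 'a::cstar_algebra)" "norm a \<le> t"
  shows "pos_elem (t *\<^sub>R 1 - a)"
proof -
  have "t \<ge> 0" using assms(2) norm_ge_zero order.trans by blast
  then show ?thesis unfolding pos_elem_iff_ball_pos ball_pos_def using assms
    by (intro conjI exI[of _ t]) (simp_all add: star_diff)
qed

text \<open>
  After scaling, \<open>a\<close> and \<open>1 - a\<close> have commuting square roots \<open>v\<close> and \<open>u\<close> with \<open>u\<^sup>2 + v\<^sup>2 = 1\<close>.
\<close>
lemma norm_le_of_pos_elem:
  fixes a :: "'a::cstar_algebra"
  assumes "pos_elem a" "pos_elem (t *\<^sub>R 1 - a)" "t > 0"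
  shows "norm a \<le> t"
proof -
  define b where "b = (1/t) *\<^sub>R a"
  have "pos_elem b" unfolding b_def using assms by (intro pos_elem_scaleR) auto
  then obtain v where v: "star v = v" "v * v = b" "\<And>z. z * b = b * z \<Longrightarrow> z * v = v * z"
    by (rule pos_elem_sqrt) blast
  have "1 - b = (1/t) *\<^sub>R (t *\<^sub>R 1 - a)" using assms by (simp add: b_def algebra_simps)
  then have "pos_elem (1 - b)" using assms by (simp add: pos_elem_scaleR)
  then obtain u where u: "star u = u" "u * u = 1 - b" "\<And>z. z * (1 - b) = (1 - b) * z \<Longrightarrow> z * u = u * z"
    by (rule pos_elem_sqrt) blast
  have "v * b = b * v" unfolding v(2)[symmetric] by (simp add: mult.assoc)
  then have "v * (1 - b) = (1 - b) * v" by (simp add: algebra_simps)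
  then have "v * u = u * v" by (rule u(3))
  then have "norm v \<le> 1"
    using norm_le_of_sum_squares(1)[OF v(1) u(1)] u(2) v(2) by simp
  then have "norm b \<le> 1" using norm_selfadjoint_square[OF v(1)] v(2) by (simp add: power_le_one)
  then show ?thesis using assms(3) by (simp add: b_def)
qed

lemma neumann_inverse:
  fixes x :: "'a::{real_normed_algebra_1, banach}"
  assumes "norm x < 1"
  obtains i where "(1 - x) * i = 1" "i * (1 - x) = 1"
proof -
  have sm: "summable (\<lambda>n. x ^ n)"
    using assms by (intro summable_comparison_test'[OF summable_geometric[of "norm x"], of 0])
      (auto simp: norm_power_ineq)
  have "(\<lambda>n. x ^ n) \<longlonglongrightarrow> 0" using sm by (rule summable_LIMSEQ_zero)
  then have sums: "(\<lambda>n. x ^ n - x ^ Suc n) sums (x ^ 0 - 0)" by (rule telescope_sums')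
  have "(\<lambda>n. (1 - x) * x ^ n) sums ((1 - x) * suminf (\<lambda>n. x ^ n))"
    using sm by (intro sums_mult summable_sums)
  then have "(1 - x) * suminf (\<lambda>n. x ^ n) = 1"
    using sums by (auto simp: left_diff_distrib dest: sums_unique2)
  moreover have "(\<lambda>n. x ^ n * (1 - x)) sums (suminf (\<lambda>n. x ^ n) * (1 - x))"
    using sm by (intro sums_mult2 summable_sums)
  then have "suminf (\<lambda>n. x ^ n) * (1 - x) = 1"
    using sums by (auto simp: right_diff_distrib power_commutes dest: sums_unique2)
  ultimately show ?thesis by (rule that)
qed

text \<open>
  After scaling, \<open>a\<close> lies at distance less than \<open>1\<close> from \<open>1\<close>, and the Neumann series applies.
\<close>
lemma pos_elem_inverse:
  fixes a :: "'a::cstar_algebra"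
  assumes pa: "pos_elem (a - \<delta> *\<^sub>R 1)" and d: "\<delta> > 0"
  obtains i where "a * i = 1" "i * a = 1" "star i = i" "pos_elem i"
proof -
  define t where "t = norm a + \<delta>"
  have t: "t > 0" "t \<ge> \<delta>" using d by (simp_all add: t_def add_nonneg_pos)
  have "pos_elem (a - \<delta> *\<^sub>R 1 + \<delta> *\<^sub>R 1)" using pa d by (intro pos_elem_add pos_elem_const) auto
  then have a: "pos_elem a" by simp
  define x where "x = 1 - (1/t) *\<^sub>R a"
  have "x = (1/t) *\<^sub>R (t *\<^sub>R 1 - a)" using t by (simp add: x_def algebra_simps)
  then have px: "pos_elem x"
    using t d pos_elem_star[OF a] by (auto intro!: pos_elem_scaleR pos_elem_norm_minus simp: t_def)
  have nx: "norm x < 1"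
  proof (cases "t = \<delta>")
    case True
    then have "a = 0" by (simp add: t_def)
    then have "pos_elem (- (1::'a))"
      using pos_elem_scaleR[OF pa, of "1/\<delta>"] d by simp
    then have "(1::'a) = 0" using ball_pos_antisym pos_elem_iff_ball_pos pos_elem_one by blast
    then show ?thesis by simp
  next
    case False
    have "(1 - \<delta>/t) *\<^sub>R 1 - x = (1/t) *\<^sub>R (a - \<delta> *\<^sub>R 1)"
      using t by (simp add: x_def algebra_simps)
    then have "pos_elem ((1 - \<delta>/t) *\<^sub>R 1 - x)" using pa t by (simp add: pos_elem_scaleR)
    then have "norm x \<le> 1 - \<delta>/t" using px False t d by (intro norm_le_of_pos_elem) auto
    then show ?thesis using d t by (smt (verit) divide_pos_pos)
  qed
  then obtain j where j: "(1 - x) * j = 1" "j * (1 - x) = 1" by (rule neumann_inverse)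
  define i where "i = (1/t) *\<^sub>R j"
  have i: "a * i = 1" "i * a = 1" using j by (simp_all add: i_def x_def)
  have "star i * a = 1" using i(1) pos_elem_star[OF a] by (metis star_mult star_one)
  then have si: "star i = i" using i(1) by (metis mult.assoc mult.left_neutral mult.right_neutral)
  have "star i * a * i = i" by (simp add: si i(2))
  then have "pos_elem i" using pos_elem_conj[OF a, of i] by simp
  then show ?thesis using that i si by blast
qed

lemma star_im_part: "star (im_part w) = im_part (w :: 'a::cstar_algebra)"
proof -
  have "cnj (1 / (2 * \<i>)) = - (1 / (2 * \<i>))" by simp
  then show ?thesis unfolding im_part_def star_scaleC by (simp add: star_diff star_star scaleC_diff_right)
qed

lemma im_part_diff: "im_part (a - b :: 'a::cstar_algebra) = im_part a - im_part b"
  by (simp add: im_part_def star_diff scaleC_diff_right)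

lemma tendsto_im_part: "((f :: 'b \<Rightarrow> 'a::cstar_algebra) \<longlongrightarrow> l) F \<Longrightarrow> ((\<lambda>x. im_part (f x)) \<longlongrightarrow> im_part l) F"
  unfolding im_part_def by (intro tendsto_scaleC tendsto_diff tendsto_star)

lemma norm_im_part_le: "norm (im_part w) \<le> norm (w :: 'a::cstar_algebra)"
  using norm_triangle_ineq4[of w "star w"] by (simp add: im_part_def norm_scaleC norm_divide norm_mult)

text \<open>
  Both identities expand \<open>H (w - w\<^sup>*) H\<^sup>* = H\<^sup>* - H = H\<^sup>* (w - w\<^sup>*) H\<close>. The first is used for the upper left
  and the second for the lower right corner of a block.
\<close>
lemma im_part_inverse:
  fixes w H :: "'a::cstar_algebra"
  assumes "w * H = 1" "H * w = 1"
  shows "- im_part H = H * im_part w * star H" "- im_part H = star H * im_part w * H"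
proof -
  have s: "star H * star w = 1" "star w * star H = 1"
    using assms by (simp_all flip: star_mult)
  have e: "H * (c *\<^sub>C u) * v = c *\<^sub>C (H * u * v)" "star H * (c *\<^sub>C u) * v = c *\<^sub>C (star H * u * v)" for c and u v :: 'a
    by (simp_all add: mult_scaleC_left mult_scaleC_right)
  have "H * (w - star w) * star H = star H - H"
    using assms s by (simp add: left_diff_distrib right_diff_distrib mult.assoc)
  then show "- im_part H = H * im_part w * star H"
    unfolding im_part_def e by (simp add: scaleC_diff_right)
  have "star H * (w - star w) * H = star H - H"
    using assms s by (simp add: left_diff_distrib right_diff_distrib mult.assoc)
  then show "- im_part H = star H * im_part w * H"
    unfolding im_part_def e by (simp add: scaleC_diff_right)
qed

text \<open>
  Expanding \<open>(w - \<i> \<epsilon>)\<^sup>* (w - \<i> \<epsilon>) \<ge> 0\<close> gives \<open>w\<^sup>* w \<ge> 2 \<epsilon> Im w - \<epsilon>\<^sup>2 \<ge> \<epsilon>\<^sup>2\<close>, and \<open>w w\<^sup>*\<close> is treated in the same way.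
\<close>
lemma upper_half_inverse:
  fixes w :: "'a::cstar_algebra"
  assumes pw: "pos_elem (im_part w - \<epsilon> *\<^sub>R 1)" and e: "\<epsilon> > 0"
  obtains H where "w * H = 1" "H * w = 1" "norm H \<le> 1 / \<epsilon>"
proof -
  define k :: 'a where "k = (\<i> * \<epsilon>) *\<^sub>C 1"
  define v where "v = w - k"
  have sv: "star v = star w + k" by (simp add: v_def k_def star_diff star_scaleC)
  have k: "x * k = (\<i> * \<epsilon>) *\<^sub>C x" "k * x = (\<i> * \<epsilon>) *\<^sub>C x" for x
    by (simp_all add: k_def mult_scaleC_left mult_scaleC_right)
  have im2: "(2 * \<epsilon>) *\<^sub>R im_part w = k * star w - k * w"
    unfolding k im_part_def scaleR_scaleC scaleC_scaleC by (simp add: scaleC_diff_right field_simps)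
  have kk: "k * k = - (\<epsilon>\<^sup>2 *\<^sub>R 1)"
  proof -
    have "(\<i> * \<epsilon>) * (\<i> * \<epsilon>) = complex_of_real (- (\<epsilon>\<^sup>2))"
      by (simp add: complex_eq_iff power2_eq_square)
    then have "k * k = complex_of_real (- (\<epsilon>\<^sup>2)) *\<^sub>C 1"
      unfolding k(1) by (simp only: k_def scaleC_scaleC)
    then show ?thesis by (simp only: scaleR_minus_left flip: scaleR_scaleC)
  qed
  have p: "pos_elem ((2 * \<epsilon>) *\<^sub>R (im_part w - \<epsilon> *\<^sub>R 1))" using pw e by (intro pos_elem_scaleR) auto
  have wk: "w * k = k * w" "star w * k = k * star w" by (simp_all add: k)
  have ee: "(2 * \<epsilon>) *\<^sub>R (im_part w - \<epsilon> *\<^sub>R 1) = k * star w - k * w - \<epsilon>\<^sup>2 *\<^sub>R 1 - \<epsilon>\<^sup>2 *\<^sub>R 1"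
    unfolding scaleR_diff_right im2 by (simp add: power2_eq_square scaleR_2 flip: scaleR_scaleR)
  have "star w * w - \<epsilon>\<^sup>2 *\<^sub>R 1 = star v * v + (2 * \<epsilon>) *\<^sub>R (im_part w - \<epsilon> *\<^sub>R 1)"
    unfolding sv ee unfolding v_def by (simp add: left_diff_distrib right_diff_distrib distrib_left distrib_right kk wk)
  then have p1: "pos_elem (star w * w - \<epsilon>\<^sup>2 *\<^sub>R 1)"
    using p by (simp only: pos_elem_add pos_elem_star_mult)
  have "w * star w - \<epsilon>\<^sup>2 *\<^sub>R 1 = v * star v + (2 * \<epsilon>) *\<^sub>R (im_part w - \<epsilon> *\<^sub>R 1)"
    unfolding sv ee unfolding v_def by (simp add: left_diff_distrib right_diff_distrib distrib_left distrib_right kk wk)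
  then have p2: "pos_elem (w * star w - \<epsilon>\<^sup>2 *\<^sub>R 1)"
    using p by (simp only: pos_elem_add pos_elem_mult_star)
  have e2: "\<epsilon>\<^sup>2 > 0" using e by simp
  obtain i where i: "i * (star w * w) = 1" using pos_elem_inverse[OF p1 e2] by blast
  obtain j where j: "(w * star w) * j = 1" using pos_elem_inverse[OF p2 e2] by blast
  define H where "H = i * star w"
  have Hw: "H * w = 1" using i by (simp add: H_def mult.assoc)
  have "H = H * (w * (star w * j))" using j by (simp add: mult.assoc)
  also have "\<dots> = star w * j" using Hw by (simp add: mult.assoc[symmetric])
  finally have wH: "w * H = 1" using j by (simp add: mult.assoc)
  have "star H * (star w * w - \<epsilon>\<^sup>2 *\<^sub>R 1) * H = star (w * H) * (w * H) - \<epsilon>\<^sup>2 *\<^sub>R (star H * H)"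
    by (simp add: star_mult algebra_simps)
  then have "pos_elem (1 - \<epsilon>\<^sup>2 *\<^sub>R (star H * H))"
    using pos_elem_conj[OF p1, of H] by (simp add: wH)
  then have "norm (\<epsilon>\<^sup>2 *\<^sub>R (star H * H)) \<le> 1"
    using e by (intro norm_le_of_pos_elem pos_elem_scaleR pos_elem_star_mult) auto
  then have "(\<epsilon> * norm H)\<^sup>2 \<le> 1" by (simp add: norm_star_mult power_mult_distrib)
  then have "\<epsilon> * norm H \<le> 1" using power2_le_imp_le[of "\<epsilon> * norm H" 1] by simp
  then show ?thesis using e by (intro that[OF wH Hw]) (simp add: field_simps)
qed

section \<open>Positive two by two blocks and 2-positive maps\<close>

text \<open>
  Positivity of the matrix with rows \<open>(a, r)\<close> and \<open>(r\<^sup>*, d)\<close> as a \<open>B\<close>-valued quadratic form. Sums, limits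
  and congruences of such matrices are controlled by the corresponding facts in \<open>B\<close> itself, whereas
  for \<^const>\<open>pos_mat\<close> they would require the norm of the matrix algebra.
\<close>
definition pos_block :: "'a::cstar_algebra \<Rightarrow> 'a \<Rightarrow> 'a \<Rightarrow> bool" where
  "pos_block a r d \<longleftrightarrow>
     (\<forall>x y. pos_elem (star x * a * x + star x * r * y + star y * star r * x + star y * d * y))"

lemma pos_blockD:
  "pos_block a r d \<Longrightarrow> pos_elem (star x * a * x + star x * r * y + star y * star r * x + star y * d * y)"
  by (simp add: pos_block_def)

lemma pos_block_diag: "pos_block a r d \<Longrightarrow> pos_elem a" "pos_block a r d \<Longrightarrow> pos_elem d"
  using pos_blockD[of a r d 1 0] pos_blockD[of a r d 0 1] by simp_all

lemma pos_block_add: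
  "pos_block a r d \<Longrightarrow> pos_block a' r' d' \<Longrightarrow> pos_block (a + a') (r + r') (d + d')"
  unfolding pos_block_def
proof (intro allI)
  fix x y
  assume "\<forall>x y. pos_elem (star x * a * x + star x * r * y + star y * star r * x + star y * d * y)"
    "\<forall>x y. pos_elem (star x * a' * x + star x * r' * y + star y * star r' * x + star y * d' * y)"
  then have "pos_elem ((star x * a * x + star x * r * y + star y * star r * x + star y * d * y)
     + (star x * a' * x + star x * r' * y + star y * star r' * x + star y * d' * y))"
    by (blast intro: pos_elem_add)
  then show "pos_elem (star x * (a + a') * x + star x * (r + r') * y + star y * star (r + r') * x + star y * (d + d') * y)"
    by (simp add: algebra_simps star_add)
qed

lemma pos_block_diagonal: "pos_elem a \<Longrightarrow> pos_elem d \<Longrightarrow> pos_block a 0 d"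
  by (simp add: pos_block_def pos_elem_add pos_elem_conj)

lemma pos_block_mono:
  assumes "pos_block a r d" "pos_elem (a' - a)" "pos_elem (d' - d)"
  shows "pos_block a' r d'"
  using pos_block_add[OF assms(1) pos_block_diagonal[OF assms(2,3)]] by simp

lemma pos_block_conj:
  assumes "pos_block a r d"
  shows "pos_block (H * a * star H) (H * r * K) (star K * d * K)"
  unfolding pos_block_def
proof (intro allI)
  fix x y
  show "pos_elem (star x * (H * a * star H) * x + star x * (H * r * K) * y
      + star y * star (H * r * K) * x + star y * (star K * d * K) * y)"
    using pos_blockD[OF assms, of "star H * x" "K * y"] by (simp add: star_mult star_star mult.assoc)
qed

lemma pos_block_closed:
  fixes f g h :: "nat \<Rightarrow> 'a::cstar_algebra"
  assumes "f \<longlonglongrightarrow> a" "g \<longlonglongrightarrow> r" "h \<longlonglongrightarrow> d" "\<And>n. pos_block (f n) (g n) (h n)"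
  shows "pos_block a r d"
  unfolding pos_block_def
proof (intro allI)
  fix x y
  show "pos_elem (star x * a * x + star x * r * y + star y * star r * x + star y * d * y)"
  proof (rule pos_elem_closed[OF sequentially_bot])
    show "(\<lambda>n. star x * f n * x + star x * g n * y + star y * star (g n) * x + star y * h n * y)
        \<longlonglongrightarrow> star x * a * x + star x * r * y + star y * star r * x + star y * d * y"
      by (intro tendsto_add tendsto_mult tendsto_const tendsto_star assms(1-3))
    show "\<forall>\<^sub>F n in sequentially.
        pos_elem (star x * f n * x + star x * g n * y + star y * star (g n) * x + star y * h n * y)"
      by (intro always_eventually allI pos_blockD assms(4))
  qed
qed

text \<open>
  Completing the square with \<open>v = k x + r y\<close>, the form is \<open>k\<^sup>-\<^sup>1 (v\<^sup>* v + y\<^sup>* (k\<^sup>2 - r\<^sup>* r) y)\<close>.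
\<close>
lemma pos_block_norm:
  fixes r :: "'a::cstar_algebra"
  assumes "norm r \<le> k"
  shows "pos_block (k *\<^sub>R 1) r (k *\<^sub>R 1)"
proof (cases "k = 0")
  case True
  with assms have "r = 0" by simp
  then show ?thesis unfolding True by (simp add: pos_block_diagonal)
next
  case False
  then have k: "k > 0" using assms norm_ge_zero[of r] by linarith
  show ?thesis unfolding pos_block_def
  proof (intro allI)
    fix x y
    define v where "v = k *\<^sub>R x + r * y"
    have "(norm r)\<^sup>2 \<le> k\<^sup>2" using assms by (simp add: power_mono)
    then have "pos_elem (k\<^sup>2 *\<^sub>R 1 - star r * r)"
      by (intro pos_elem_norm_minus) (simp_all add: star_mult star_star norm_star_mult)
    then have "pos_elem ((1/k) *\<^sub>R (star v * v + star y * (k\<^sup>2 *\<^sub>R 1 - star r * r) * y))"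
      using k by (intro pos_elem_scaleR pos_elem_add pos_elem_star_mult pos_elem_conj) auto
    moreover have "star v * v + star y * (k\<^sup>2 *\<^sub>R 1 - star r * r) * y
        = k *\<^sub>R (star x * (k *\<^sub>R 1) * x + star x * r * y + star y * star r * x + star y * (k *\<^sub>R 1) * y)"
      by (simp add: v_def star_add star_mult algebra_simps power2_eq_square)
    ultimately show "pos_elem (star x * (k *\<^sub>R 1) * x + star x * r * y + star y * star r * x + star y * (k *\<^sub>R 1) * y)"
      using k by simp
  qed
qed

text \<open>
  The form is evaluated at \<open>x = - k\<^sup>-\<^sup>1 r\<close> and \<open>y = 1\<close>, where it equals \<open>k\<^sup>-\<^sup>1 (k\<^sup>2 - r\<^sup>* r)\<close>.
\<close>
lemma norm_le_of_pos_block: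
  fixes r :: "'a::cstar_algebra"
  assumes r: "pos_block (k *\<^sub>R 1) r (k *\<^sub>R 1)" and k: "k > 0"
  shows "norm r \<le> k"
proof -
  have "pos_elem (k *\<^sub>R (star (- ((1/k) *\<^sub>R r)) * (k *\<^sub>R 1) * (- ((1/k) *\<^sub>R r)) + star (- ((1/k) *\<^sub>R r)) * r * 1
      + star 1 * star r * (- ((1/k) *\<^sub>R r)) + star 1 * (k *\<^sub>R 1) * 1))"
    using k by (intro pos_elem_scaleR pos_blockD[OF r]) auto
  then have "pos_elem (k\<^sup>2 *\<^sub>R 1 - star r * r)"
    using k by (simp add: algebra_simps power2_eq_square)
  then have "norm (star r * r) \<le> k\<^sup>2"
    using k by (intro norm_le_of_pos_elem pos_elem_star_mult) auto
  then show ?thesis using k power2_le_imp_le[of "norm r" k] by (simp add: norm_star_mult)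
qed

definition block :: "'a \<Rightarrow> 'a \<Rightarrow> 'a \<Rightarrow> 'a::cstar_algebra ^ 2 ^ 2" where
  "block a r d = (\<chi> i j. if i = 1 then if j = 1 then a else r else if j = 1 then star r else d)"

text \<open>
  Completing the square: with \<open>u = sqrt a\<close> the matrix is \<open>X\<^sup>* X\<close> for
  \<open>X = (u, u\<^sup>-\<^sup>1 r; 0, v)\<close>, where \<open>v\<^sup>2 = d - r\<^sup>* a\<^sup>-\<^sup>1 r\<close> is the Schur complement.
\<close>
lemma pos_mat_of_pos_block:
  fixes a r d :: "'a::cstar_algebra"
  assumes ard: "pos_block a r d" and a: "pos_elem (a - \<delta> *\<^sub>R 1)" "\<delta> > 0"
  shows "pos_mat (block a r d)"
proof -
  obtain i where i: "a * i = 1" "i * a = 1" "star i = i" "pos_elem i"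
    using a by (rule pos_elem_inverse)
  obtain w where w: "star w = w" "w * w = i"
    using i(4) by (rule pos_elem_sqrt) blast
  have sa: "star a = a" using pos_block_diag(1)[OF ard] by (rule pos_elem_star)
  have "pos_elem (star (- (i * r)) * a * (- (i * r)) + star (- (i * r)) * r * 1
      + star 1 * star r * (- (i * r)) + star 1 * d * 1)"
    by (rule pos_blockD[OF ard])
  moreover have "star r * (i * (a * (i * r))) = star r * (i * r)"
    using i(1) by (metis mult.assoc mult.left_neutral)
  ultimately have "pos_elem (d - star r * i * r)" by (simp add: star_mult i(3) mult.assoc)
  then obtain v where v: "star v = v" "v * v = d - star r * i * r" by (rule pos_elem_sqrt) blast
  define X :: "'a^2^2" where
    "X = (\<chi> i j. if i = 1 then if j = 1 then w * a else w * r else if j = 1 then 0 else v)"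
  have "block a r d = mat_star X ** X"
  proof -
    have sw: "star (w * x) * (w * y) = star x * i * y" for x y
      by (simp only: star_mult w(1) mult.assoc flip: w(2))
    have e1: "star (w * a) * (w * a) = a" by (simp add: sw sa i)
    have e2: "star (w * a) * (w * r) = r" by (simp add: sw sa i)
    have e3: "star (w * r) * (w * a) = star r" by (simp add: sw i mult.assoc)
    have e4: "star (w * r) * (w * r) + star v * v = d" by (simp add: sw v)
    show ?thesis
      by (simp add: vec_eq_iff forall_2 block_def mat_star_def matrix_matrix_mult_def X_def sum_2 e1 e2 e3 e4)
  qed
  then show ?thesis unfolding pos_mat_def by blast
qed

lemma pos_block_of_pos_mat:
  fixes A :: "'a::cstar_algebra ^ 2 ^ 2"
  assumes "pos_mat A" and ard: "a = A $ 1 $ 1" "r = A $ 1 $ 2" "d = A $ 2 $ 2"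
  shows "pos_block a r d"
proof -
  obtain X where A: "A = mat_star X ** X" using assms(1) by (auto simp: pos_mat_def)
  define p where "p = X $ 1 $ 1"
  define q where "q = X $ 1 $ 2"
  define s where "s = X $ 2 $ 1"
  define t where "t = X $ 2 $ 2"
  have "a = star p * p + star s * s" "r = star p * q + star s * t" "d = star q * q + star t * t"
    by (simp_all add: ard A mat_star_def matrix_matrix_mult_def sum_2 p_def q_def s_def t_def)
  moreover have "pos_elem (star (p * x + q * y) * (p * x + q * y) + star (s * x + t * y) * (s * x + t * y))" for x y
    by (intro pos_elem_add pos_elem_star_mult)
  ultimately show ?thesis
    unfolding pos_block_def by (simp add: star_add star_mult star_star algebra_simps)
qed

lemma clinear_add: "clinear f \<Longrightarrow> f (x + y) = f x + f y"
  and clinear_scaleC: "clinear f \<Longrightarrow> f (c *\<^sub>C x) = c *\<^sub>C f x"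
  by (simp_all add: clinear_def)

lemma clinear_scaleR: "clinear f \<Longrightarrow> f (r *\<^sub>R x) = r *\<^sub>R f x"
  by (simp add: clinear_scaleC scaleR_scaleC)

lemma clinear_minus: "clinear f \<Longrightarrow> f (- x) = - f x"
  using clinear_scaleR[of f "-1" x] by simp

lemma clinear_diff: "clinear f \<Longrightarrow> f (x - y) = f x - f y"
  using clinear_add[of f x "- y"] by (simp add: clinear_minus)

text \<open>
  The property of 2-positive maps on which the whole argument rests. Unlike 2-positivity in the
  form of \<^const>\<open>two_positive_maps\<close>, it evidently passes to convex combinations, and the segment between
  two maps is needed for the second estimate.
\<close>
definition block_positive :: "('a::cstar_algebra \<Rightarrow> 'a) \<Rightarrow> bool" where
  "block_positive \<eta> \<longleftrightarrow>
     clinear \<eta> \<and> (\<forall>a r d. pos_block a r d \<longrightarrow> pos_block (\<eta> a) (\<eta> r) (\<eta> d))"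

text \<open>
  Adding \<open>1 / n\<close> to the upper left corner makes the matrix positive in the sense of \<^const>\<open>pos_mat\<close>; the
  amplification keeps it positive, and then \<open>n\<close> tends to infinity.
\<close>
lemma block_positive_of_two_positive:
  fixes \<eta> :: "'a::cstar_algebra \<Rightarrow> 'a"
  assumes "\<eta> \<in> two_positive_maps"
  shows "block_positive \<eta>"
  unfolding block_positive_def
proof (intro conjI allI impI)
  show lin: "clinear \<eta>" using assms by (simp add: two_positive_maps_def)
  fix a r d :: 'a assume ard: "pos_block a r d"
  let ?e = "\<lambda>n. inverse (real (Suc n))"
  have e: "?e \<longlonglongrightarrow> 0" by (rule LIMSEQ_inverse_real_of_nat)
  show "pos_block (\<eta> a) (\<eta> r) (\<eta> d)"
  proof (rule pos_block_closed)
    show "(\<lambda>n. \<eta> (a + ?e n *\<^sub>R 1)) \<longlonglongrightarrow> \<eta> a"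
      unfolding clinear_add[OF lin] clinear_scaleR[OF lin]
      using tendsto_add[OF tendsto_const tendsto_scaleR[OF e tendsto_const], of "\<eta> a" "\<eta> 1"] by simp
    show "(\<lambda>n. \<eta> r) \<longlonglongrightarrow> \<eta> r" "(\<lambda>n. \<eta> d) \<longlonglongrightarrow> \<eta> d" by simp_all
    fix n
    have "pos_block (a + ?e n *\<^sub>R 1) r d"
      using ard by (rule pos_block_mono) (simp_all add: pos_elem_const)
    then have "pos_mat (block (a + ?e n *\<^sub>R 1) r d)"
      by (rule pos_mat_of_pos_block[of _ _ _ "?e n"]) (use pos_block_diag(1)[OF ard] in simp_all)
    then have "pos_mat (amplification \<eta> (block (a + ?e n *\<^sub>R 1) r d))"
      using assms by (simp add: two_positive_maps_def)
    then show "pos_block (\<eta> (a + ?e n *\<^sub>R 1)) (\<eta> r) (\<eta> d)"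
      by (rule pos_block_of_pos_mat) (simp_all add: amplification_def block_def)
  qed
qed

lemma pos_block_scaleR:
  assumes "pos_block a r d" "k \<ge> 0"
  shows "pos_block (k *\<^sub>R a) (k *\<^sub>R r) (k *\<^sub>R d)"
  unfolding pos_block_def
proof (intro allI)
  fix x y
  have "pos_elem (k *\<^sub>R (star x * a * x + star x * r * y + star y * star r * x + star y * d * y))"
    by (intro pos_elem_scaleR pos_blockD assms)
  then show "pos_elem (star x * (k *\<^sub>R a) * x + star x * (k *\<^sub>R r) * y + star y * star (k *\<^sub>R r) * x + star y * (k *\<^sub>R d) * y)"
    by (simp add: scaleR_add_right)
qed

lemma block_positive_convex:
  fixes \<eta> \<eta>' :: "'a::cstar_algebra \<Rightarrow> 'a"
  assumes e: "block_positive \<eta>" "block_positive \<eta>'" and st: "s \<ge> 0" "t \<ge> 0"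
  shows "block_positive (\<lambda>b. s *\<^sub>R \<eta> b + t *\<^sub>R \<eta>' b)"
  unfolding block_positive_def
proof (intro conjI allI impI)
  have lin: "clinear \<eta>" "clinear \<eta>'" using e by (simp_all add: block_positive_def)
  show "clinear (\<lambda>b. s *\<^sub>R \<eta> b + t *\<^sub>R \<eta>' b)"
    unfolding clinear_def by (simp add: clinear_add[OF lin(1)] clinear_add[OF lin(2)] clinear_scaleC[OF lin(1)]
        clinear_scaleC[OF lin(2)] scaleR_add_right scaleC_add_right scaleC_scaleR)
  fix a r d :: 'a assume "pos_block a r d"
  then show "pos_block (s *\<^sub>R \<eta> a + t *\<^sub>R \<eta>' a) (s *\<^sub>R \<eta> r + t *\<^sub>R \<eta>' r) (s *\<^sub>R \<eta> d + t *\<^sub>R \<eta>' d)"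
    using e st by (intro pos_block_add pos_block_scaleR) (auto simp: block_positive_def)
qed

locale block_positive_map =
  fixes \<eta> :: "'a::cstar_algebra \<Rightarrow> 'a"
  assumes block_positive: "block_positive \<eta>"
begin

lemma linear: "clinear \<eta>"
  using block_positive by (simp add: block_positive_def)

lemmas add = clinear_add[OF linear] and scaleC = clinear_scaleC[OF linear]
  and scaleR = clinear_scaleR[OF linear] and minus = clinear_minus[OF linear] and diff = clinear_diff[OF linear]

lemma pos_block_apply: "pos_block a r d \<Longrightarrow> pos_block (\<eta> a) (\<eta> r) (\<eta> d)"
  using block_positive by (simp add: block_positive_def)

lemma pos_elem_apply: "pos_elem a \<Longrightarrow> pos_elem (\<eta> a)"
  using pos_block_diag(1)[OF pos_block_apply[OF pos_block_diagonal[of a a]]] by simp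

lemma star_apply_selfadjoint:
  assumes "star a = a"
  shows "star (\<eta> a) = \<eta> a"
proof -
  have "pos_elem (\<eta> (norm a *\<^sub>R 1))" "pos_elem (\<eta> (norm a *\<^sub>R 1 - a))"
    using assms by (auto intro!: pos_elem_apply pos_elem_const pos_elem_norm_minus)
  then have "star (\<eta> (norm a *\<^sub>R 1) - \<eta> (norm a *\<^sub>R 1 - a)) = \<eta> (norm a *\<^sub>R 1) - \<eta> (norm a *\<^sub>R 1 - a)"
    by (simp only: star_diff pos_elem_star)
  then show ?thesis by (simp flip: diff)
qed

lemma star: "\<eta> (star r) = star (\<eta> r)"
proof -
  have "star (\<eta> (r + star r)) = \<eta> (r + star r)"
    by (rule star_apply_selfadjoint) (simp add: star_add star_star add.commute)
  then have 1: "star (\<eta> r) + star (\<eta> (star r)) = \<eta> r + \<eta> (star r)" by (simp add: add star_add)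
  have "star (\<eta> (\<i> *\<^sub>C (r - star r))) = \<eta> (\<i> *\<^sub>C (r - star r))"
    by (rule star_apply_selfadjoint) (simp add: star_diff star_star star_scaleC scaleC_diff_right)
  then have "\<i> *\<^sub>C (- (star (\<eta> r) - star (\<eta> (star r)))) = \<i> *\<^sub>C (\<eta> r - \<eta> (star r))"
    by (simp add: scaleC diff star_diff star_scaleC del: minus_diff_eq)
  then have "(- \<i>) *\<^sub>C \<i> *\<^sub>C (- (star (\<eta> r) - star (\<eta> (star r)))) = (- \<i>) *\<^sub>C \<i> *\<^sub>C (\<eta> r - \<eta> (star r))"
    by (simp only:)
  then have 2: "- (star (\<eta> r) - star (\<eta> (star r))) = \<eta> r - \<eta> (star r)" by (simp add: scaleC_scaleC del: minus_diff_eq)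
  have "2 *\<^sub>R \<eta> (star r) = (\<eta> r + \<eta> (star r)) - (\<eta> r - \<eta> (star r))" by (simp add: scaleR_2)
  also have "\<dots> = 2 *\<^sub>R star (\<eta> r)" unfolding 1[symmetric] 2[symmetric] by (simp add: scaleR_2)
  finally show ?thesis by simp
qed

lemma im_part: "\<eta> (im_part a) = im_part (\<eta> a)"
  by (simp add: im_part_def scaleC diff minus star)

text \<open>
  The map is applied to the block with corner \<open>b\<close> and diagonal \<open>norm b\<close>.
\<close>
lemma norm_le: "norm (\<eta> b) \<le> norm (\<eta> 1) * norm b"
proof (cases "norm (\<eta> 1) * norm b = 0")
  case False
  then have pos: "norm (\<eta> 1) * norm b > 0" by (simp add: mult_nonneg_nonneg order_less_le)
  have "pos_elem (norm b *\<^sub>R (norm (\<eta> 1) *\<^sub>R 1 - \<eta> 1))"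
    by (intro pos_elem_scaleR pos_elem_norm_minus) (simp_all flip: star)
  then have "pos_elem ((norm (\<eta> 1) * norm b) *\<^sub>R 1 - \<eta> (norm b *\<^sub>R 1))"
    by (simp add: scaleR algebra_simps)
  then have "pos_block ((norm (\<eta> 1) * norm b) *\<^sub>R 1) (\<eta> b) ((norm (\<eta> 1) * norm b) *\<^sub>R 1)"
    using pos_block_mono[OF pos_block_apply[OF pos_block_norm[of b "norm b"]]] by simp
  then show ?thesis using pos by (rule norm_le_of_pos_block)
next
  case True
  have "norm (\<eta> b) \<le> e" if "e > 0" for e
  proof -
    have k: "norm b *\<^sub>R \<eta> 1 = 0" using True by auto
    have "pos_block (e *\<^sub>R 1) (\<eta> b) (e *\<^sub>R 1)"
      using pos_block_mono[OF pos_block_apply[OF pos_block_norm[of b "norm b"]], of "e *\<^sub>R 1" "e *\<^sub>R 1"] that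
      by (simp add: scaleR k pos_elem_const)
    then show ?thesis using that by (rule norm_le_of_pos_block)
  qed
  then have "norm (\<eta> b) \<le> 0" using dense_ge by blast
  then show ?thesis using True by simp
qed

lemma bounded_linear: "bounded_linear \<eta>"
proof (rule bounded_linear_intro[of \<eta> "norm (\<eta> 1)"])
  show "norm (\<eta> x) \<le> norm x * norm (\<eta> 1)" for x using norm_le[of x] by (simp add: mult.commute)
qed (simp_all add: add scaleR)

lemma tendsto: "(f \<longlongrightarrow> l) F \<Longrightarrow> ((\<lambda>x. \<eta> (f x)) \<longlongrightarrow> \<eta> l) F"
  by (rule bounded_linear.tendsto[OF bounded_linear])

end

section \<open>The Dyson equation\<close>

lemma pos_block_of_strict:
  fixes r :: "'a::cstar_algebra"
  assumes "pos_elem (a - \<delta> *\<^sub>R 1)" "pos_elem (d - \<delta> *\<^sub>R 1)" "norm r \<le> K * \<delta>" "K \<ge> 0"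
  shows "pos_block (K *\<^sub>R a) r (K *\<^sub>R d)"
proof (rule pos_block_mono[OF pos_block_norm[OF assms(3)]])
  have "pos_elem (K *\<^sub>R (a - \<delta> *\<^sub>R 1))" "pos_elem (K *\<^sub>R (d - \<delta> *\<^sub>R 1))"
    by (intro pos_elem_scaleR assms)+
  then show "pos_elem (K *\<^sub>R a - (K * \<delta>) *\<^sub>R 1)" "pos_elem (K *\<^sub>R d - (K * \<delta>) *\<^sub>R 1)"
    by (simp_all add: scaleR_diff_right)
qed

lemma norm_le_of_pos_block_norm:
  fixes r :: "'a::cstar_algebra"
  assumes b: "pos_block a r d" and k: "norm a \<le> k" "norm d \<le> k" "k \<ge> 0"
  shows "norm r \<le> k"
proof -
  have "norm r \<le> k + e" if "e > 0" for e
  proof (rule norm_le_of_pos_block)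
    show "pos_block ((k + e) *\<^sub>R 1) r ((k + e) *\<^sub>R 1)"
      using b by (rule pos_block_mono)
        (use k that in \<open>auto intro!: pos_elem_norm_minus pos_elem_star pos_block_diag[OF b]\<close>)
  qed (use k that in auto)
  then show ?thesis by (rule field_le_epsilon)
qed

text \<open>
  From \<open>H (w w\<^sup>*) H\<^sup>* = 1\<close> and \<open>w w\<^sup>* \<le> M\<^sup>2\<close> one gets \<open>H H\<^sup>* \<ge> M\<^sup>-\<^sup>2\<close>, and \<open>- Im H = H (Im w) H\<^sup>* \<ge> \<epsilon> H H\<^sup>*\<close>.
\<close>
lemma im_part_inverse_strict:
  fixes w H :: "'a::cstar_algebra"
  assumes wH: "w * H = 1" "H * w = 1" and pw: "pos_elem (im_part w - \<epsilon> *\<^sub>R 1)" and e: "\<epsilon> > 0"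
    and M: "norm w \<le> M" "M > 0"
  shows "pos_elem (- im_part H - (\<epsilon> / M\<^sup>2) *\<^sub>R 1)"
proof -
  have "(norm w)\<^sup>2 \<le> M\<^sup>2" using M by (simp add: power_mono)
  moreover have "norm (w * star w) = (norm w)\<^sup>2" using norm_star_mult[of "star w"] by (simp add: star_star)
  ultimately have "pos_elem (M\<^sup>2 *\<^sub>R 1 - w * star w)"
    by (intro pos_elem_norm_minus) (simp_all add: star_mult star_star)
  then have "pos_elem (H * (M\<^sup>2 *\<^sub>R 1 - w * star w) * star H)" by (rule pos_elem_conj')
  moreover have "H * (w * star w) * star H = 1"
    using wH by (metis mult.assoc mult.left_neutral star_mult star_one)
  ultimately have "pos_elem (M\<^sup>2 *\<^sub>R (H * star H) - 1)" by (simp add: left_diff_distrib right_diff_distrib)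
  then have "pos_elem ((\<epsilon> / M\<^sup>2) *\<^sub>R (M\<^sup>2 *\<^sub>R (H * star H) - 1))" using e by (intro pos_elem_scaleR) auto
  moreover have "pos_elem (H * (im_part w - \<epsilon> *\<^sub>R 1) * star H)" using pw by (rule pos_elem_conj')
  ultimately have "pos_elem (H * (im_part w - \<epsilon> *\<^sub>R 1) * star H + (\<epsilon> / M\<^sup>2) *\<^sub>R (M\<^sup>2 *\<^sub>R (H * star H) - 1))"
    by (rule pos_elem_add[rotated])
  moreover have "H * (im_part w - \<epsilon> *\<^sub>R 1) * star H + (\<epsilon> / M\<^sup>2) *\<^sub>R (M\<^sup>2 *\<^sub>R (H * star H) - 1)
      = - im_part H - (\<epsilon> / M\<^sup>2) *\<^sub>R 1"
    using M im_part_inverse(1)[OF wH] by (simp add: left_diff_distrib right_diff_distrib scaleR_diff_right)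
  ultimately show ?thesis by simp
qed

lemma upper_half_iff: "b \<in> upper_half \<longleftrightarrow> (\<exists>\<epsilon>>0. pos_elem (im_part b - \<epsilon> *\<^sub>R 1))"
  by (simp add: upper_half_def cs_le_def)

lemma lower_half_iff: "b \<in> lower_half \<longleftrightarrow> (\<exists>\<epsilon>>0. pos_elem (- im_part b - \<epsilon> *\<^sub>R 1))"
  by (simp add: lower_half_def cs_le_def)

lemma pos_elem_of_strict: "pos_elem (a - \<epsilon> *\<^sub>R 1) \<Longrightarrow> \<epsilon> \<ge> 0 \<Longrightarrow> pos_elem (a :: 'a::cstar_algebra)"
  using pos_elem_add[OF _ pos_elem_const, of "a - \<epsilon> *\<^sub>R 1" \<epsilon>] by simp

lemma pos_elem_weaken: "pos_elem (a - \<epsilon> *\<^sub>R 1) \<Longrightarrow> \<delta> \<le> \<epsilon> \<Longrightarrow> pos_elem (a - \<delta> *\<^sub>R 1 :: 'a::cstar_algebra)"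
  using pos_elem_add[OF _ pos_elem_const, of "a - \<epsilon> *\<^sub>R 1" "\<epsilon> - \<delta>"] by (simp add: scaleR_diff_left)

text \<open>
  The Dyson equation at a single point \<open>b\<close>; solutions turn out to be unique pointwise.
\<close>
definition dyson_eq :: "('a::cstar_algebra \<Rightarrow> 'a) \<Rightarrow> 'a \<Rightarrow> 'a \<Rightarrow> bool" where
  "dyson_eq \<eta> b G \<longleftrightarrow> G \<in> lower_half \<and> b * G = 1 + \<eta> G * G"

context block_positive_map
begin

lemma im_part_minus_apply:
  assumes "pos_elem (im_part b - \<epsilon> *\<^sub>R 1)" "pos_elem (- im_part G)"
  shows "pos_elem (im_part (b - \<eta> G) - \<epsilon> *\<^sub>R 1)"
  using pos_elem_add[OF assms(1) pos_elem_apply[OF assms(2)]]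
  by (simp add: im_part_diff minus im_part algebra_simps)

text \<open>
  The order-theoretic counterpart of the Schwarz--Pick lemma. The number \<open>K\<close> measures \<open>r\<close> against
  the imaginary parts; passing to \<open>H\<^sub>1 (h + \<eta> r) H\<^sub>0\<close> replaces \<open>\<eta> (- Im G\<^sub>i)\<close> by the larger
  \<open>Im b\<^sub>i + \<eta> (- Im G\<^sub>i)\<close>, and this excess allows a smaller constant.
\<close>
lemma pos_block_step:
  assumes e: "\<epsilon> > 0"
    and b: "pos_elem (im_part b1 - \<epsilon> *\<^sub>R 1)" "pos_elem (im_part b0 - \<epsilon> *\<^sub>R 1)"
    and H1: "(b1 - \<eta> G1) * H1 = 1" "H1 * (b1 - \<eta> G1) = 1"
    and H0: "(b0 - \<eta> G0) * H0 = 1" "H0 * (b0 - \<eta> G0) = 1"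
    and blk: "pos_block (K *\<^sub>R (- im_part G1)) r (K *\<^sub>R (- im_part G0))"
    and L: "norm (\<eta> (im_part G1)) \<le> L" "norm (\<eta> (im_part G0)) \<le> L"
    and K: "norm h \<le> K * \<epsilon>"
    and K': "K' = norm h / \<epsilon> + (K - norm h / \<epsilon>) * (L / (\<epsilon> + L))"
  shows "pos_block (K' *\<^sub>R (- im_part H1)) (H1 * (h + \<eta> r) * H0) (K' *\<^sub>R (- im_part H0))"
proof -
  have L0: "L \<ge> 0" using L(1) norm_ge_zero order.trans by blast
  define t where "t = (K * \<epsilon> - norm h) / (\<epsilon> + L)"
  have t: "t \<ge> 0" using K e L0 by (simp add: t_def)
  have tL: "t * (\<epsilon> + L) = K * \<epsilon> - norm h" using e L0 by (simp add: t_def)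
  have Kt: "K' = K - t" "K' * \<epsilon> - norm h = t * L"
  proof -
    define c where "c = norm h / \<epsilon>"
    have c: "norm h = c * \<epsilon>" using e by (simp add: c_def)
    have "K' * \<epsilon> = norm h + t * L"
      unfolding K' c_def[symmetric] t_def c using e by (simp add: algebra_simps diff_divide_distrib)
    then show "K' * \<epsilon> - norm h = t * L" by simp
    then have "(K' - (K - t)) * \<epsilon> = 0" using tL by (simp add: algebra_simps)
    then show "K' = K - t" using e by simp
  qed
  have "K' * \<epsilon> \<ge> 0" using Kt(2) t L0 by (smt (verit) mult_nonneg_nonneg norm_ge_zero)
  then have K'0: "K' \<ge> 0" using e by (simp add: zero_le_mult_iff)
  have key: "pos_elem (K' *\<^sub>R im_part (b - \<eta> G) - (norm h *\<^sub>R 1 + \<eta> (K *\<^sub>R (- im_part G))))"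
    if "pos_elem (im_part b - \<epsilon> *\<^sub>R 1)" "norm (\<eta> (im_part G)) \<le> L" for b G
  proof -
    have "star (- \<eta> (im_part G)) = - \<eta> (im_part G)" by (simp flip: star add: star_im_part)
    then have "pos_elem (L *\<^sub>R 1 - (- \<eta> (im_part G)))" using that by (intro pos_elem_norm_minus) auto
    then have "pos_elem (K' *\<^sub>R (im_part b - \<epsilon> *\<^sub>R 1) + t *\<^sub>R (L *\<^sub>R 1 - (- \<eta> (im_part G))))"
      using t K'0 that by (intro pos_elem_add pos_elem_scaleR) auto
    moreover have "K' *\<^sub>R (im_part b - \<epsilon> *\<^sub>R 1) + t *\<^sub>R (L *\<^sub>R 1 - (- \<eta> (im_part G)))
       = K' *\<^sub>R im_part (b - \<eta> G) - (norm h *\<^sub>R 1 + \<eta> (K *\<^sub>R (- im_part G)))"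
    proof -
      have "\<eta> (K *\<^sub>R (- im_part G)) = - ((K' + t) *\<^sub>R im_part (\<eta> G))"
        using Kt(1) by (simp only: scaleR minus im_part scaleR_minus_right) simp
      moreover have "norm h *\<^sub>R (1::'a) = (K' * \<epsilon> - t * L) *\<^sub>R 1" using Kt(2) by simp
      ultimately show ?thesis by (simp only:) (simp add: im_part_diff im_part algebra_simps)
    qed
    ultimately show ?thesis by simp
  qed
  have "pos_block (norm h *\<^sub>R 1 + \<eta> (K *\<^sub>R (- im_part G1))) (h + \<eta> r) (norm h *\<^sub>R 1 + \<eta> (K *\<^sub>R (- im_part G0)))"
    by (intro pos_block_add pos_block_norm pos_block_apply blk) simp
  then have "pos_block (H1 * (norm h *\<^sub>R 1 + \<eta> (K *\<^sub>R (- im_part G1))) * star H1) (H1 * (h + \<eta> r) * H0)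
      (star H0 * (norm h *\<^sub>R 1 + \<eta> (K *\<^sub>R (- im_part G0))) * H0)"
    by (rule pos_block_conj)
  then show ?thesis
  proof (rule pos_block_mono)
    have "K' *\<^sub>R (- im_part H1) = H1 * (K' *\<^sub>R im_part (b1 - \<eta> G1)) * star H1"
      unfolding im_part_inverse(1)[OF H1] by simp
    then show "pos_elem (K' *\<^sub>R - im_part H1 - H1 * (norm h *\<^sub>R 1 + \<eta> (K *\<^sub>R - im_part G1)) * star H1)"
      using pos_elem_conj'[OF key[OF b(1) L(1)], of H1] by (simp only: left_diff_distrib right_diff_distrib)
    have "K' *\<^sub>R (- im_part H0) = star H0 * (K' *\<^sub>R im_part (b0 - \<eta> G0)) * H0"
      unfolding im_part_inverse(2)[OF H0] by simp
    then show "pos_elem (K' *\<^sub>R - im_part H0 - star H0 * (norm h *\<^sub>R 1 + \<eta> (K *\<^sub>R - im_part G0)) * H0)"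
      using pos_elem_conj[OF key[OF b(2) L(2)], of H0] by (simp only: left_diff_distrib right_diff_distrib)
  qed
qed

lemma dyson_eq_inverse:
  assumes "dyson_eq \<eta> b G" "pos_elem (im_part b - \<epsilon> *\<^sub>R 1)" "\<epsilon> > 0"
  shows "(b - \<eta> G) * G = 1" "G * (b - \<eta> G) = 1" "norm G \<le> 1 / \<epsilon>"
proof -
  have pG: "pos_elem (- im_part G)"
    using assms(1) pos_elem_of_strict less_imp_le by (auto simp: dyson_eq_def lower_half_iff)
  show 1: "(b - \<eta> G) * G = 1" using assms(1) by (simp add: dyson_eq_def left_diff_distrib)
  obtain H where H: "(b - \<eta> G) * H = 1" "H * (b - \<eta> G) = 1" "norm H \<le> 1 / \<epsilon>"
    using upper_half_inverse[OF im_part_minus_apply[OF assms(2) pG] assms(3)] .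
  have "G = H" using H(2) 1 by (metis mult.assoc mult.left_neutral mult.right_neutral)
  with H show "G * (b - \<eta> G) = 1" "norm G \<le> 1 / \<epsilon>" by simp_all
qed

text \<open>
  Iterating the step with \<open>H\<^sub>i = G\<^sub>i\<close> drives the constant \<open>K\<close> down to its fixed point \<open>norm h / \<epsilon>\<close>.
\<close>
lemma dyson_linear_bound:
  assumes G1: "dyson_eq \<eta> b1 G1" and G0: "dyson_eq \<eta> b0 G0"
    and b: "pos_elem (im_part b1 - \<epsilon> *\<^sub>R 1)" "pos_elem (im_part b0 - \<epsilon> *\<^sub>R 1)" and e: "\<epsilon> > 0"
    and r: "r = G1 * (h + \<eta> r) * G0"
  shows "pos_block ((norm h / \<epsilon>) *\<^sub>R (- im_part G1)) r ((norm h / \<epsilon>) *\<^sub>R (- im_part G0))"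
proof -
  define c where "c = norm h / \<epsilon>"
  obtain d1 d0 where d: "d1 > 0" "pos_elem (- im_part G1 - d1 *\<^sub>R 1)" "d0 > 0" "pos_elem (- im_part G0 - d0 *\<^sub>R 1)"
    using G1 G0 by (auto simp: dyson_eq_def lower_half_iff)
  define \<delta> where "\<delta> = min d1 d0"
  define L where "L = max (norm (\<eta> (im_part G1))) (norm (\<eta> (im_part G0)))"
  define q where "q = L / (\<epsilon> + L)"
  have L: "L \<ge> 0" by (simp add: L_def le_max_iff_disj)
  have q: "0 \<le> q" "q < 1" using L e by (simp_all add: q_def)
  have \<delta>: "\<delta> > 0" using d by (simp add: \<delta>_def)
  \<comment> \<open>strict positivity of the imaginary parts provides a first, possibly bad, constant\<close>
  define K0 where "K0 = max c (norm r / \<delta>)"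
  define K where "K n = c + (K0 - c) * q ^ n" for n
  have Kc: "K n \<ge> c" for n using q by (simp add: K_def K0_def)
  have "pos_block (K n *\<^sub>R (- im_part G1)) r (K n *\<^sub>R (- im_part G0))" for n
  proof (induction n)
    case 0
    have "c \<ge> 0" using e by (simp add: c_def)
    then have K00: "K 0 = K0" "K0 \<ge> 0" by (simp_all add: K_def K0_def)
    have "norm r / \<delta> * \<delta> \<le> K0 * \<delta>" using \<delta> by (intro mult_right_mono) (simp_all add: K0_def)
    then have "norm r \<le> K0 * \<delta>" using \<delta> by simp
    moreover have "pos_elem (- im_part G1 - \<delta> *\<^sub>R 1)" "pos_elem (- im_part G0 - \<delta> *\<^sub>R 1)"
      by (rule pos_elem_weaken[OF d(2)] pos_elem_weaken[OF d(4)], simp add: \<delta>_def)+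
    ultimately show ?case unfolding K00(1) using K00(2) by (intro pos_block_of_strict)
  next
    case (Suc n)
    have "norm h \<le> K n * \<epsilon>" using Kc[of n] e by (simp add: c_def field_simps)
    moreover have "norm (\<eta> (im_part G1)) \<le> L" "norm (\<eta> (im_part G0)) \<le> L" by (simp_all add: L_def)
    moreover have "K (Suc n) = norm h / \<epsilon> + (K n - norm h / \<epsilon>) * (L / (\<epsilon> + L))"
      by (simp add: K_def c_def q_def)
    ultimately have "pos_block (K (Suc n) *\<^sub>R (- im_part G1)) (G1 * (h + \<eta> r) * G0) (K (Suc n) *\<^sub>R (- im_part G0))"
      by (intro pos_block_step[OF e b dyson_eq_inverse(1,2)[OF G1 b(1) e] dyson_eq_inverse(1,2)[OF G0 b(2) e] Suc])
    then show ?case by (simp only: r[symmetric])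
  qed
  then have blk: "pos_block (K n *\<^sub>R (- im_part G1)) r (K n *\<^sub>R (- im_part G0))" for n .
  have "K \<longlonglongrightarrow> c + (K0 - c) * 0"
    unfolding K_def using q by (intro tendsto_intros LIMSEQ_power_zero) auto
  then have K: "K \<longlonglongrightarrow> c" by simp
  show ?thesis unfolding c_def[symmetric]
    by (rule pos_block_closed[OF tendsto_scaleR[OF K tendsto_const] tendsto_const tendsto_scaleR[OF K tendsto_const] blk])
qed

text \<open>
  The resolvent identity \<open>w\<^sub>1\<^sup>-\<^sup>1 - w\<^sub>0\<^sup>-\<^sup>1 = w\<^sub>1\<^sup>-\<^sup>1 (w\<^sub>0 - w\<^sub>1) w\<^sub>0\<^sup>-\<^sup>1\<close> for \<open>w\<^sub>i = b\<^sub>i - \<eta> G\<^sub>i\<close>. It is exact and linear in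
  \<open>G\<^sub>1 - G\<^sub>0\<close> for fixed factors \<open>G\<^sub>i\<close>.
\<close>
lemma dyson_diff:
  assumes G1: "dyson_eq \<eta> b1 G1" and G0: "dyson_eq \<eta> b0 G0"
    and b: "pos_elem (im_part b1 - \<epsilon> *\<^sub>R 1)" "pos_elem (im_part b0 - \<epsilon> *\<^sub>R 1)" and e: "\<epsilon> > 0"
  shows "G1 - G0 = G1 * ((b0 - b1) + \<eta> (G1 - G0)) * G0"
proof -
  have "G1 * ((b0 - \<eta> G0) - (b1 - \<eta> G1)) * G0 = G1 * ((b0 - \<eta> G0) * G0) - (G1 * (b1 - \<eta> G1)) * G0"
    by (simp add: left_diff_distrib right_diff_distrib mult.assoc)
  also have "\<dots> = G1 - G0"
    unfolding dyson_eq_inverse[OF G1 b(1) e] dyson_eq_inverse[OF G0 b(2) e] by simp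
  also have "(b0 - \<eta> G0) - (b1 - \<eta> G1) = (b0 - b1) + \<eta> (G1 - G0)" by (simp add: diff)
  finally show ?thesis by simp
qed

lemma dyson_diff_bound:
  assumes "dyson_eq \<eta> b1 G1" "dyson_eq \<eta> b0 G0"
    "pos_elem (im_part b1 - \<epsilon> *\<^sub>R 1)" "pos_elem (im_part b0 - \<epsilon> *\<^sub>R 1)" "\<epsilon> > 0"
  shows "pos_block ((norm (b1 - b0) / \<epsilon>) *\<^sub>R (- im_part G1)) (G1 - G0) ((norm (b1 - b0) / \<epsilon>) *\<^sub>R (- im_part G0))"
  using dyson_linear_bound[OF assms dyson_diff[OF assms]] by (simp add: norm_minus_commute)

lemma norm_dyson_linear_le:
  assumes G1: "dyson_eq \<eta> b1 G1" and G0: "dyson_eq \<eta> b0 G0"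
    and b: "pos_elem (im_part b1 - \<epsilon> *\<^sub>R 1)" "pos_elem (im_part b0 - \<epsilon> *\<^sub>R 1)" and e: "\<epsilon> > 0"
    and r: "r = G1 * (h + \<eta> r) * G0"
  shows "norm r \<le> norm h / \<epsilon>\<^sup>2"
proof (rule norm_le_of_pos_block_norm[OF dyson_linear_bound[OF assms]])
  have "norm (im_part G1) \<le> 1 / \<epsilon>" "norm (im_part G0) \<le> 1 / \<epsilon>"
    using dyson_eq_inverse(3)[OF G1 b(1) e] dyson_eq_inverse(3)[OF G0 b(2) e] norm_im_part_le order.trans by blast+
  then have "norm h / \<epsilon> * norm (im_part G1) \<le> norm h / \<epsilon> * (1 / \<epsilon>)" 
    "norm h / \<epsilon> * norm (im_part G0) \<le> norm h / \<epsilon> * (1 / \<epsilon>)" using e by (intro mult_left_mono; simp)+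
  then show "norm ((norm h / \<epsilon>) *\<^sub>R (- im_part G1)) \<le> norm h / \<epsilon>\<^sup>2"
    "norm ((norm h / \<epsilon>) *\<^sub>R (- im_part G0)) \<le> norm h / \<epsilon>\<^sup>2" 
    using e by (simp_all add: power2_eq_square)
qed (use e in simp)

lemma dyson_eq_unique:
  assumes "dyson_eq \<eta> b G1" "dyson_eq \<eta> b G0" "b \<in> upper_half"
  shows "G1 = G0"
proof -
  obtain \<epsilon> where e: "\<epsilon> > 0" "pos_elem (im_part b - \<epsilon> *\<^sub>R 1)" using assms(3) by (auto simp: upper_half_iff)
  have "norm (G1 - G0) \<le> norm (b - b) / \<epsilon>\<^sup>2"
    by (rule norm_dyson_linear_le[OF assms(1,2) e(2,2,1) dyson_diff[OF assms(1,2) e(2,2,1)]])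
  then show ?thesis by simp
qed

text \<open>
  Picard iteration \<open>G \<mapsto> (b - \<eta> G)\<^sup>-\<^sup>1\<close> from \<open>- \<i>\<close>. By the step with \<open>h = 0\<close> consecutive differences are
  bounded by a geometric sequence, in the order and hence in norm.
\<close>
lemma dyson_eq_exists:
  assumes "b \<in> upper_half"
  obtains G where "dyson_eq \<eta> b G"
proof -
  obtain \<epsilon> where e: "\<epsilon> > 0" "pos_elem (im_part b - \<epsilon> *\<^sub>R 1)" using assms by (auto simp: upper_half_iff)
  define F where "F G = (SOME H. (b - \<eta> G) * H = 1 \<and> H * (b - \<eta> G) = 1 \<and> norm H \<le> 1 / \<epsilon>)" for G
  have F: "(b - \<eta> G) * F G = 1" "F G * (b - \<eta> G) = 1" "norm (F G) \<le> 1 / \<epsilon>" if "pos_elem (- im_part G)" for G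
  proof -
    have "\<exists>H. (b - \<eta> G) * H = 1 \<and> H * (b - \<eta> G) = 1 \<and> norm H \<le> 1 / \<epsilon>"
      using upper_half_inverse[OF im_part_minus_apply[OF e(2) that] e(1)] by blast
    from someI_ex[OF this] show "(b - \<eta> G) * F G = 1" "F G * (b - \<eta> G) = 1" "norm (F G) \<le> 1 / \<epsilon>"
      unfolding F_def by blast+
  qed
  define g where "g n = (F ^^ n) ((- \<i>) *\<^sub>C 1)" for n
  have g0: "g 0 = (- \<i>) *\<^sub>C 1" and gS: "g (Suc n) = F (g n)" for n by (simp_all add: g_def)
  have im0: "im_part (g 0) = - 1"
  proof -
    have "g 0 - star (g 0) = (- \<i> + - \<i>) *\<^sub>C 1"
      unfolding scaleC_add_left g0 by (simp add: star_scaleC)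
    then have "im_part (g 0) = (1 / (2 * \<i>) * (- \<i> + - \<i>)) *\<^sub>C 1"
      by (simp only: im_part_def scaleC_scaleC)
    also have "1 / (2 * \<i>) * (- \<i> + - \<i>) = complex_of_real (- 1)" by (simp add: complex_eq_iff)
    finally show ?thesis by (simp flip: scaleR_scaleC)
  qed
  \<comment> \<open>uniform bounds along the iteration: \<open>R\<close> for the iterates, \<open>L\<close> for their images under \<open>\<eta>\<close>, \<open>M\<close> for
    the elements to be inverted, and \<open>\<delta>\<close> for the distance of the iterates to the real line\<close>
  define R where "R = max 1 (1 / \<epsilon>)"
  define L where "L = norm (\<eta> 1) * R"
  define M where "M = norm b + L + 1"
  define \<delta> where "\<delta> = min 1 (\<epsilon> / M\<^sup>2)"
  have R: "R > 0" by (simp add: R_def)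
  have L: "L \<ge> 0" using R by (simp add: L_def)
  have M: "M > 0" using L by (simp add: M_def add_nonneg_pos)
  have \<delta>: "\<delta> > 0" using e M by (simp add: \<delta>_def)
  have inv: "norm (g n) \<le> R \<and> pos_elem (- im_part (g n) - \<delta> *\<^sub>R 1)" for n
  proof (induction n)
    case 0
    have "norm (g 0) = 1" by (simp add: g0 norm_scaleC)
    moreover have "pos_elem (- im_part (g 0) - \<delta> *\<^sub>R 1)"
      unfolding im0 by (rule pos_elem_weaken[of _ 1]) (simp_all add: \<delta>_def)
    ultimately show ?case by (simp add: R_def)
  next
    case (Suc n)
    then have p: "pos_elem (- im_part (g n))" using \<delta> pos_elem_of_strict less_imp_le by blast
    have "norm (\<eta> (g n)) \<le> L"
      using Suc norm_le[of "g n"] mult_left_mono[of "norm (g n)" R "norm (\<eta> 1)"] by (simp add: L_def)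
    then have "norm (b - \<eta> (g n)) \<le> M"
      using norm_triangle_ineq4[of b "\<eta> (g n)"] by (simp add: M_def)
    then have "pos_elem (- im_part (g (Suc n)) - (\<epsilon> / M\<^sup>2) *\<^sub>R 1)"
      unfolding gS using e M by (intro im_part_inverse_strict[OF F(1,2)[OF p] im_part_minus_apply[OF _ p]])
    then have "pos_elem (- im_part (g (Suc n)) - \<delta> *\<^sub>R 1)"
      by (rule pos_elem_weaken) (simp add: \<delta>_def)
    moreover have "norm (g (Suc n)) \<le> R" using F(3)[OF p] by (simp add: gS R_def)
    ultimately show ?case by simp
  qed
  have p: "pos_elem (- im_part (g n))" for n using inv \<delta> pos_elem_of_strict less_imp_le by blast
  have nL: "norm (\<eta> (im_part (g n))) \<le> L" for n
  proof -
    have "norm (im_part (g n)) \<le> R" using inv[of n] norm_im_part_le order.trans by blast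
    then show ?thesis
      using norm_le[of "im_part (g n)"] mult_left_mono[of "norm (im_part (g n))" R "norm (\<eta> 1)"] by (simp add: L_def)
  qed
  define q where "q = L / (\<epsilon> + L)"
  have q: "0 \<le> q" "q < 1" using L e by (simp_all add: q_def)
  define r where "r n = g (Suc n) - g n" for n
  define K0 where "K0 = norm (r 0) / \<delta>"
  have K0: "K0 \<ge> 0" using \<delta> by (simp add: K0_def)
  have blk: "pos_block ((K0 * q ^ n) *\<^sub>R (- im_part (g (Suc n)))) (r n) ((K0 * q ^ n) *\<^sub>R (- im_part (g n)))" for n
  proof (induction n)
    case 0
    show ?case using inv[of 0] inv[of 1] \<delta> K0 by (intro pos_block_of_strict[of _ \<delta>]) (simp_all add: K0_def)
  next
    case (Suc n)
    have "r (Suc n) = F (g (Suc n)) * (0 + \<eta> (r n)) * F (g n)"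
    proof -
      have "F (g (Suc n)) * ((b - \<eta> (g n)) - (b - \<eta> (g (Suc n)))) * F (g n)
          = F (g (Suc n)) * ((b - \<eta> (g n)) * F (g n)) - (F (g (Suc n)) * (b - \<eta> (g (Suc n)))) * F (g n)"
        by (simp only: left_diff_distrib right_diff_distrib mult.assoc)
      also have "\<dots> = r (Suc n)" unfolding F(1)[OF p] F(2)[OF p] by (simp add: r_def gS)
      finally show ?thesis by (simp add: r_def diff)
    qed
    moreover have "norm 0 \<le> K0 * q ^ n * \<epsilon>" using K0 q e by simp
    ultimately show ?case
      using pos_block_step[OF e(1) e(2,2) F(1,2)[OF p] F(1,2)[OF p] Suc nL nL, of 0 "K0 * q ^ Suc n"]
      by (simp add: gS q_def mult_ac)
  qed
  have nr: "norm (r n) \<le> K0 * R * q ^ n" for n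
  proof (rule norm_le_of_pos_block_norm[OF blk])
    have "norm ((K0 * q ^ n) *\<^sub>R (- im_part (g m))) \<le> K0 * R * q ^ n" for m
    proof -
      have "norm (im_part (g m)) \<le> R" using inv[of m] norm_im_part_le order.trans by blast
      then have "(K0 * q ^ n) * norm (im_part (g m)) \<le> (K0 * q ^ n) * R" using K0 q by (intro mult_left_mono) auto
      then show ?thesis using K0 q by (simp add: mult_ac)
    qed
    then show "norm ((K0 * q ^ n) *\<^sub>R (- im_part (g (Suc n)))) \<le> K0 * R * q ^ n" "norm ((K0 * q ^ n) *\<^sub>R (- im_part (g n))) \<le> K0 * R * q ^ n" by blast+
  qed (use K0 R q in simp)
  have "summable (\<lambda>n. K0 * R * q ^ n)" using q by (intro summable_mult summable_geometric) auto
  then have "summable r" by (rule summable_comparison_test') (rule nr)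
  then have "(\<lambda>n. \<Sum>k<n. r k) \<longlonglongrightarrow> suminf r" by (rule summable_LIMSEQ)
  then have "(\<lambda>n. g n - g 0) \<longlonglongrightarrow> suminf r" by (simp add: r_def sum_lessThan_telescope)
  then have "(\<lambda>n. g n - g 0 + g 0) \<longlonglongrightarrow> suminf r + g 0" by (intro tendsto_intros)
  then obtain G where G: "g \<longlonglongrightarrow> G" by auto
  have "(\<lambda>n. (b - \<eta> (g n)) * g (Suc n)) \<longlonglongrightarrow> (b - \<eta> G) * G"
    by (intro tendsto_intros tendsto G LIMSEQ_Suc)
  moreover have "(b - \<eta> (g n)) * g (Suc n) = 1" for n unfolding gS by (rule F(1)[OF p])
  ultimately have "(b - \<eta> G) * G = 1" by (simp add: LIMSEQ_const_iff)
  moreover have "pos_elem (- im_part G - \<delta> *\<^sub>R 1)"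
  proof (rule pos_elem_closed[OF sequentially_bot])
    show "(\<lambda>n. - im_part (g n) - \<delta> *\<^sub>R 1) \<longlonglongrightarrow> - im_part G - \<delta> *\<^sub>R 1"
      by (intro tendsto_intros tendsto_im_part G)
  qed (use inv in simp)
  ultimately have "dyson_eq \<eta> b G"
    unfolding dyson_eq_def lower_half_iff using \<delta> by (auto simp: left_diff_distrib diff_eq_eq)
  then show ?thesis by (rule that)
qed

lemma dyson_solution:
  assumes "b \<in> upper_half"
  shows "dyson_eq \<eta> b (dyson_solution \<eta> b)"
proof -
  define P where "P G \<longleftrightarrow> G \<in> upper_half \<rightarrow>\<^sub>E lower_half \<and>
        (\<forall>b\<in>upper_half. b * G b = 1 + \<eta> (G b) * G b)" for G
  define G where "G b = (SOME H. dyson_eq \<eta> b H)" for b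
  have G: "dyson_eq \<eta> b (G b)" if "b \<in> upper_half" for b
    unfolding G_def by (rule dyson_eq_exists[OF that]) (rule someI)
  define G' where "G' = restrict G upper_half"
  have P: "P G'" using G by (auto simp: P_def G'_def dyson_eq_def)
  have "H = G'" if PH: "P H" for H
  proof (rule extensionalityI[of _ upper_half])
    show "H \<in> extensional upper_half" using PH unfolding P_def PiE_def by blast
    show "G' \<in> extensional upper_half" by (simp add: G'_def)
    fix b :: 'a assume b: "b \<in> upper_half"
    have "dyson_eq \<eta> b (H b)" using PH b unfolding P_def dyson_eq_def by blast
    then show "H b = G' b" using dyson_eq_unique[OF _ G[OF b] b] b by (simp add: G'_def)
  qed
  then have "(THE G. P G) = G'" using P by (intro the_equality)
  then have "dyson_solution \<eta> = G'" unfolding dyson_solution_def P_def .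
  then show ?thesis using assms G by (simp add: G'_def)
qed

end

section \<open>States and holomorphy of the scalar resolvent\<close>

locale cstar_state =
  fixes \<phi> :: "'a::cstar_algebra \<Rightarrow> complex"
  assumes state: "state \<phi>"
begin

lemma linear: "clinear \<phi>"
  using state by (simp add: state_def)

lemmas add = clinear_add[OF linear] and minus = clinear_minus[OF linear] and diff = clinear_diff[OF linear]

lemma scaleC: "\<phi> (c *\<^sub>C x) = c * \<phi> x"
  by (simp add: clinear_scaleC[OF linear] scaleC_complex_def)

lemma scaleR: "\<phi> (r *\<^sub>R x) = complex_of_real r * \<phi> x"
  by (simp add: scaleR_scaleC scaleC)

lemma one: "\<phi> 1 = 1"
  using state by (simp add: state_def)

lemma pos_elem_apply: "pos_elem a \<Longrightarrow> 0 \<le> Re (\<phi> a)" "pos_elem a \<Longrightarrow> Im (\<phi> a) = 0"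
  using state by (auto simp: state_def complex_nonneg_Reals_iff)

lemma Im_selfadjoint:
  assumes "star a = a"
  shows "Im (\<phi> a) = 0"
  using pos_elem_apply(2)[OF pos_elem_norm_minus[OF assms order_refl]]
  by (simp add: diff scaleR one)

lemma star: "\<phi> (star b) = cnj (\<phi> b)"
proof -
  have "Im (\<phi> (b + star b)) = 0" by (rule Im_selfadjoint) (simp add: star_add star_star add.commute)
  moreover have "Im (\<phi> (\<i> *\<^sub>C (b - star b))) = 0"
    by (rule Im_selfadjoint) (simp add: star_diff star_star star_scaleC scaleC_diff_right)
  ultimately show ?thesis by (simp add: add diff scaleC complex_eq_iff)
qed

lemma im_part: "\<phi> (im_part b) = complex_of_real (Im (\<phi> b))"
  by (simp add: im_part_def scaleC diff minus star complex_eq_iff)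

text \<open>
  The form is evaluated at \<open>x = c\<close> and \<open>y = 1\<close>, where the number \<open>c\<close> of modulus \<open>1\<close> makes the mixed terms
  equal to \<open>- 2 cmod (\<phi> r)\<close>.
\<close>
lemma pos_block_apply:
  assumes "pos_block a r d"
  shows "cmod (\<phi> r) \<le> (Re (\<phi> a) + Re (\<phi> d)) / 2"
proof -
  define c where "c = - (if \<phi> r = 0 then 1 else sgn (\<phi> r))"
  have c: "cnj c * c = 1" "cnj c * \<phi> r = - complex_of_real (cmod (\<phi> r))"
  proof -
    have "cmod c = 1" by (simp add: c_def norm_sgn)
    then show "cnj c * c = 1" using complex_norm_square[of c] by (simp add: mult.commute)
    have "cnj (sgn (\<phi> r)) * \<phi> r = complex_of_real (cmod (\<phi> r))" if "\<phi> r \<noteq> 0"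
      using that complex_norm_square[of "\<phi> r"] by (simp add: sgn_eq field_simps power2_eq_square)
    then show "cnj c * \<phi> r = - complex_of_real (cmod (\<phi> r))" by (simp add: c_def)
  qed
  have "pos_elem (star (c *\<^sub>C 1) * a * (c *\<^sub>C 1) + star (c *\<^sub>C 1) * r * 1 + star 1 * star r * (c *\<^sub>C 1) + star 1 * d * 1)"
    by (rule pos_blockD[OF assms])
  then have "pos_elem (a + cnj c *\<^sub>C r + c *\<^sub>C star r + d)"
    using c(1) by (simp add: star_scaleC mult_scaleC_left mult_scaleC_right scaleC_scaleC mult.commute)
  then have "0 \<le> Re (\<phi> (a + cnj c *\<^sub>C r + c *\<^sub>C star r + d))" by (rule pos_elem_apply(1))
  moreover have "c * cnj (\<phi> r) = - complex_of_real (cmod (\<phi> r))"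
    using arg_cong[OF c(2), of cnj] by simp
  ultimately show ?thesis using c(2) by (simp add: add scaleC star)
qed

lemma Im_dyson_le:
  assumes "dyson_eq \<eta> b G"
  shows "Im (\<phi> G) \<le> 0"
proof -
  have "pos_elem (- im_part G)"
    using assms pos_elem_of_strict less_imp_le by (auto simp: dyson_eq_def lower_half_iff)
  then have "0 \<le> Re (\<phi> (- im_part G))" by (rule pos_elem_apply(1))
  then show ?thesis by (simp add: minus im_part)
qed

lemma norm_le: "cmod (\<phi> b) \<le> norm b"
  using pos_block_apply[OF pos_block_norm[of b "norm b"]] by (simp add: scaleR one)

end

text \<open>
  Lipschitz quotients satisfy the Cauchy criterion at \<open>z\<close>.
\<close>
lemma field_differentiable_of_Lipschitz_quotient:
  fixes g :: "complex \<Rightarrow> complex"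
  assumes d: "d > 0"
    and lip: "\<And>w w'. \<lbrakk>w \<in> ball z d; w \<noteq> z; w' \<in> ball z d; w' \<noteq> z\<rbrakk> \<Longrightarrow>
      cmod ((g w - g z) / (w - z) - (g w' - g z) / (w' - z)) \<le> C * cmod (w - w')"
  shows "g field_differentiable (at z)"
proof -
  define Q where "Q w = (g w - g z) / (w - z)" for w
  define u where "u n = z + complex_of_real (d / (real n + 2))" for n
  have u: "u n \<in> ball z d" "u n \<noteq> z" for n
  proof -
    have "0 < d / (real n + 2)" "d / (real n + 2) < d" using d mult_strict_left_mono[of 1 "real n + 2" d] by (simp_all add: divide_less_eq)
    moreover have "dist z (z + complex_of_real e) = \<bar>e\<bar>" for e
      by (simp add: dist_norm)
    ultimately show "u n \<in> ball z d" "u n \<noteq> z" unfolding u_def by (simp_all del: of_real_divide)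
  qed
  have "(\<lambda>n. d / (real n + 2)) \<longlonglongrightarrow> 0" by real_asymp
  then have "(\<lambda>n. complex_of_real (d / (real n + 2))) \<longlonglongrightarrow> complex_of_real 0" by (rule tendsto_of_real)
  then have "(\<lambda>n. z + complex_of_real (d / (real n + 2))) \<longlonglongrightarrow> z + complex_of_real 0" by (intro tendsto_add tendsto_const)
  then have ul: "u \<longlonglongrightarrow> z" by (simp add: u_def[abs_def])
  have QL: "cmod (Q w - Q w') \<le> \<bar>C\<bar> * cmod (w - w')" if "w \<in> ball z d" "w \<noteq> z" "w' \<in> ball z d" "w' \<noteq> z" for w w'
    using lip[OF that] mult_right_mono[OF abs_ge_self norm_ge_zero, of C "w - w'"] unfolding Q_def by linarith
  have "Cauchy (\<lambda>n. Q (u n))"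
  proof (rule metric_CauchyI)
    fix e :: real assume e: "e > 0"
    obtain N where N: "\<And>m n. m \<ge> N \<Longrightarrow> n \<ge> N \<Longrightarrow> dist (u m) (u n) < e / (\<bar>C\<bar> + 1)"
      using metric_CauchyD[OF LIMSEQ_imp_Cauchy[OF ul], of "e / (\<bar>C\<bar> + 1)"] e by auto
    have "dist (Q (u m)) (Q (u n)) < e" if "m \<ge> N" "n \<ge> N" for m n
    proof -
      have "dist (Q (u m)) (Q (u n)) \<le> \<bar>C\<bar> * dist (u m) (u n)"
        using QL[OF u u, of m n] by (simp add: dist_norm)
      also have "\<dots> \<le> (\<bar>C\<bar> + 1) * dist (u m) (u n)" by (intro mult_right_mono) auto
      also have "\<dots> < e" using N[OF that] by (simp add: field_simps)
      finally show ?thesis .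
    qed
    then show "\<exists>M. \<forall>m\<ge>M. \<forall>n\<ge>M. dist (Q (u m)) (Q (u n)) < e" by blast
  qed
  then obtain D where D: "(\<lambda>n. Q (u n)) \<longlonglongrightarrow> D" using Cauchy_convergent convergentD by blast
  have bd: "cmod (Q w - D) \<le> \<bar>C\<bar> * cmod (w - z)" if w: "w \<in> ball z d" "w \<noteq> z" for w
  proof (rule tendsto_le[OF sequentially_bot])
    show "(\<lambda>n. \<bar>C\<bar> * cmod (w - u n)) \<longlonglongrightarrow> \<bar>C\<bar> * cmod (w - z)" by (intro tendsto_intros ul)
    show "(\<lambda>n. cmod (Q w - Q (u n))) \<longlonglongrightarrow> cmod (Q w - D)" by (intro tendsto_intros D)
  qed (use QL[OF w u] in simp)
  have "(Q \<longlongrightarrow> D) (at z)"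
  proof (rule Lim_transform_bound[where g = "\<lambda>w. \<bar>C\<bar> * cmod (w - z)", THEN LIM_zero_cancel])
    show "\<forall>\<^sub>F w in at z. norm (Q w - D) \<le> norm (\<bar>C\<bar> * cmod (w - z))"
      unfolding eventually_at using bd d by (auto intro!: exI[of _ d] simp: dist_commute)
    show "((\<lambda>w. \<bar>C\<bar> * cmod (w - z)) \<longlongrightarrow> 0) (at z)" by (auto intro!: tendsto_eq_intros)
  qed
  then have "(g has_field_derivative D) (at z)" by (simp add: has_field_derivative_iff Q_def[abs_def])
  then show ?thesis by (auto simp: field_differentiable_def)
qed

locale dyson_data = block_positive_map \<eta> + phi: cstar_state \<phi> for \<eta> :: "'a::cstar_algebra \<Rightarrow> 'a" and \<phi> :: "'a \<Rightarrow> complex" +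
  fixes b0 :: 'a
  assumes selfadjoint: "star b0 = b0"
begin

abbreviation "G z \<equiv> dyson_solution \<eta> (z *\<^sub>C 1 - b0)"

lemma im_part_pencil: "im_part (z *\<^sub>C 1 - b0) = Im z *\<^sub>R 1"
proof -
  have "(z *\<^sub>C 1 - b0) - star (z *\<^sub>C 1 - b0) = (z - cnj z) *\<^sub>C 1"
    using scaleC_add_left[of z "- cnj z" "1::'a"] by (simp add: star_diff star_scaleC selfadjoint)
  then have "im_part (z *\<^sub>C 1 - b0) = (1 / (2 * \<i>) * (z - cnj z)) *\<^sub>C 1"
    by (simp only: im_part_def scaleC_scaleC)
  also have "1 / (2 * \<i>) * (z - cnj z) = complex_of_real (Im z)" by (simp add: complex_eq_iff)
  finally show ?thesis by (simp flip: scaleR_scaleC)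
qed

lemma pencil_strict: "\<epsilon> \<le> Im z \<Longrightarrow> pos_elem (im_part (z *\<^sub>C 1 - b0) - \<epsilon> *\<^sub>R 1)"
  unfolding im_part_pencil scaleR_diff_left[symmetric] by (simp add: pos_elem_const)

lemma pencil_upper: "Im z > 0 \<Longrightarrow> z *\<^sub>C 1 - b0 \<in> upper_half"
  using pencil_strict[of "Im z" z] by (auto simp: upper_half_iff)

lemma dyson_eq_G: "Im z > 0 \<Longrightarrow> dyson_eq \<eta> (z *\<^sub>C 1 - b0) (G z)"
  by (intro dyson_solution pencil_upper)

lemma norm_G_le: "Im z > 0 \<Longrightarrow> norm (G z) \<le> 1 / Im z"
  by (rule dyson_eq_inverse(3)[OF dyson_eq_G pencil_strict]) auto

lemma Im_phi_G_le: "Im z > 0 \<Longrightarrow> Im (\<phi> (G z)) \<le> 0"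
  by (rule phi.Im_dyson_le[OF dyson_eq_G])

text \<open>
  The equation reads \<open>z G = 1 + b\<^sub>0 G + \<eta>(G) G\<close>, and \<open>norm (G z) \<le> 1 / Im z\<close>.
\<close>
lemma phi_G_asymp:
  assumes z: "Im z > 0"
  shows "cmod (z * \<phi> (G z) - 1) \<le> norm b0 / Im z + norm (\<eta> 1) / (Im z)\<^sup>2"
proof -
  have "(z *\<^sub>C 1 - b0) * G z = 1 + \<eta> (G z) * G z" using dyson_eq_G[OF z] by (simp add: dyson_eq_def)
  then have eq: "z *\<^sub>C G z = 1 + b0 * G z + \<eta> (G z) * G z"
    by (simp add: left_diff_distrib mult_scaleC_left diff_eq_eq) 
  have "z * \<phi> (G z) - 1 = \<phi> (z *\<^sub>C G z) - \<phi> 1"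
    by (simp add: phi.scaleC phi.one)
  also have "\<dots> = \<phi> (b0 * G z + \<eta> (G z) * G z)"
    unfolding eq phi.diff[symmetric] by (simp add: algebra_simps)
  finally have "cmod (z * \<phi> (G z) - 1) \<le> norm (b0 * G z + \<eta> (G z) * G z)"
    using phi.norm_le by simp
  also have "\<dots> \<le> norm b0 * norm (G z) + norm (\<eta> (G z)) * norm (G z)"
    by (intro order.trans[OF norm_triangle_ineq] add_mono norm_mult_ineq)
  also have "\<dots> \<le> norm b0 * (1 / Im z) + (norm (\<eta> 1) * (1 / Im z)) * (1 / Im z)"
    using norm_G_le[OF z] z order.trans[OF norm_le[of "G z"] mult_left_mono[OF norm_G_le[OF z] norm_ge_zero]]
    by (intro add_mono mult_mono) auto
  finally show ?thesis by (simp add: power2_eq_square)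
qed

text \<open>
  The difference quotients \<open>q\<^sub>w\<close> solve \<open>q\<^sub>w = G(w) (- 1 + \<eta> q\<^sub>w) G(z)\<close>. Hence \<open>q\<^sub>w - q\<^sub>v\<close> solves the linear
  equation whose inhomogeneity is of the order of \<open>G(w) - G(v)\<close>, and the quotients are Lipschitz in \<open>w\<close>.
\<close>
lemma phi_G_holomorphic: "(\<lambda>z. \<phi> (G z)) holomorphic_on {z. Im z > 0}"
proof (rule holomorphic_onI)
  fix z assume "z \<in> {z. Im z > 0}"
  define \<epsilon> where "\<epsilon> = Im z / 2"
  have e: "\<epsilon> > 0" "Im z \<ge> \<epsilon>" "Im z > 0" using \<open>z \<in> _\<close> by (auto simp: \<epsilon>_def)
  define d where "d = min \<epsilon> 1"
  have d: "d > 0" using e by (simp add: d_def)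
  have w: "Im w \<ge> \<epsilon>" "Im w > 0" "cmod w \<le> cmod z + 1" if "w \<in> ball z d" for w
  proof -
    have "cmod (z - w) < \<epsilon>" "cmod (z - w) < 1" using that by (auto simp: d_def dist_norm)
    then show "Im w \<ge> \<epsilon>" "cmod w \<le> cmod z + 1"
      using abs_Im_le_cmod[of "z - w"] norm_triangle_sub[of w z] by (auto simp: \<epsilon>_def norm_minus_commute)
    then show "Im w > 0" using e by simp
  qed
  have lin: "norm r \<le> norm h / \<epsilon>\<^sup>2" if "r = G w * (h + \<eta> r) * G v" "Im w \<ge> \<epsilon>" "Im v \<ge> \<epsilon>" for r h w v
    using norm_dyson_linear_le[OF dyson_eq_G dyson_eq_G pencil_strict pencil_strict e(1) that(1)] that(2,3) e(1) by simp
  have dif: "G w - G v = G w * ((v - w) *\<^sub>C 1 + \<eta> (G w - G v)) * G v" if "Im w \<ge> \<epsilon>" "Im v \<ge> \<epsilon>" for w v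
  proof -
    have "(v *\<^sub>C 1 - b0) - (w *\<^sub>C 1 - b0) = (v - w) *\<^sub>C 1"
      using scaleC_add_left[of v "- w" "1::'a"] by simp
    then show ?thesis
      using dyson_diff[OF dyson_eq_G dyson_eq_G pencil_strict pencil_strict e(1), of w v] that e(1) by simp
  qed
  define q where "q w = (1 / (w - z)) *\<^sub>C (G w - G z)" for w
  have q: "q w = G w * (- 1 + \<eta> (q w)) * G z" if "Im w \<ge> \<epsilon>" "w \<noteq> z" for w
  proof -
    have "q w = (1 / (w - z)) *\<^sub>C (G w * ((z - w) *\<^sub>C 1 + \<eta> (G w - G z)) * G z)"
      unfolding q_def using dif[OF that(1) e(2)] by simp
    also have "\<dots> = G w * ((1 / (w - z) * (z - w)) *\<^sub>C 1 + \<eta> (q w)) * G z"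
    proof -
      have "c *\<^sub>C (x * y * u) = x * (c *\<^sub>C y) * u" for c and x y u :: 'a
        by (simp only: mult_scaleC_left mult_scaleC_right)
      then show ?thesis by (simp only: q_def scaleC_add_right scaleC_scaleC scaleC)
    qed
    also have "1 / (w - z) * (z - w) = -1" using that by (simp add: field_simps)
    finally show ?thesis by simp
  qed
  define B where "B = cmod z + 1 + norm b0 + norm (\<eta> 1) * (1 / \<epsilon>)"
  have B: "B \<ge> 0" using e by (simp add: B_def)
  define C where "C = B * (1 / \<epsilon>\<^sup>2) * (1 + norm (\<eta> 1) * (1 / \<epsilon>\<^sup>2)) / \<epsilon>\<^sup>2"
  have "cmod ((\<phi> (G w) - \<phi> (G z)) / (w - z) - (\<phi> (G v) - \<phi> (G z)) / (v - z)) \<le> C * cmod (w - v)"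
    if wv: "w \<in> ball z d" "w \<noteq> z" "v \<in> ball z d" "v \<noteq> z" for w v
  proof -
    define W where "W = w *\<^sub>C 1 - b0 - \<eta> (G w)"
    have GW: "G w * W = 1"
      unfolding W_def using dyson_eq_inverse(2)[OF dyson_eq_G pencil_strict] w[OF wv(1)] by blast
    have "norm (G w) \<le> 1 / \<epsilon>" using norm_G_le[of w] w[OF wv(1)] e by (smt (verit) frac_le)
    then have "norm (\<eta> (G w)) \<le> norm (\<eta> 1) * (1 / \<epsilon>)"
      using norm_le[of "G w"] mult_left_mono[of "norm (G w)" "1 / \<epsilon>" "norm (\<eta> 1)"] by simp
    then have nW: "norm W \<le> B"
      using norm_triangle_ineq4[of "w *\<^sub>C (1::'a) - b0" "\<eta> (G w)"] norm_triangle_ineq4[of "w *\<^sub>C (1::'a)" b0] w(3)[OF wv(1)]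
      by (simp add: W_def B_def norm_scaleC)
    have nq: "norm (q v) \<le> 1 / \<epsilon>\<^sup>2" using lin[OF q] w(1)[OF wv(3)] wv e by simp
    have "norm (G w - G v) \<le> norm ((v - w) *\<^sub>C (1::'a)) / \<epsilon>\<^sup>2"
      using w wv by (intro lin[OF dif]) auto
    then have nG: "norm (G w - G v) \<le> cmod (w - v) * (1 / \<epsilon>\<^sup>2)"
      by (simp add: norm_scaleC norm_minus_commute)
    define h where "h = W * (G w - G v) * (- 1 + \<eta> (q v))"
    have "norm (- 1 + \<eta> (q v)) \<le> 1 + norm (\<eta> (q v))" using norm_triangle_ineq[of "- 1" "\<eta> (q v)"] by simp
    also have "\<dots> \<le> 1 + norm (\<eta> 1) * (1 / \<epsilon>\<^sup>2)"
      using norm_le[of "q v"] mult_left_mono[OF nq, of "norm (\<eta> 1)"] by simp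
    finally have n1: "norm (- 1 + \<eta> (q v)) \<le> 1 + norm (\<eta> 1) * (1 / \<epsilon>\<^sup>2)" .
    have "norm h \<le> norm W * norm (G w - G v) * norm (- 1 + \<eta> (q v))"
      unfolding h_def by (intro order.trans[OF norm_mult_ineq] mult_right_mono norm_mult_ineq norm_ge_zero)
    also have "\<dots> \<le> B * (cmod (w - v) * (1 / \<epsilon>\<^sup>2)) * (1 + norm (\<eta> 1) * (1 / \<epsilon>\<^sup>2))"
      using B e by (intro mult_mono nW nG n1) auto
    finally have "norm h / \<epsilon>\<^sup>2 \<le> B * (cmod (w - v) * (1 / \<epsilon>\<^sup>2)) * (1 + norm (\<eta> 1) * (1 / \<epsilon>\<^sup>2)) / \<epsilon>\<^sup>2"
      by (rule divide_right_mono) simp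
    then have nh: "norm h / \<epsilon>\<^sup>2 \<le> C * cmod (w - v)" by (simp add: C_def mult_ac)
    have "q w - q v = G w * (h + \<eta> (q w - q v)) * G z"
    proof -
      have "G w * h * G z = (G w - G v) * (- 1 + \<eta> (q v)) * G z"
        unfolding h_def using GW by (simp add: mult.assoc[symmetric])
      then have "G w * (h + \<eta> (q w - q v)) * G z
          = (G w - G v) * (- 1 + \<eta> (q v)) * G z + G w * (\<eta> (q w) - \<eta> (q v)) * G z"
        by (simp only: diff distrib_left distrib_right)
      also have "\<dots> = G w * (- 1 + \<eta> (q w)) * G z - G v * (- 1 + \<eta> (q v)) * G z"
        by (simp add: left_diff_distrib right_diff_distrib distrib_left distrib_right)
      also have "\<dots> = q w - q v" using q w(1) wv by simp
      finally show ?thesis by (rule sym)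
    qed
    then have "norm (q w - q v) \<le> norm h / \<epsilon>\<^sup>2"
      using lin[of "q w - q v" w h z] w(1)[OF wv(1)] e(2) by (simp only:)
    then have "norm (q w - q v) \<le> C * cmod (w - v)" using nh by simp
    then have "cmod (\<phi> (q w - q v)) \<le> C * cmod (w - v)"
      using phi.norm_le[of "q w - q v"] by simp
    then show ?thesis
      by (simp add: q_def phi.diff phi.scaleC)
  qed
  then have "(\<lambda>z. \<phi> (G z)) field_differentiable at z"
    by (rule field_differentiable_of_Lipschitz_quotient[OF d])
  then show "(\<lambda>z. \<phi> (G z)) field_differentiable at z within {z. Im z > 0}"
    by (rule field_differentiable_at_within)
qed

end

section \<open>The Cauchy transform determines the measure\<close>

text \<open>
  The density of the Cauchy distribution of scale \<open>\<epsilon>\<close>, which is the Poisson kernel of the half plane.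
\<close>
definition cauchy_density :: "real \<Rightarrow> real \<Rightarrow> real" where
  "cauchy_density \<epsilon> s = \<epsilon> / (pi * (s\<^sup>2 + \<epsilon>\<^sup>2))"

lemma cauchy_density_nonneg: "\<epsilon> \<ge> 0 \<Longrightarrow> cauchy_density \<epsilon> s \<ge> 0"
  by (simp add: cauchy_density_def)

lemma cauchy_density_measurable [measurable]: "cauchy_density \<epsilon> \<in> borel_measurable borel"
  unfolding cauchy_density_def by measurable

lemma has_bochner_integral_cauchy_density:
  assumes e: "\<epsilon> > 0"
  shows "has_bochner_integral lborel (\<lambda>s. cauchy_density \<epsilon> (s - x)) 1"
proof -
  have "set_integrable lborel UNIV (\<lambda>x::real. inverse (1 + x\<^sup>2))"
    using integrable_inverse_1_plus_square by (simp add: einterval_eq)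
  then have i: "integrable lborel (\<lambda>x::real. inverse (1 + x\<^sup>2))" by (simp add: set_integrable_def)
  have "(LBINT x=-\<infinity>..\<infinity>. inverse (1 + x^2)) = (LINT x|lborel. inverse (1 + x\<^sup>2))"
    by (simp add: interval_lebesgue_integral_def set_lebesgue_integral_def einterval_eq)
  then have "has_bochner_integral lborel (\<lambda>x::real. inverse (1 + x\<^sup>2)) pi"
    using i LBINT_inverse_1_plus_square by (simp add: has_bochner_integral_iff)
  then have "has_bochner_integral lborel (\<lambda>s. inverse (1 + (- x / \<epsilon> + (1 / \<epsilon>) * s)\<^sup>2)) (pi /\<^sub>R \<bar>1 / \<epsilon>\<bar>)"
    using e by (subst (asm) lborel_has_bochner_integral_real_affine_iff[of "1 / \<epsilon>" _ _ "- x / \<epsilon>"]) auto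
  then have "has_bochner_integral lborel (\<lambda>s. 1 / (\<epsilon> * pi) * inverse (1 + (- x / \<epsilon> + (1 / \<epsilon>) * s)\<^sup>2)) (1 / (\<epsilon> * pi) * (pi /\<^sub>R \<bar>1 / \<epsilon>\<bar>))"
    by (rule has_bochner_integral_mult_right)
  moreover have "1 / (\<epsilon> * pi) * (pi /\<^sub>R \<bar>1 / \<epsilon>\<bar>) = 1" using e by simp
  moreover have "1 / (\<epsilon> * pi) * inverse (1 + (- x / \<epsilon> + (1 / \<epsilon>) * s)\<^sup>2) = cauchy_density \<epsilon> (s - x)" for s
  proof -
    have "- x / \<epsilon> + (1 / \<epsilon>) * s = (s - x) / \<epsilon>" by (simp add: diff_divide_distrib)
    then have "1 + (- x / \<epsilon> + (1 / \<epsilon>) * s)\<^sup>2 = ((s - x)\<^sup>2 + \<epsilon>\<^sup>2) / \<epsilon>\<^sup>2"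
      using e by (simp add: power_divide add_divide_distrib)
    then show ?thesis using e by (simp add: cauchy_density_def power2_eq_square)
  qed
  ultimately show ?thesis by simp
qed

lemma cauchy_kernel_measurable [measurable]: "(\<lambda>t. 1 / (z - complex_of_real t)) \<in> borel_measurable borel"
  by measurable

lemma cmod_resolvent_le: "Im z > 0 \<Longrightarrow> cmod (1 / (z - complex_of_real t)) \<le> 1 / Im z"
  using abs_Im_le_cmod[of "z - complex_of_real t"] by (simp add: norm_divide frac_le)

lemma (in real_distribution) integrable_resolvent:
  "Im z > 0 \<Longrightarrow> integrable M (\<lambda>t. 1 / (z - complex_of_real t))"
  by (rule integrable_const_bound[of _ "1 / Im z"]) (auto simp: cmod_resolvent_le simp del: norm_divide)

lemma Im_resolvent:
  "Im z > 0 \<Longrightarrow> Im (1 / (z - complex_of_real t)) = - (pi * cauchy_density (Im z) (Re z - t))"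
  by (simp add: Im_divide cauchy_density_def)

lemma (in real_distribution) integrable_cauchy_density: "\<epsilon> > 0 \<Longrightarrow> integrable M (\<lambda>t. cauchy_density \<epsilon> (s - t))"
proof (rule integrable_const_bound[of _ "1 / (pi * \<epsilon>)"])
  assume e: "\<epsilon> > 0"
  have "cauchy_density \<epsilon> u \<le> 1 / (pi * \<epsilon>)" for u
  proof -
    have "\<epsilon> / (pi * (u\<^sup>2 + \<epsilon>\<^sup>2)) \<le> \<epsilon> / (pi * \<epsilon>\<^sup>2)" using e by (intro divide_left_mono mult_left_mono) (auto intro!: mult_pos_pos add_nonneg_pos)
    then show ?thesis using e by (simp add: cauchy_density_def power2_eq_square)
  qed
  then show "AE t in M. norm (cauchy_density \<epsilon> (s - t)) \<le> 1 / (pi * \<epsilon>)"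
    using cauchy_density_nonneg[of \<epsilon>] e by (simp add: abs_of_nonneg)
qed simp

lemma (in real_distribution) Im_cauchy_transform:
  assumes "Im z > 0"
  shows "Im (cauchy_transform M z) = - (pi * (LINT t|M. cauchy_density (Im z) (Re z - t)))"
proof -
  have "Im (cauchy_transform M z) = (LINT t|M. Im (1 / (z - complex_of_real t)))"
    unfolding cauchy_transform_def by (rule integral_Im[symmetric]) (rule integrable_resolvent[OF assms])
  also have "\<dots> = (LINT t|M. - (pi * cauchy_density (Im z) (Re z - t)))"
    by (simp only: Im_resolvent[OF assms])
  finally show ?thesis by simp
qed

text \<open>
  By Tonelli's theorem: each point mass contributes the integral of a Cauchy density.
\<close>
lemma (in real_distribution) nn_integral_Im_cauchy_transform:
  assumes e: "\<epsilon> > 0"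
  shows "(\<integral>\<^sup>+ s. ennreal (- Im (cauchy_transform M (complex_of_real s + \<i> * complex_of_real \<epsilon>))) \<partial>lborel) = ennreal pi"
proof -
  interpret lb: sigma_finite_measure "lborel :: real measure" by (rule sigma_finite_lborel)
  interpret pair_sigma_finite M "lborel :: real measure" ..
  have "ennreal (- Im (cauchy_transform M (complex_of_real s + \<i> * complex_of_real \<epsilon>)))
      = ennreal pi * (\<integral>\<^sup>+ t. ennreal (cauchy_density \<epsilon> (s - t)) \<partial>M)" for s
  proof -
    have "- Im (cauchy_transform M (complex_of_real s + \<i> * complex_of_real \<epsilon>)) = pi * (LINT t|M. cauchy_density \<epsilon> (s - t))"
      using e by (subst Im_cauchy_transform) auto
    moreover have "(\<integral>\<^sup>+ t. ennreal (cauchy_density \<epsilon> (s - t)) \<partial>M) = ennreal (LINT t|M. cauchy_density \<epsilon> (s - t))"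
      using e by (intro nn_integral_eq_integral integrable_cauchy_density) (auto simp: cauchy_density_nonneg)
    ultimately show ?thesis by (simp add: ennreal_mult')
  qed
  then have "(\<integral>\<^sup>+ s. ennreal (- Im (cauchy_transform M (complex_of_real s + \<i> * complex_of_real \<epsilon>))) \<partial>lborel)
      = ennreal pi * (\<integral>\<^sup>+ s. (\<integral>\<^sup>+ t. ennreal (cauchy_density \<epsilon> (s - t)) \<partial>M) \<partial>lborel)"
    by (simp add: nn_integral_cmult)
  also have "(\<integral>\<^sup>+ s. (\<integral>\<^sup>+ t. ennreal (cauchy_density \<epsilon> (s - t)) \<partial>M) \<partial>lborel)
     = (\<integral>\<^sup>+ t. (\<integral>\<^sup>+ s. ennreal (cauchy_density \<epsilon> (s - t)) \<partial>lborel) \<partial>M)"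
    by (rule Fubini') measurable
  also have "\<dots> = (\<integral>\<^sup>+ t. 1 \<partial>M)"
  proof (rule nn_integral_cong)
    fix t
    show "(\<integral>\<^sup>+ s. ennreal (cauchy_density \<epsilon> (s - t)) \<partial>lborel) = 1"
      using has_bochner_integral_cauchy_density[OF e, of t] e
      by (subst nn_integral_eq_integral) (auto simp: has_bochner_integral_iff cauchy_density_nonneg)
  qed
  finally show ?thesis using emeasure_space_1 by simp
qed

text \<open>
  The imaginary part of the transform on \<open>\<real> + \<i> \<epsilon>\<close> is, up to the factor \<open>- \<pi>\<close>, the density of the
  convolution with a Cauchy distribution, whose characteristic function at \<open>\<xi>\<close> is \<open>k\<close> below. For small
  \<open>\<epsilon>\<close> the factor \<open>k\<close> is not zero and can be cancelled.
\<close>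
theorem cauchy_transform_unique:
  assumes M: "real_distribution M" and N: "real_distribution N"
    and eq: "\<And>z. Im z > 0 \<Longrightarrow> cauchy_transform M z = cauchy_transform N z"
  shows "M = N"
proof (rule Levy_uniqueness[OF M N], rule ext)
  fix \<xi> :: real
  define k where "k \<epsilon> = (LINT s|lborel. cauchy_density \<epsilon> s *\<^sub>R iexp (\<xi> * s))" for \<epsilon>
  have fourier: "(LINT s|lborel. (LINT t|L. cauchy_density \<epsilon> (s - t)) *\<^sub>R iexp (\<xi> * s)) = char L \<xi> * k \<epsilon>"
    if e: "\<epsilon> > 0" and L: "real_distribution L" for \<epsilon> L
  proof -
    interpret real_distribution L by (rule L)
    interpret lb: sigma_finite_measure "lborel :: real measure" by (rule sigma_finite_lborel)
    interpret pair_sigma_finite L "lborel :: real measure" ..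
    let ?f = "\<lambda>t s. cauchy_density \<epsilon> (s - t) *\<^sub>R iexp (\<xi> * s)"
    have hb: "has_bochner_integral lborel (\<lambda>s. cauchy_density \<epsilon> (s - t)) 1" for t
      using e by (rule has_bochner_integral_cauchy_density)
    have i: "integrable (L \<Otimes>\<^sub>M lborel) (\<lambda>(t, s). ?f t s)"
    proof (rule Fubini_integrable)
      show "(\<lambda>(t, s). ?f t s) \<in> borel_measurable (L \<Otimes>\<^sub>M lborel)" by measurable
      show "integrable L (\<lambda>t. LINT s|lborel. norm (case (t, s) of (t, s) \<Rightarrow> ?f t s))"
        using hb e by (simp add: has_bochner_integral_iff abs_of_nonneg cauchy_density_nonneg)
      have "integrable lborel (?f t)" for t
        by (rule Bochner_Integration.integrable_bound[of _ "\<lambda>s. cauchy_density \<epsilon> (s - t)"])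
           (use hb[of t] in \<open>auto simp: has_bochner_integral_iff\<close>)
      then show "AE t in L. integrable lborel (\<lambda>s. case (t, s) of (t, s) \<Rightarrow> ?f t s)" by simp
    qed
    have "(LINT s|lborel. (LINT t|L. cauchy_density \<epsilon> (s - t)) *\<^sub>R iexp (\<xi> * s)) = (LINT s|lborel. (LINT t|L. ?f t s))"
      by (simp add: integral_scaleR_left integrable_cauchy_density[OF e])
    also have "\<dots> = (LINT t|L. (LINT s|lborel. ?f t s))"
      using Fubini_integral[OF i] by simp
    also have "\<dots> = (LINT t|L. iexp (\<xi> * t) * k \<epsilon>)"
    proof (rule Bochner_Integration.integral_cong[OF refl])
      fix t
      have "(LINT s|lborel. ?f t s) = (LINT s|lborel. ?f t (t + 1 * s))"
        by (subst lborel_integral_real_affine[of 1 _ t]) auto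
      also have "\<dots> = (LINT s|lborel. iexp (\<xi> * t) * (cauchy_density \<epsilon> s *\<^sub>R iexp (\<xi> * s)))"
        by (simp add: distrib_left exp_add mult_ac)
      also have "\<dots> = iexp (\<xi> * t) * k \<epsilon>" unfolding k_def by (rule integral_mult_right_zero)
      finally show "(LINT s|lborel. ?f t s) = iexp (\<xi> * t) * k \<epsilon>" .
    qed
    finally show ?thesis by (simp add: char_def mult.commute)
  qed
  have "(\<lambda>n. k (inverse (real (Suc n)))) \<longlonglongrightarrow> 1"
  proof -
    have hb1: "has_bochner_integral lborel (cauchy_density 1) 1"
      using has_bochner_integral_cauchy_density[of 1 0] by simp
    have k: "k e = (LINT s|lborel. cauchy_density 1 s *\<^sub>R iexp (\<xi> * (e * s)))" if "e > 0" for e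
    proof -
      have "k e = \<bar>e\<bar> *\<^sub>R (LINT s|lborel. cauchy_density e (0 + e * s) *\<^sub>R iexp (\<xi> * (0 + e * s)))"
        unfolding k_def using that by (subst lborel_integral_real_affine[of e _ 0]) auto
      also have "\<dots> = (LINT s|lborel. e *\<^sub>R (cauchy_density e (e * s) *\<^sub>R iexp (\<xi> * (e * s))))"
        using that by (simp only: abs_of_pos add_0 integral_scaleR_right)
      also have "\<dots> = (LINT s|lborel. cauchy_density 1 s *\<^sub>R iexp (\<xi> * (e * s)))"
      proof (rule Bochner_Integration.integral_cong[OF refl])
        fix s
        have "(e * s)\<^sup>2 + e\<^sup>2 = e\<^sup>2 * (s\<^sup>2 + 1)" by (simp add: power_mult_distrib algebra_simps)
        then have "e * cauchy_density e (e * s) = cauchy_density 1 s"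
          using that by (simp add: cauchy_density_def power2_eq_square)
        then show "e *\<^sub>R (cauchy_density e (e * s) *\<^sub>R iexp (\<xi> * (e * s))) = cauchy_density 1 s *\<^sub>R iexp (\<xi> * (e * s))"
          by (simp only: scaleR_scaleR)
      qed
      finally show ?thesis .
    qed
    have "(\<lambda>n. LINT s|lborel. cauchy_density 1 s *\<^sub>R iexp (\<xi> * (inverse (real (Suc n)) * s)))
        \<longlonglongrightarrow> (LINT s|lborel. cauchy_density 1 s *\<^sub>R iexp (\<xi> * (0 * s)))"
    proof (rule integral_dominated_convergence[where w = "cauchy_density 1"])
      show "AE s in lborel. (\<lambda>n. cauchy_density 1 s *\<^sub>R iexp (\<xi> * (inverse (real (Suc n)) * s)))
          \<longlonglongrightarrow> cauchy_density 1 s *\<^sub>R iexp (\<xi> * (0 * s))"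
        by (intro always_eventually allI tendsto_intros LIMSEQ_inverse_real_of_nat)
    qed (use hb1 in \<open>auto simp: has_bochner_integral_iff cauchy_density_nonneg\<close>)
    moreover have "(LINT s|lborel. cauchy_density 1 s *\<^sub>R iexp (\<xi> * (0 * s))) = 1"
      using hb1 by (simp add: has_bochner_integral_iff scaleR_conv_of_real)
    ultimately show ?thesis by (simp add: k)
  qed
  then obtain n where "k (inverse (real (Suc n))) \<noteq> 0"
    by (metis (no_types, lifting) LIMSEQ_unique tendsto_const zero_neq_one LIMSEQ_const_iff ext)
  moreover define \<epsilon> where "\<epsilon> = inverse (real (Suc n))"
  ultimately have e: "\<epsilon> > 0" "k \<epsilon> \<noteq> 0" by auto
  have "(LINT t|M. cauchy_density \<epsilon> (s - t)) = (LINT t|N. cauchy_density \<epsilon> (s - t))" for s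
    using eq[of "complex_of_real s + \<i> * complex_of_real \<epsilon>"] e
      real_distribution.Im_cauchy_transform[OF M, of "complex_of_real s + \<i> * complex_of_real \<epsilon>"]
      real_distribution.Im_cauchy_transform[OF N, of "complex_of_real s + \<i> * complex_of_real \<epsilon>"] by simp
  then have "char M \<xi> * k \<epsilon> = char N \<xi> * k \<epsilon>"
    using fourier[OF e(1) M] fourier[OF e(1) N] by simp
  then show "char M \<xi> = char N \<xi>" using e by simp
qed

section \<open>Functions on the half plane\<close>

text \<open>
  The integral over the boundary of a large half disc vanishes, and the arc of radius \<open>r\<close> contributes at
  most \<open>\<pi> C / r\<close>.
\<close>
lemma integral_real_line_eq_0:
  fixes f :: "complex \<Rightarrow> complex"
  assumes hol: "f holomorphic_on {w. Im w > - \<delta>}" and d: "\<delta> > 0"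
    and bd: "\<And>w. Im w \<ge> 0 \<Longrightarrow> cmod w \<ge> R0 \<Longrightarrow> cmod (f w) \<le> C / (cmod w)\<^sup>2"
    and int: "integrable lborel (\<lambda>s. f (complex_of_real s))"
  shows "(LINT s|lborel. f (complex_of_real s)) = 0"
proof -
  let ?I = "\<lambda>r. LINT s|lborel. indicator {-r..r} s *\<^sub>R f (complex_of_real s)"
  have C: "C \<ge> 0"
  proof -
    define r where "r = max R0 1"
    have "0 \<le> cmod (f (complex_of_real r))" by simp
    also have "\<dots> \<le> C / (cmod (complex_of_real r))\<^sup>2" by (rule bd) (auto simp: r_def)
    finally show ?thesis by (auto simp: r_def zero_le_divide_iff)
  qed
  have small: "cmod (?I r) \<le> C * pi / r" if r: "r \<ge> R0" "r > 0" for r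
  proof -
    define l where "l = linepath (- complex_of_real r) (complex_of_real r)"
    define a where "a = part_circlepath 0 r 0 pi"
    have va: "valid_path a" "valid_path l" by (auto simp: a_def l_def)
    have ends: "pathfinish l = pathstart a" "pathfinish a = pathstart l"
      by (simp_all add: a_def l_def exp_Euler)
    have pa: "cmod w = r \<and> Im w \<ge> 0" if "w \<in> path_image a" for w
    proof -
      have "w \<in> {0 + complex_of_real r * exp (\<i> * complex_of_real x) | x. 0 \<le> x \<and> x \<le> pi}"
        using that path_image_part_circlepath[of 0 pi 0 r] by (simp add: a_def)
      then obtain t where t: "0 \<le> t" "t \<le> pi" "w = complex_of_real r * cis t"
        by (auto simp: cis_conv_exp)
      then show ?thesis using r sin_ge_zero[of t] by (simp add: norm_mult)
    qed
    have pl: "Im w = 0" if "w \<in> path_image l" for w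
      using that by (auto simp: l_def closed_segment_def)
    have sub: "path_image (l +++ a) \<subseteq> {w. Im w > - \<delta>}"
      using pa pl d ends by (force simp: path_image_join)
    have conv: "convex {w. Im w > - \<delta>}" by (rule convex_halfspace_Im_gt)
    have "(f has_contour_integral 0) (l +++ a)"
      by (rule Cauchy_theorem_convex_simple[OF hol conv _ sub]) (use va ends in auto)
    moreover have "f contour_integrable_on l" "f contour_integrable_on a"
      using calculation va contour_integrable_joinI contour_integrable_on_def contour_integrable_join by blast+
    ultimately have sum: "contour_integral l f + contour_integral a f = 0"
      using va contour_integral_join contour_integral_unique by metis
    have "cmod (contour_integral a f) \<le> C / r\<^sup>2 * r * (pi - 0)"
    proof (rule has_contour_integral_bound_part_circlepath)
      show "(f has_contour_integral contour_integral a f) (part_circlepath 0 r 0 pi)"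
        using \<open>f contour_integrable_on a\<close> has_contour_integral_integral unfolding a_def by blast
      show "cmod (f x) \<le> C / r\<^sup>2" if "x \<in> path_image (part_circlepath 0 r 0 pi)" for x
        using bd[of x] pa[of x] that r by (simp add: a_def)
    qed (use C r in auto)
    also have "C / r\<^sup>2 * r * (pi - 0) = C * pi / r" using r by (simp add: power2_eq_square)
    finally have arc: "cmod (contour_integral a f) \<le> C * pi / r" .
    have si: "set_integrable lborel {-r..r} (\<lambda>s. f (complex_of_real s))"
      unfolding set_integrable_def by (rule integrable_mult_indicator[OF _ int]) simp
    have "?I r = integral {-r..r} (\<lambda>s. f (complex_of_real s))"
      using set_borel_integral_eq_integral(2)[OF si] by (simp add: set_lebesgue_integral_def)
    also have "\<dots> = contour_integral l f"
      unfolding l_def using r by (subst contour_integral_linepath_Reals_eq) auto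
    also have "\<dots> = - contour_integral a f" using sum by (simp add: eq_neg_iff_add_eq_0)
    finally show ?thesis using arc by simp
  qed
  have "(\<lambda>n. ?I (real n)) \<longlonglongrightarrow> (LINT s|lborel. f (complex_of_real s))"
  proof (rule integral_dominated_convergence[where w = "\<lambda>s. cmod (f (complex_of_real s))"])
    show "AE s in lborel. (\<lambda>n. indicator {-real n..real n} s *\<^sub>R f (complex_of_real s)) \<longlonglongrightarrow> f (complex_of_real s)"
    proof (rule AE_I2)
      fix s :: real
      obtain N :: nat where N: "\<bar>s\<bar> \<le> real N" using real_arch_simple by blast
      have "\<forall>\<^sub>F n in sequentially. indicator {-real n..real n} s *\<^sub>R f (complex_of_real s) = f (complex_of_real s)"
        using N by (intro eventually_sequentiallyI[of N]) (auto simp: indicator_def)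
      then show "(\<lambda>n. indicator {-real n..real n} s *\<^sub>R f (complex_of_real s)) \<longlonglongrightarrow> f (complex_of_real s)"
        by (rule tendsto_eventually)
    qed
    have [measurable]: "(\<lambda>s. f (complex_of_real s)) \<in> borel_measurable lborel"
      using int by (rule borel_measurable_integrable)
    show "(\<lambda>s. f (complex_of_real s)) \<in> borel_measurable lborel" by measurable
    show "(\<lambda>s. indicator {-real n..real n} s *\<^sub>R f (complex_of_real s)) \<in> borel_measurable lborel" for n
      by measurable
    show "integrable lborel (\<lambda>s. cmod (f (complex_of_real s)))" using int by (rule integrable_norm)
    show "AE s in lborel. norm (indicator {-real n..real n} s *\<^sub>R f (complex_of_real s)) \<le> cmod (f (complex_of_real s))" for n
      by (rule AE_I2) (simp add: indicator_def)
  qed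
  moreover have "(\<lambda>n. ?I (real n)) \<longlonglongrightarrow> 0"
  proof (rule Lim_null_comparison)
    show "\<forall>\<^sub>F n in sequentially. cmod (?I (real n)) \<le> C * pi / real n"
    proof (rule eventually_sequentiallyI)
      fix n assume "nat \<lceil>max R0 1\<rceil> \<le> n"
      then have "max R0 1 \<le> real n" by linarith
      then show "cmod (?I (real n)) \<le> C * pi / real n" by (intro small) auto
    qed
    show "(\<lambda>n. C * pi / real n) \<longlonglongrightarrow> 0" by real_asymp
  qed
  ultimately show ?thesis by (rule LIMSEQ_unique)
qed

lemma integrable_inverse_square_shift:
  "y \<noteq> 0 \<Longrightarrow> integrable lborel (\<lambda>s. 1 / ((s - x)\<^sup>2 + y\<^sup>2))"
  "y > 0 \<Longrightarrow> (LINT s|lborel. 1 / ((s - x)\<^sup>2 + y\<^sup>2)) = pi / y"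
proof -
  have *: "has_bochner_integral lborel (\<lambda>s. 1 / ((s - x)\<^sup>2 + y\<^sup>2)) (pi / y)" if "y > 0" for y
  proof -
    have "has_bochner_integral lborel (\<lambda>s. pi / y * cauchy_density y (s - x)) (pi / y * 1)"
      by (intro has_bochner_integral_mult_right has_bochner_integral_cauchy_density that)
    then show ?thesis using that by (simp add: cauchy_density_def)
  qed
  show "y > 0 \<Longrightarrow> (LINT s|lborel. 1 / ((s - x)\<^sup>2 + y\<^sup>2)) = pi / y"
    using * by (simp add: has_bochner_integral_iff)
  show "integrable lborel (\<lambda>s. 1 / ((s - x)\<^sup>2 + y\<^sup>2))" if "y \<noteq> 0"
    using *[of "\<bar>y\<bar>"] that by (simp add: has_bochner_integral_iff)
qed

text \<open>
  Cauchy's theorem on large half discs, for \<open>(g w - g z) / ((w - z) (w - z\<^sup>*))\<close> and for \<open>g w / (w - z\<^sup>*)\<close>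
  where \<open>z\<^sup>*\<close> is the conjugate. Both decay like \<open>1 / w\<^sup>2\<close> and have no singularity in the upper half
  plane, so their integrals over the real line are \<open>0\<close>; the conjugate of the second identity turns \<open>g\<close>
  into its imaginary part.
\<close>
lemma half_plane_representation:
  fixes g :: "complex \<Rightarrow> complex"
  assumes hol: "g holomorphic_on {w. Im w > - \<delta>}" and d: "\<delta> > 0"
    and bd: "\<And>w. Im w \<ge> 0 \<Longrightarrow> cmod (g w) \<le> C / cmod (w + \<i> * complex_of_real \<delta>)" and z: "Im z > 0"
  shows "has_bochner_integral lborel (\<lambda>s. complex_of_real (- Im (g (complex_of_real s)) / pi) / (z - complex_of_real s)) (g z)"
proof -
  define x y where "x = Re z" and "y = Im z"
  have y: "y > 0" and zxy: "z = Complex x y" using z by (simp_all add: x_def y_def)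
  have C: "C \<ge> 0" using order.trans[OF norm_ge_zero bd[of 0]] d by (simp add: zero_le_divide_iff norm_mult)
  have wd: "cmod w \<le> cmod (w + \<i> * complex_of_real \<delta>)" "\<delta> \<le> cmod (w + \<i> * complex_of_real \<delta>)" if "Im w \<ge> 0" for w
  proof -
    show "cmod w \<le> cmod (w + \<i> * complex_of_real \<delta>)"
      using that d by (simp add: cmod_def power_mono)
    show "\<delta> \<le> cmod (w + \<i> * complex_of_real \<delta>)"
      using abs_Im_le_cmod[of "w + \<i> * complex_of_real \<delta>"] that d by simp
  qed
  have bdC: "cmod (g w) \<le> C / \<delta>" if "Im w \<ge> 0" for w
    using bd[OF that] wd(2)[OF that] C d by (meson divide_left_mono order.trans mult_pos_pos less_le_trans)
  have cont: "continuous_on UNIV (\<lambda>s. g (complex_of_real s))"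
    by (rule continuous_on_compose2[OF holomorphic_on_imp_continuous_on[OF hol]]) (use d in \<open>auto intro!: continuous_intros\<close>)
  have [measurable]: "(\<lambda>s. g (complex_of_real s)) \<in> borel_measurable borel"
    using cont by (rule borel_measurable_continuous_onI)
  have sz: "(complex_of_real s - z) * (complex_of_real s - cnj z) = complex_of_real ((s - x)\<^sup>2 + y\<^sup>2)" for s
    by (simp add: zxy complex_eq_iff power2_eq_square algebra_simps)
  have nsz: "complex_of_real s - z \<noteq> 0" "complex_of_real s - cnj z \<noteq> 0" for s
    using y by (auto simp: zxy complex_eq_iff)
  have cz: "cmod (complex_of_real s - cnj z) = sqrt ((s - x)\<^sup>2 + y\<^sup>2)" for s
    by (simp add: zxy cmod_def)
  have cd: "cmod (complex_of_real s + \<i> * complex_of_real \<delta>) = sqrt ((s - 0)\<^sup>2 + \<delta>\<^sup>2)" for s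
    by (simp add: cmod_def)
  define \<delta>' where "\<delta>' = min \<delta> y"
  have d': "\<delta>' > 0" using d y by (simp add: \<delta>'_def)
  have ncz: "w - cnj z \<noteq> 0" if "Im w > - \<delta>'" for w
    using that by (auto simp: \<delta>'_def y_def complex_eq_iff)
  have hol': "g holomorphic_on {w. Im w > - \<delta>'}"
    by (rule holomorphic_on_subset[OF hol]) (auto simp: \<delta>'_def)
  have half: "cmod w / 2 \<le> cmod (w - u)" if "cmod w \<ge> 2 * cmod z" "cmod u = cmod z" for w u
    using norm_triangle_ineq2[of w u] that by simp

  \<comment> \<open>the second identity; the integrand is dominated through \<open>p q \<le> p\<^sup>2 + q\<^sup>2\<close>\<close>
  have f2: "integrable lborel (\<lambda>s. g (complex_of_real s) / (complex_of_real s - cnj z))"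
    "(LINT s|lborel. g (complex_of_real s) / (complex_of_real s - cnj z)) = 0"
  proof -
    show i: "integrable lborel (\<lambda>s. g (complex_of_real s) / (complex_of_real s - cnj z))"
    proof (rule Bochner_Integration.integrable_bound)
      show "integrable lborel (\<lambda>s. C * (1 / ((s - 0)\<^sup>2 + \<delta>\<^sup>2) + 1 / ((s - x)\<^sup>2 + y\<^sup>2)))"
        using d y by (intro integrable_mult_right Bochner_Integration.integrable_add integrable_inverse_square_shift) auto
      show "AE s in lborel. norm (g (complex_of_real s) / (complex_of_real s - cnj z))
          \<le> norm (C * (1 / ((s - 0)\<^sup>2 + \<delta>\<^sup>2) + 1 / ((s - x)\<^sup>2 + y\<^sup>2)))"
      proof (rule AE_I2)
        fix s :: real
        define p q where "p = 1 / cmod (complex_of_real s + \<i> * complex_of_real \<delta>)"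
          and "q = 1 / cmod (complex_of_real s - cnj z)"
        have pq: "p\<^sup>2 = 1 / ((s - 0)\<^sup>2 + \<delta>\<^sup>2)" "q\<^sup>2 = 1 / ((s - x)\<^sup>2 + y\<^sup>2)" 
          unfolding p_def q_def cz cd by (simp_all add: power_divide)
        have "p \<ge> 0" "q \<ge> 0" by (simp_all add: p_def q_def)
        have "norm (g (complex_of_real s) / (complex_of_real s - cnj z)) \<le> C * p * q"
          using mult_right_mono[OF bd[of "complex_of_real s"], of q] by (simp add: norm_divide p_def q_def)
        also have "\<dots> \<le> C * (p\<^sup>2 + q\<^sup>2)"
          using C sum_squares_bound[of p q] mult_nonneg_nonneg[OF \<open>p \<ge> 0\<close> \<open>q \<ge> 0\<close>]
          by (subst mult.assoc) (intro mult_left_mono, auto)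
        finally show "norm (g (complex_of_real s) / (complex_of_real s - cnj z))
          \<le> norm (C * (1 / ((s - 0)\<^sup>2 + \<delta>\<^sup>2) + 1 / ((s - x)\<^sup>2 + y\<^sup>2)))" unfolding pq by simp
      qed
    qed measurable
    show "(LINT s|lborel. g (complex_of_real s) / (complex_of_real s - cnj z)) = 0"
    proof (rule integral_real_line_eq_0[of "\<lambda>w. g w / (w - cnj z)", OF _ d' _ i])
      show "(\<lambda>w. g w / (w - cnj z)) holomorphic_on {w. Im w > - \<delta>'}"
        using hol' ncz by (intro holomorphic_intros) auto
      fix w assume w: "Im w \<ge> 0" "cmod w \<ge> max 1 (2 * cmod z)"
      have "cmod w > 0" using w(2) by linarith
      have "cmod (g w / (w - cnj z)) = cmod (g w) * (1 / cmod (w - cnj z))" by (simp add: norm_divide)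
      also have "\<dots> \<le> (C / cmod w) * (1 / (cmod w / 2))"
      proof (intro mult_mono)
        show "cmod (g w) \<le> C / cmod w"
          using bd[OF w(1)] wd(1)[OF w(1)] C \<open>cmod w > 0\<close> by (meson divide_left_mono order.trans mult_pos_pos less_le_trans)
        show "1 / cmod (w - cnj z) \<le> 1 / (cmod w / 2)"
          using half[of w "cnj z"] w \<open>cmod w > 0\<close> by (intro divide_left_mono) (auto intro!: mult_pos_pos)
      qed (use C in auto)
      finally show "cmod (g w / (w - cnj z)) \<le> (2 * C) / (cmod w)\<^sup>2"
        by (simp add: power2_eq_square mult.commute)
    qed
  qed

  \<comment> \<open>the first identity, a Poisson formula for \<open>g\<close>; \<open>h\<close> is the integrand with the singularity at \<open>z\<close>
    removed\<close>
  have f1: "integrable lborel (\<lambda>s. g (complex_of_real s) / complex_of_real ((s - x)\<^sup>2 + y\<^sup>2))"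
    "(LINT s|lborel. g (complex_of_real s) / complex_of_real ((s - x)\<^sup>2 + y\<^sup>2)) = g z * complex_of_real (pi / y)"
  proof -
    define h where "h w = (if w = z then deriv g z else (g w - g z) / (w - z)) / (w - cnj z)" for w
    have hs: "h (complex_of_real s) = (g (complex_of_real s) - g z) * complex_of_real (1 / ((s - x)\<^sup>2 + y\<^sup>2))" for s
    proof -
      have "complex_of_real s \<noteq> z" using nsz(1)[of s] by auto
      then have "h (complex_of_real s) = (g (complex_of_real s) - g z) / ((complex_of_real s - z) * (complex_of_real s - cnj z))"
        by (simp add: h_def)
      then show ?thesis unfolding sz by (simp only: of_real_divide of_real_1 times_divide_eq_right mult_1_right)
    qed
    have ik: "integrable lborel (\<lambda>s. complex_of_real (1 / ((s - x)\<^sup>2 + y\<^sup>2)))"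
      using y by (intro integrable_of_real integrable_inverse_square_shift) auto
    have ib: "integrable lborel (\<lambda>s. g (complex_of_real s) * complex_of_real (1 / ((s - x)\<^sup>2 + y\<^sup>2)))"
    proof (rule Bochner_Integration.integrable_bound)
      show "integrable lborel (\<lambda>s. C / \<delta> * (1 / ((s - x)\<^sup>2 + y\<^sup>2)))"
        using y by (intro integrable_mult_right integrable_inverse_square_shift) auto
      show "AE s in lborel. norm (g (complex_of_real s) * complex_of_real (1 / ((s - x)\<^sup>2 + y\<^sup>2)))
          \<le> norm (C / \<delta> * (1 / ((s - x)\<^sup>2 + y\<^sup>2)))"
      proof (rule AE_I2)
        fix s :: real
        have "cmod (g (complex_of_real s)) * (1 / ((s - x)\<^sup>2 + y\<^sup>2)) \<le> C / \<delta> * (1 / ((s - x)\<^sup>2 + y\<^sup>2))"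
          by (intro mult_right_mono bdC) auto
        then show "norm (g (complex_of_real s) * complex_of_real (1 / ((s - x)\<^sup>2 + y\<^sup>2)))
          \<le> norm (C / \<delta> * (1 / ((s - x)\<^sup>2 + y\<^sup>2)))"
          using C d by (simp add: norm_mult abs_of_nonneg del: of_real_add of_real_power of_real_diff of_real_divide)
      qed
    qed measurable
    then show "integrable lborel (\<lambda>s. g (complex_of_real s) / complex_of_real ((s - x)\<^sup>2 + y\<^sup>2))"
      by (simp add: divide_inverse)
    have ih: "integrable lborel (\<lambda>s. h (complex_of_real s))"
      unfolding hs left_diff_distrib by (intro Bochner_Integration.integrable_diff ib integrable_mult_right ik)
    have h0: "(LINT s|lborel. h (complex_of_real s)) = 0"
    proof (rule integral_real_line_eq_0[OF _ d' _ ih])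
      have "open {w. Im w > - \<delta>'}" by (rule open_halfspace_Im_gt)
      then show "h holomorphic_on {w. Im w > - \<delta>'}"
        unfolding h_def using pole_lemma_open[OF hol'] ncz by (intro holomorphic_on_divide) (auto intro!: holomorphic_intros)
      fix w assume w: "Im w \<ge> 0" "cmod w \<ge> max 1 (2 * cmod z)"
      have w0: "cmod w > 0" using w(2) by linarith
      have hw: "cmod w / 2 \<le> cmod (w - z)" "cmod w / 2 \<le> cmod (w - cnj z)" using half w by auto
      then have "w \<noteq> z" using w0 by auto
      then have "cmod (h w) = cmod (g w - g z) * ((1 / cmod (w - z)) * (1 / cmod (w - cnj z)))"
        by (simp add: h_def norm_divide norm_mult)
      also have "\<dots> \<le> (C / \<delta> + C / \<delta>) * ((1 / (cmod w / 2)) * (1 / (cmod w / 2)))"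
      proof (intro mult_mono)
        show "cmod (g w - g z) \<le> C / \<delta> + C / \<delta>"
          using norm_triangle_ineq4[of "g w" "g z"] bdC[OF w(1)] bdC[of z] z by simp
        show "1 / cmod (w - z) \<le> 1 / (cmod w / 2)" "1 / cmod (w - cnj z) \<le> 1 / (cmod w / 2)"
          using frac_le[OF _ order_refl _ hw(1), of 1] frac_le[OF _ order_refl _ hw(2), of 1] w0 by simp_all
      qed (use C d in auto)
      finally show "cmod (h w) \<le> (8 * (C / \<delta>)) / (cmod w)\<^sup>2" by (simp add: power2_eq_square)
    qed
    have "(LINT s|lborel. h (complex_of_real s))
        = (LINT s|lborel. g (complex_of_real s) * complex_of_real (1 / ((s - x)\<^sup>2 + y\<^sup>2)))
          - (LINT s|lborel. g z * complex_of_real (1 / ((s - x)\<^sup>2 + y\<^sup>2)))"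
      unfolding hs left_diff_distrib
      by (rule Bochner_Integration.integral_diff[OF ib integrable_mult_right[OF ik]])
    then have "(LINT s|lborel. g (complex_of_real s) * complex_of_real (1 / ((s - x)\<^sup>2 + y\<^sup>2)))
        = (LINT s|lborel. g z * complex_of_real (1 / ((s - x)\<^sup>2 + y\<^sup>2)))"
      unfolding h0 by (rule eq_iff_diff_eq_0[THEN iffD2, OF sym])
    also have "\<dots> = g z * complex_of_real (pi / y)"
      by (simp only: integral_mult_right_zero integral_complex_of_real integrable_inverse_square_shift(2)[OF y])
    finally show "(LINT s|lborel. g (complex_of_real s) / complex_of_real ((s - x)\<^sup>2 + y\<^sup>2)) = g z * complex_of_real (pi / y)"
      by (simp only: of_real_divide of_real_1 times_divide_eq_right mult_1_right)
  qed

  have A: "has_bochner_integral lborel (\<lambda>s. g (complex_of_real s) / (complex_of_real s - cnj z)) 0"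
    using f2 by (simp add: has_bochner_integral_iff)
  have B: "has_bochner_integral lborel (\<lambda>s. (2 * \<i> * complex_of_real y) * (g (complex_of_real s) / complex_of_real ((s - x)\<^sup>2 + y\<^sup>2)))
      ((2 * \<i> * complex_of_real y) * (g z * complex_of_real (pi / y)))"
    using f1 by (intro has_bochner_integral_mult_right) (simp only: has_bochner_integral_iff)
  have "has_bochner_integral lborel (\<lambda>s. cnj (g (complex_of_real s) / (complex_of_real s - cnj z))) (cnj 0)"
    by (rule has_bochner_integral_bounded_linear[OF bounded_linear_cnj A])
  from has_bochner_integral_diff[OF has_bochner_integral_add[OF A B] this]
  have "has_bochner_integral lborel (\<lambda>s. 1 / (2 * \<i> * pi) * (g (complex_of_real s) / (complex_of_real s - cnj z) +
      (2 * \<i> * complex_of_real y) * (g (complex_of_real s) / complex_of_real ((s - x)\<^sup>2 + y\<^sup>2))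
      - cnj (g (complex_of_real s) / (complex_of_real s - cnj z))))
      (1 / (2 * \<i> * pi) * (0 + (2 * \<i> * complex_of_real y) * (g z * complex_of_real (pi / y)) - cnj 0))"
    by (rule has_bochner_integral_mult_right)
  moreover have "1 / (2 * \<i> * pi) * (0 + (2 * \<i> * complex_of_real y) * (g z * complex_of_real (pi / y)) - cnj 0) = g z"
    using y by simp
  moreover have "1 / (2 * \<i> * pi) * (g (complex_of_real s) / (complex_of_real s - cnj z) +
      (2 * \<i> * complex_of_real y) * (g (complex_of_real s) / complex_of_real ((s - x)\<^sup>2 + y\<^sup>2))
      - cnj (g (complex_of_real s) / (complex_of_real s - cnj z)))
      = complex_of_real (- Im (g (complex_of_real s)) / pi) / (z - complex_of_real s)" for s
  proof -
    define S T v where "S = complex_of_real s - z" and "T = complex_of_real s - cnj z" and "v = g (complex_of_real s)"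
    have ST: "S \<noteq> 0" "T \<noteq> 0" using nsz by (auto simp: S_def T_def)
    have TS: "2 * \<i> * complex_of_real y = T - S" by (simp add: T_def S_def zxy complex_eq_iff)
    have cT: "cnj T = S" by (simp add: S_def T_def)
    have "v / T + (T - S) * (v / (S * T)) = v / S" using ST by (simp add: field_simps)
    moreover have "v - cnj v = 2 * \<i> * complex_of_real (Im v)" by (simp add: complex_eq_iff)
    ultimately have "v / T + (T - S) * (v / (S * T)) - cnj (v / T) = 2 * \<i> * complex_of_real (Im v) / S"
      by (simp add: cT flip: diff_divide_distrib)
    then have "1 / (2 * \<i> * pi) * (v / T + (T - S) * (v / (S * T)) - cnj (v / T)) = complex_of_real (Im v / pi) / S"
      by simp
    also have "\<dots> = complex_of_real (- Im v / pi) / (- S)" by simp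
    also have "- S = z - complex_of_real s" by (simp add: S_def)
    finally show ?thesis unfolding sz[symmetric] TS S_def[symmetric] T_def[symmetric] v_def[symmetric] .
  qed
  ultimately show ?thesis by simp
qed

section \<open>Existence of a measure with given Cauchy transform\<close>

lemma (in real_distribution) integral_Re_cauchy_transform:
  assumes R: "R > 0"
  shows "(LINT s|M. R\<^sup>2 / (R\<^sup>2 + s\<^sup>2)) = Re (\<i> * complex_of_real R * cauchy_transform M (\<i> * complex_of_real R))"
    and "integrable M (\<lambda>s. R\<^sup>2 / (R\<^sup>2 + s\<^sup>2))"
proof -
  let ?z = "\<i> * complex_of_real R"
  have i: "integrable M (\<lambda>s. ?z * (1 / (?z - complex_of_real s)))"
    using R by (intro integrable_mult_right integrable_resolvent) auto
  have Re: "Re (?z * (1 / (?z - complex_of_real s))) = R\<^sup>2 / (R\<^sup>2 + s\<^sup>2)" for s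
    by (simp add: Re_divide power2_eq_square add.commute)
  show "(LINT s|M. R\<^sup>2 / (R\<^sup>2 + s\<^sup>2)) = Re (?z * cauchy_transform M ?z)"
    using integral_Re[OF i] by (simp only: Re cauchy_transform_def integral_mult_right_zero)
  show "integrable M (\<lambda>s. R\<^sup>2 / (R\<^sup>2 + s\<^sup>2))"
    using integrable_Re[OF i] by (simp only: Re)
qed

text \<open>
  The function \<open>R\<^sup>2 / (R\<^sup>2 + s\<^sup>2)\<close> is at most \<open>1\<close>, and at most \<open>1 / 2\<close> outside \<open>{-R..R}\<close>.
\<close>
lemma (in real_distribution) measure_interval_ge:
  assumes R: "R > 0"
  shows "2 * Re (\<i> * complex_of_real R * cauchy_transform M (\<i> * complex_of_real R)) - 1 \<le> measure M {-R..R}"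
proof -
  have "(LINT s|M. R\<^sup>2 / (R\<^sup>2 + s\<^sup>2)) \<le> (LINT s|M. 1 / 2 + indicator {-R..R} s / 2)"
  proof (rule integral_mono[OF integral_Re_cauchy_transform(2)[OF R]])
    fix s
    show "R\<^sup>2 / (R\<^sup>2 + s\<^sup>2) \<le> 1 / 2 + indicator {-R..R} s / 2"
    proof (cases "s \<in> {-R..R}")
      case False
      then have "R < \<bar>s\<bar>" by auto
      then have "R\<^sup>2 \<le> s\<^sup>2" using R by (simp flip: abs_le_square_iff)
      moreover have "R\<^sup>2 > 0" using R by simp
      ultimately have "R\<^sup>2 / (R\<^sup>2 + s\<^sup>2) \<le> 1 / 2" by (simp add: divide_le_eq add_pos_nonneg)
      then show ?thesis using False by (simp del: atLeastAtMost_iff)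
    next
      case True
      have "R\<^sup>2 / (R\<^sup>2 + s\<^sup>2) \<le> 1" by (simp add: divide_le_eq sum_power2_gt_zero_iff)
      then show ?thesis using True by (simp del: atLeastAtMost_iff)
    qed
  qed (auto intro!: Bochner_Integration.integrable_add integrable_real_indicator simp: less_top[symmetric])
  also have "\<dots> = 1 / 2 + measure M {-R..R} / 2"
    using prob_space by (subst Bochner_Integration.integral_add) (auto simp: less_top[symmetric])
  finally show ?thesis using integral_Re_cauchy_transform(1)[OF R] by simp
qed

text \<open>
  The density is \<open>- Im g / \<pi>\<close> on the line \<open>\<real> + \<i> \<epsilon>\<close>. Its total mass is the limit of \<open>\<i> R g (\<i> R + \<i> \<epsilon>)\<close> by monotone
  convergence. The tail bound does not depend on \<open>\<epsilon>\<close>, which makes these measures tight.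
\<close>
lemma cauchy_transform_shift_exists:
  fixes g :: "complex \<Rightarrow> complex"
  assumes hol: "g holomorphic_on {z. Im z > 0}"
    and neg: "\<And>z. Im z > 0 \<Longrightarrow> Im (g z) \<le> 0"
    and asymp: "\<And>z. Im z > 0 \<Longrightarrow> cmod (z * g z - 1) \<le> A / Im z + B / (Im z)\<^sup>2"
    and AB: "A \<ge> 0" "B \<ge> 0" and e: "\<epsilon> > 0" "\<epsilon> \<le> 1"
  obtains \<mu> where "real_distribution \<mu>"
    "\<And>z. Im z > 0 \<Longrightarrow> cauchy_transform \<mu> z = g (z + \<i> * complex_of_real \<epsilon>)"
    "\<And>R. R \<ge> 1 \<Longrightarrow> 1 - 2 * (1 + 2 * A + 2 * B) / R \<le> measure \<mu> {-R..R}"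
proof -
  define h where "h w = g (w + \<i> * complex_of_real \<epsilon>)" for w
  define C where "C = 1 + A / \<epsilon> + B / \<epsilon>\<^sup>2"
  define D where "D = 1 + 2 * A + 2 * B"
  have holh: "h holomorphic_on {w. Im w > - \<epsilon>}"
    unfolding h_def by (rule holomorphic_on_compose_gen[OF _ hol, unfolded o_def]) (auto intro!: holomorphic_intros)
  have bdh: "cmod (h w) \<le> C / cmod (w + \<i> * complex_of_real \<epsilon>)" if "Im w \<ge> 0" for w
  proof -
    define z where "z = w + \<i> * complex_of_real \<epsilon>"
    have z: "Im z \<ge> \<epsilon>" "Im z > 0" "z \<noteq> 0" using that e by (auto simp: z_def complex_eq_iff)
    have "A / Im z \<le> A / \<epsilon>" "B / (Im z)\<^sup>2 \<le> B / \<epsilon>\<^sup>2"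
      using z(1) e AB by (auto intro!: divide_left_mono mult_pos_pos power_mono simp: less_le_trans)
    moreover have "cmod (z * g z) \<le> 1 + cmod (z * g z - 1)"
      using norm_triangle_ineq[of 1 "z * g z - 1"] by simp
    ultimately have "cmod (z * g z) \<le> C" using asymp[OF z(2)] by (simp add: C_def)
    then show ?thesis using z by (simp add: h_def z_def[symmetric] norm_mult field_simps)
  qed
  define \<rho> where "\<rho> s = - Im (h (complex_of_real s)) / pi" for s
  have \<rho>0: "\<rho> s \<ge> 0" for s
    unfolding \<rho>_def h_def using neg[of "complex_of_real s + \<i> * complex_of_real \<epsilon>"] e
    by (simp add: divide_nonpos_pos)
  have rep: "has_bochner_integral lborel (\<lambda>s. complex_of_real (\<rho> s) / (z - complex_of_real s)) (h z)" if "Im z > 0" for z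
    unfolding \<rho>_def by (rule half_plane_representation[OF holh e(1) bdh that])
  have "continuous_on UNIV (\<lambda>s. h (complex_of_real s))"
    by (rule continuous_on_compose2[OF holomorphic_on_imp_continuous_on[OF holh]]) (use e in \<open>auto intro!: continuous_intros\<close>)
  then have [measurable]: "(\<lambda>s. h (complex_of_real s)) \<in> borel_measurable borel" by (rule borel_measurable_continuous_onI)
  have [measurable]: "\<rho> \<in> borel_measurable borel" unfolding \<rho>_def by measurable
  have est: "cmod (\<i> * complex_of_real R * h (\<i> * complex_of_real R) - 1) \<le> D / R" if R: "R \<ge> 1" for R
  proof -
    define z where "z = \<i> * complex_of_real (R + \<epsilon>)"
    have z: "Im z = R + \<epsilon>" "cmod z = R + \<epsilon>" using R e by (simp_all add: z_def norm_mult del: of_real_add)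
    have hz: "h (\<i> * complex_of_real R) = g z" by (simp add: h_def z_def distrib_left)
    have *: "cmod (z * g z - 1) \<le> (A + B) / R"
    proof -
      have "A / (R + \<epsilon>) \<le> A / R" using R e AB by (intro divide_left_mono) auto
      moreover have "B / (R + \<epsilon>)\<^sup>2 \<le> B / R"
      proof (rule divide_left_mono)
        have "R * 1 \<le> (R + \<epsilon>) * (R + \<epsilon>)" using R e by (intro mult_mono) auto
        then show "R \<le> (R + \<epsilon>)\<^sup>2" by (simp add: power2_eq_square)
      qed (use R e AB in auto)
      ultimately show ?thesis using asymp[of z] z R e by (simp add: add_divide_distrib)
    qed
    also have "(A + B) / R \<le> A + B" using R AB mult_left_mono[of 1 R "A + B"] by (simp add: divide_le_eq)
    finally have "cmod (z * g z) \<le> 1 + A + B" using norm_triangle_ineq[of 1 "z * g z - 1"] by simp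
    then have "(R + \<epsilon>) * cmod (g z) \<le> 1 + A + B" by (simp add: norm_mult z)
    then have "R * cmod (g z) \<le> 1 + A + B"
      using e mult_right_mono[of R "R + \<epsilon>" "cmod (g z)"] by simp
    then have "cmod (g z) \<le> (1 + A + B) / R" using R by (simp add: field_simps)
    then have eg: "cmod (\<i> * complex_of_real \<epsilon> * g z) \<le> (1 + A + B) / R"
      using e mult_right_mono[of \<epsilon> 1 "cmod (g z)"] by (simp add: norm_mult)
    have eqn: "\<i> * complex_of_real R * h (\<i> * complex_of_real R) - 1 = (z * g z - 1) - \<i> * complex_of_real \<epsilon> * g z"
      by (simp add: hz z_def algebra_simps)
    have "cmod (\<i> * complex_of_real R * h (\<i> * complex_of_real R) - 1) \<le> (A + B) / R + (1 + A + B) / R"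
      unfolding eqn using norm_triangle_ineq4[of "z * g z - 1" "\<i> * complex_of_real \<epsilon> * g z"] * eg by linarith
    also have "(A + B) / R + (1 + A + B) / R = D / R"
      unfolding add_divide_distrib[symmetric] D_def by (simp add: algebra_simps)
    finally show ?thesis .
  qed
  \<comment> \<open>the real part of the integrand of \<open>\<i> R h (\<i> R)\<close> at \<open>R = n + 1\<close>, which increases to \<open>\<rho>\<close>\<close>
  define u where "u n s = \<rho> s * ((real (Suc n))\<^sup>2 / ((real (Suc n))\<^sup>2 + s\<^sup>2))" for n s
  have u: "has_bochner_integral lborel (u n) (Re (\<i> * complex_of_real (real (Suc n)) * h (\<i> * complex_of_real (real (Suc n)))))" for n
  proof -
    define R where "R = real (Suc n)"
    have R: "R > 0" by (simp add: R_def)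
    have "has_bochner_integral lborel (\<lambda>s. Re (\<i> * complex_of_real R * (complex_of_real (\<rho> s) / (\<i> * complex_of_real R - complex_of_real s))))
        (Re (\<i> * complex_of_real R * h (\<i> * complex_of_real R)))"
      using R by (intro has_bochner_integral_bounded_linear[OF bounded_linear_Re] has_bochner_integral_mult_right rep) auto
    moreover have "Re (\<i> * complex_of_real R * (complex_of_real (\<rho> s) / (\<i> * complex_of_real R - complex_of_real s))) = u n s" for s
      unfolding u_def R_def[symmetric] by (simp add: Re_divide power2_eq_square add.commute mult_ac)
    ultimately show ?thesis by (simp only: R_def)
  qed
  have lim: "(\<lambda>n. Re (\<i> * complex_of_real (real (Suc n)) * h (\<i> * complex_of_real (real (Suc n))))) \<longlonglongrightarrow> 1"
  proof -
    have "(\<lambda>n. \<i> * complex_of_real (real (Suc n)) * h (\<i> * complex_of_real (real (Suc n))) - 1) \<longlonglongrightarrow> 0"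
    proof (rule Lim_null_comparison)
      show "\<forall>\<^sub>F n in sequentially. cmod (\<i> * complex_of_real (real (Suc n)) * h (\<i> * complex_of_real (real (Suc n))) - 1) \<le> D / real (Suc n)"
        by (intro always_eventually allI est) simp
      show "(\<lambda>n. D / real (Suc n)) \<longlonglongrightarrow> 0" by real_asymp
    qed
    then have "(\<lambda>n. \<i> * complex_of_real (real (Suc n)) * h (\<i> * complex_of_real (real (Suc n)))) \<longlonglongrightarrow> 1" by (rule LIM_zero_cancel)
    then show ?thesis using tendsto_Re by fastforce
  qed
  have mono: "mono (\<lambda>n. u n s)" for s
  proof (rule incseq_SucI)
    fix n
    have fr: "p / (p + s\<^sup>2) \<le> q / (q + s\<^sup>2)" if "0 < p" "p \<le> q" for p q :: real
      using that by (simp add: divide_simps add_pos_nonneg) (simp add: algebra_simps mult_right_mono)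
    show "u n s \<le> u (Suc n) s"
      unfolding u_def by (intro mult_left_mono fr \<rho>0 power_mono) auto
  qed
  have ulim: "(\<lambda>n. u n s) \<longlonglongrightarrow> \<rho> s" for s
  proof -
    have "(\<lambda>n. (real (Suc n))\<^sup>2 / ((real (Suc n))\<^sup>2 + s\<^sup>2)) \<longlonglongrightarrow> 1" by real_asymp
    then have "(\<lambda>n. \<rho> s * ((real (Suc n))\<^sup>2 / ((real (Suc n))\<^sup>2 + s\<^sup>2))) \<longlonglongrightarrow> \<rho> s * 1" by (intro tendsto_intros)
    then show ?thesis by (simp add: u_def)
  qed
  have "integrable lborel \<rho>" "(LINT s|lborel. \<rho> s) = 1"
    using integrable_monotone_convergence[of lborel u \<rho> 1] integral_monotone_convergence[of lborel u \<rho> 1]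
      u lim mono ulim by (auto simp: has_bochner_integral_iff)
  then have nn: "(\<integral>\<^sup>+ s. ennreal (\<rho> s) \<partial>lborel) = 1"
    by (subst nn_integral_eq_integral) (auto simp: \<rho>0)
  define \<mu> where "\<mu> = density lborel (\<lambda>s. ennreal (\<rho> s))"
  have "prob_space \<mu>" unfolding \<mu>_def by (rule prob_spaceI) (simp add: emeasure_density nn)
  then have \<mu>: "real_distribution \<mu>"
    by (intro real_distribution.intro real_distribution_axioms.intro) (simp_all add: \<mu>_def)
  have ct: "cauchy_transform \<mu> z = h z" if z: "Im z > 0" for z
  proof -
    have "cauchy_transform \<mu> z = (LINT s|lborel. \<rho> s *\<^sub>R (1 / (z - complex_of_real s)))"
      unfolding cauchy_transform_def \<mu>_def by (rule integral_density) (auto simp: \<rho>0)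
    also have "\<dots> = h z" using rep[OF z] by (simp add: has_bochner_integral_iff scaleR_conv_of_real)
    finally show ?thesis .
  qed
  have "1 - 2 * D / R \<le> measure \<mu> {-R..R}" if R: "R \<ge> 1" for R
  proof -
    have "1 - D / R \<le> Re (\<i> * complex_of_real R * h (\<i> * complex_of_real R))"
      using est[OF R] abs_Re_le_cmod[of "\<i> * complex_of_real R * h (\<i> * complex_of_real R) - 1"] by simp
    then show ?thesis
      using real_distribution.measure_interval_ge[OF \<mu>, of R] R ct[of "\<i> * complex_of_real R"] by simp
  qed
  then show ?thesis using that \<mu> ct unfolding h_def D_def by blast
qed

text \<open>
  The measures of the shifted functions \<open>g (\<cdot> + \<i> / n)\<close> are tight by the growth condition, and any limit
  point has the transform \<open>g\<close>.
\<close>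
theorem cauchy_transform_exists:
  fixes g :: "complex \<Rightarrow> complex"
  assumes hol: "g holomorphic_on {z. Im z > 0}"
    and neg: "\<And>z. Im z > 0 \<Longrightarrow> Im (g z) \<le> 0"
    and asymp: "\<And>z. Im z > 0 \<Longrightarrow> cmod (z * g z - 1) \<le> A / Im z + B / (Im z)\<^sup>2"
    and AB: "A \<ge> 0" "B \<ge> 0"
  obtains M where "real_distribution M" "\<And>z. Im z > 0 \<Longrightarrow> cauchy_transform M z = g z"
proof -
  define D where "D = 1 + 2 * A + 2 * B"
  define e where "e n = inverse (real (Suc n))" for n
  have e: "e n > 0" "e n \<le> 1" for n by (auto simp: e_def inverse_le_1_iff)
  have "\<exists>\<mu>. real_distribution \<mu> \<and> (\<forall>z. Im z > 0 \<longrightarrow> cauchy_transform \<mu> z = g (z + \<i> * complex_of_real (e n)))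
      \<and> (\<forall>R\<ge>1. 1 - 2 * D / R \<le> measure \<mu> {-R..R})" for n
    using cauchy_transform_shift_exists[OF hol neg asymp AB e] unfolding D_def by metis
  then obtain \<mu> where \<mu>: "\<And>n. real_distribution (\<mu> n)"
    "\<And>n z. Im z > 0 \<Longrightarrow> cauchy_transform (\<mu> n) z = g (z + \<i> * complex_of_real (e n))"
    "\<And>n R. R \<ge> 1 \<Longrightarrow> 1 - 2 * D / R \<le> measure (\<mu> n) {-R..R}"
    by metis
  have "tight \<mu>"
    unfolding tight_def
  proof (intro conjI allI impI \<mu>(1))
    fix \<epsilon> :: real assume eps: "\<epsilon> > 0"
    define R where "R = 1 + 2 * D / \<epsilon>"
    have D: "D > 0" using AB by (simp add: D_def add_pos_nonneg)
    have R: "R \<ge> 1" using eps D by (simp add: R_def)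
    have "2 * D < R * \<epsilon>" using eps by (simp add: R_def distrib_right)
    then have small: "2 * D / R < \<epsilon>" using R by (simp add: divide_less_eq mult.commute)
    have "1 - \<epsilon> < measure (\<mu> n) {-R - 1<..R}" for n
    proof -
      interpret real_distribution "\<mu> n" by (rule \<mu>(1))
      have "measure (\<mu> n) {-R..R} \<le> measure (\<mu> n) {-R - 1<..R}" by (rule finite_measure_mono) auto
      then show ?thesis using \<mu>(3)[OF R, of n] small by simp
    qed
    then show "\<exists>a b. a < b \<and> (\<forall>n. 1 - \<epsilon> < measure (\<mu> n) {a<..b})"
      using R by (intro exI[of _ "- R - 1"] exI[of _ R]) auto
  qed
  then obtain r M where r: "strict_mono r" and M: "real_distribution M" and wc: "weak_conv_m (\<mu> \<circ> id \<circ> r) M"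
    using tight_imp_convergent_subsubsequence[of \<mu> id] strict_mono_id by blast
  have "cauchy_transform M z = g z" if z: "Im z > 0" for z
  proof -
    have "isCont (\<lambda>t. 1 / (z - complex_of_real t)) x" for x
      using z by (intro continuous_intros) (auto simp: complex_eq_iff)
    then have "(\<lambda>n. integral\<^sup>L ((\<mu> \<circ> id \<circ> r) n) (\<lambda>t. 1 / (z - complex_of_real t)))
        \<longlonglongrightarrow> (LINT t|M. 1 / (z - complex_of_real t))"
      by (intro weak_conv_imp_integral_bdd_continuous_conv[OF _ M wc, where B = "1 / Im z"])
         (use z in \<open>simp_all only: o_def id_apply \<mu>(1) cmod_resolvent_le\<close>)
    then have "(\<lambda>n. cauchy_transform (\<mu> (r n)) z) \<longlonglongrightarrow> cauchy_transform M z"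
      by (simp add: cauchy_transform_def)
    then have "(\<lambda>n. g (z + \<i> * complex_of_real (e (r n)))) \<longlonglongrightarrow> cauchy_transform M z"
      by (simp add: \<mu>(2)[OF z])
    moreover have "(\<lambda>n. g (z + \<i> * complex_of_real (e (r n)))) \<longlonglongrightarrow> g z"
    proof (rule isCont_tendsto_compose[of _ g])
      have "open {z. Im z > 0}" by (rule open_halfspace_Im_gt)
      then show "isCont g z"
        using holomorphic_on_imp_continuous_on[OF hol] z by (simp add: continuous_on_eq_continuous_at)
      have "(\<lambda>n. e (r n)) \<longlonglongrightarrow> 0"
        using LIMSEQ_subseq_LIMSEQ[OF LIMSEQ_inverse_real_of_nat r] by (simp add: o_def e_def)
      then have "(\<lambda>n. z + \<i> * complex_of_real (e (r n))) \<longlonglongrightarrow> z + \<i> * complex_of_real 0"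
        by (intro tendsto_intros)
      then show "(\<lambda>n. z + \<i> * complex_of_real (e (r n))) \<longlonglongrightarrow> z" by simp
    qed
    ultimately show ?thesis by (rule LIMSEQ_unique)
  qed
  then show ?thesis using that M by blast
qed

section \<open>Lipschitz estimates for the density of states\<close>

context dyson_data
begin

lemma density_of_states:
  "real_distribution (density_of_states \<phi> (b0, \<eta>))"
  "Im z > 0 \<Longrightarrow> cauchy_transform (density_of_states \<phi> (b0, \<eta>)) z = \<phi> (G z)"
proof -
  obtain M where M: "real_distribution M" "\<And>z. Im z > 0 \<Longrightarrow> cauchy_transform M z = \<phi> (G z)"
    using cauchy_transform_exists[OF phi_G_holomorphic Im_phi_G_le phi_G_asymp norm_ge_zero norm_ge_zero] by blast
  have "(THE M. real_distribution M \<and> (\<forall>z. Im z > 0 \<longrightarrow> cauchy_transform M z = \<phi> (G z))) = M"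
  proof (rule the_equality)
    fix N assume "real_distribution N \<and> (\<forall>z. Im z > 0 \<longrightarrow> cauchy_transform N z = \<phi> (G z))"
    then show "N = M" using M by (intro cauchy_transform_unique) simp_all
  qed (use M in blast)
  then have "density_of_states \<phi> (b0, \<eta>) = M" by (simp add: density_of_states_def)
  with M show "real_distribution (density_of_states \<phi> (b0, \<eta>))"
    "Im z > 0 \<Longrightarrow> cauchy_transform (density_of_states \<phi> (b0, \<eta>)) z = \<phi> (G z)" by simp_all
qed

lemma nn_integral_Im_phi_G:
  assumes "\<epsilon> > 0"
  shows "(\<integral>\<^sup>+ s. ennreal (- Im (\<phi> (G (complex_of_real s + \<i> * complex_of_real \<epsilon>)))) \<partial>lborel) = ennreal pi"
  using real_distribution.nn_integral_Im_cauchy_transform[OF density_of_states(1) assms] assms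
  by (simp add: density_of_states(2))

lemma phi_G_measurable:
  assumes "\<epsilon> > 0"
  shows "(\<lambda>s. \<phi> (G (complex_of_real s + \<i> * complex_of_real \<epsilon>))) \<in> borel_measurable borel"
proof (rule borel_measurable_continuous_onI)
  show "continuous_on UNIV (\<lambda>s. \<phi> (G (complex_of_real s + \<i> * complex_of_real \<epsilon>)))"
    by (rule continuous_on_compose2[OF holomorphic_on_imp_continuous_on[OF phi_G_holomorphic]])
       (use assms in \<open>auto intro!: continuous_intros\<close>)
qed

end

lemma (in cstar_state) phi_dyson_diff_bound:
  assumes eta: "block_positive \<eta>" and G: "dyson_eq \<eta> b1 G1" "dyson_eq \<eta> b0 G0"
    and b: "pos_elem (im_part b1 - \<epsilon> *\<^sub>R 1)" "pos_elem (im_part b0 - \<epsilon> *\<^sub>R 1)" and e: "\<epsilon> > 0"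
    and K: "norm (b1 - b0) \<le> K"
  shows "cmod (\<phi> G1 - \<phi> G0) \<le> K / \<epsilon> / 2 * (- Im (\<phi> G1) + - Im (\<phi> G0))"
proof -
  interpret eta: block_positive_map \<eta> by (rule block_positive_map.intro[OF eta])
  define c where "c = norm (b1 - b0) / \<epsilon>"
  have "cmod (\<phi> (G1 - G0)) \<le> (Re (\<phi> (c *\<^sub>R (- im_part G1))) + Re (\<phi> (c *\<^sub>R (- im_part G0)))) / 2"
    unfolding c_def by (rule pos_block_apply[OF eta.dyson_diff_bound[OF G b e]])
  also have "\<dots> = c / 2 * (- Im (\<phi> G1) + - Im (\<phi> G0))"
    by (simp only: scaleR minus im_part) (simp add: algebra_simps diff_divide_distrib)
  also have "\<dots> \<le> K / \<epsilon> / 2 * (- Im (\<phi> G1) + - Im (\<phi> G0))"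
    using K e Im_dyson_le[OF G(1)] Im_dyson_le[OF G(2)] by (intro mult_right_mono divide_right_mono) (auto simp: c_def divide_right_mono)
  finally show ?thesis by (simp add: diff)
qed

text \<open>
  The distance between two data pairs that is to be bounded: the normalised \<open>L\<^sup>1\<close> distance of the
  transforms on the line \<open>\<real> + \<i> \<epsilon>\<close>, written in terms of the Dyson solutions.
\<close>
definition resolvent_dist ::
  "('a::cstar_algebra \<Rightarrow> complex) \<Rightarrow> real \<Rightarrow> ('a \<Rightarrow> 'a) \<Rightarrow> 'a \<Rightarrow> ('a \<Rightarrow> 'a) \<Rightarrow> 'a \<Rightarrow> ennreal" where
  "resolvent_dist \<phi> \<epsilon> \<eta>1 b1 \<eta>0 b0 = ennreal (1 / pi) * (\<integral>\<^sup>+ s. ennreal (cmod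
      (\<phi> (dyson_solution \<eta>1 ((complex_of_real s + \<i> * complex_of_real \<epsilon>) *\<^sub>C 1 - b1))
     - \<phi> (dyson_solution \<eta>0 ((complex_of_real s + \<i> * complex_of_real \<epsilon>) *\<^sub>C 1 - b0)))) \<partial>lborel)"

lemma resolvent_dist_cauchy_transform:
  assumes "dyson_data \<eta>1 \<phi> b1" "dyson_data \<eta>0 \<phi> b0" "\<epsilon> > 0"
  shows "resolvent_dist \<phi> \<epsilon> \<eta>1 b1 \<eta>0 b0 = ennreal (1 / pi) * (\<integral>\<^sup>+ s. ennreal (cmod
            (cauchy_transform (density_of_states \<phi> (b1, \<eta>1)) (complex_of_real s + \<i> * complex_of_real \<epsilon>)
           - cauchy_transform (density_of_states \<phi> (b0, \<eta>0)) (complex_of_real s + \<i> * complex_of_real \<epsilon>)))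
          \<partial>lborel)"
  unfolding resolvent_dist_def
  using assms(3) by (simp add: dyson_data.density_of_states(2)[OF assms(1)] dyson_data.density_of_states(2)[OF assms(2)])

lemma resolvent_dist_triangle:
  assumes D: "dyson_data \<eta>2 \<phi> b2" "dyson_data \<eta>1 \<phi> b1" "dyson_data \<eta>0 \<phi> b0" and e: "\<epsilon> > 0"
  shows "resolvent_dist \<phi> \<epsilon> \<eta>2 b2 \<eta>0 b0 \<le> resolvent_dist \<phi> \<epsilon> \<eta>2 b2 \<eta>1 b1 + resolvent_dist \<phi> \<epsilon> \<eta>1 b1 \<eta>0 b0"
proof -
  note [measurable] = dyson_data.phi_G_measurable[OF D(1) e] dyson_data.phi_G_measurable[OF D(2) e]
    dyson_data.phi_G_measurable[OF D(3) e]
  have tri: "ennreal (cmod (x - z)) \<le> ennreal (cmod (x - y)) + ennreal (cmod (y - z))" for x y z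
    using norm_triangle_ineq[of "x - y" "y - z"] by (simp add: ennreal_leI flip: ennreal_plus)
  show ?thesis
    unfolding resolvent_dist_def distrib_left[symmetric]
    by (subst nn_integral_add[symmetric]) (auto intro!: mult_left_mono nn_integral_mono tri)
qed

text \<open>
  On the line the imaginary parts of both transforms have total integral \<open>- \<pi>\<close>.
\<close>
lemma resolvent_dist_le:
  assumes D: "dyson_data \<eta>1 \<phi> b1" "dyson_data \<eta>0 \<phi> b0" and e: "\<epsilon> > 0" and L: "L \<ge> 0"
    and bd: "\<And>z. Im z = \<epsilon> \<Longrightarrow> cmod (\<phi> (dyson_solution \<eta>1 (z *\<^sub>C 1 - b1)) - \<phi> (dyson_solution \<eta>0 (z *\<^sub>C 1 - b0)))
      \<le> L / 2 * (- Im (\<phi> (dyson_solution \<eta>1 (z *\<^sub>C 1 - b1))) + - Im (\<phi> (dyson_solution \<eta>0 (z *\<^sub>C 1 - b0))))"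
  shows "resolvent_dist \<phi> \<epsilon> \<eta>1 b1 \<eta>0 b0 \<le> ennreal L"
proof -
  note [measurable] = dyson_data.phi_G_measurable[OF D(1) e] dyson_data.phi_G_measurable[OF D(2) e]
  define f1 f0 where "f1 s = \<phi> (dyson_solution \<eta>1 ((complex_of_real s + \<i> * complex_of_real \<epsilon>) *\<^sub>C 1 - b1))"
    and "f0 s = \<phi> (dyson_solution \<eta>0 ((complex_of_real s + \<i> * complex_of_real \<epsilon>) *\<^sub>C 1 - b0))" for s
  have [measurable]: "f1 \<in> borel_measurable borel" "f0 \<in> borel_measurable borel"
    unfolding f1_def f0_def by measurable
  have neg: "Im (f1 s) \<le> 0" "Im (f0 s) \<le> 0" for s
    unfolding f1_def f0_def using e
    by (intro dyson_data.Im_phi_G_le[OF D(1)] dyson_data.Im_phi_G_le[OF D(2)]; simp)+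
  have "(\<integral>\<^sup>+ s. ennreal (cmod (f1 s - f0 s)) \<partial>lborel)
      \<le> (\<integral>\<^sup>+ s. ennreal (L / 2) * (ennreal (- Im (f1 s)) + ennreal (- Im (f0 s))) \<partial>lborel)"
  proof (rule nn_integral_mono)
    fix s
    have "cmod (f1 s - f0 s) \<le> L / 2 * (- Im (f1 s) + - Im (f0 s))"
      unfolding f1_def f0_def by (rule bd) simp
    then have "ennreal (cmod (f1 s - f0 s)) \<le> ennreal (L / 2 * (- Im (f1 s) + - Im (f0 s)))" by (rule ennreal_leI)
    also have "\<dots> = ennreal (L / 2) * (ennreal (- Im (f1 s)) + ennreal (- Im (f0 s)))"
      using neg[of s] L by (subst ennreal_mult) (auto simp flip: ennreal_plus)
    finally show "ennreal (cmod (f1 s - f0 s)) \<le> ennreal (L / 2) * (ennreal (- Im (f1 s)) + ennreal (- Im (f0 s)))" .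
  qed
  also have "\<dots> = ennreal (L / 2) * (ennreal pi + ennreal pi)"
  proof -
    have "(\<integral>\<^sup>+ s. ennreal (- Im (f1 s)) \<partial>lborel) = ennreal pi" "(\<integral>\<^sup>+ s. ennreal (- Im (f0 s)) \<partial>lborel) = ennreal pi"
      unfolding f1_def f0_def by (rule dyson_data.nn_integral_Im_phi_G[OF D(1) e] dyson_data.nn_integral_Im_phi_G[OF D(2) e])+
    then show ?thesis by (simp add: nn_integral_cmult nn_integral_add)
  qed
  also have "\<dots> = ennreal (L * pi)" using L by (simp flip: ennreal_plus ennreal_mult)
  finally have "resolvent_dist \<phi> \<epsilon> \<eta>1 b1 \<eta>0 b0 \<le> ennreal (1 / pi) * ennreal (L * pi)"
    unfolding resolvent_dist_def f1_def f0_def by (rule mult_left_mono) simp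
  also have "\<dots> = ennreal L" using L by (simp flip: ennreal_mult)
  finally show ?thesis .
qed

lemma resolvent_dist_selfadjoint:
  assumes D: "dyson_data \<eta> \<phi> b1" "dyson_data \<eta> \<phi> b0" and e: "\<epsilon> > 0"
  shows "resolvent_dist \<phi> \<epsilon> \<eta> b1 \<eta> b0 \<le> ennreal (norm (b1 - b0) / \<epsilon>)"
proof (rule resolvent_dist_le[OF D e])
  interpret D1: dyson_data \<eta> \<phi> b1 by (rule D(1))
  interpret D0: dyson_data \<eta> \<phi> b0 by (rule D(2))
  fix z assume "Im z = \<epsilon>"
  then have z: "Im z > 0" "\<epsilon> \<le> Im z" using e by auto
  show "cmod (\<phi> (D1.G z) - \<phi> (D0.G z)) \<le> norm (b1 - b0) / \<epsilon> / 2 * (- Im (\<phi> (D1.G z)) + - Im (\<phi> (D0.G z)))"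
    by (rule D1.phi.phi_dyson_diff_bound[OF D1.block_positive D1.dyson_eq_G[OF z(1)] D0.dyson_eq_G[OF z(1)]
          D1.pencil_strict[OF z(2)] D0.pencil_strict[OF z(2)] e]) (simp add: norm_minus_commute)
qed (use e in simp)

text \<open>
  A solution for \<open>\<eta>\<^sub>1\<close> at \<open>b\<close> is a solution for \<open>\<eta>\<^sub>0\<close> at \<open>b - (\<eta>\<^sub>1 - \<eta>\<^sub>0) G\<close>: a perturbation of the map is a
  perturbation of the base point, at the cost of \<open>\<kappa> / \<epsilon>\<close> in the distance to the real line.
\<close>
lemma resolvent_dist_small_step:
  assumes D: "dyson_data \<eta>1 \<phi> b" "dyson_data \<eta>0 \<phi> b" and e: "\<epsilon> > 0"
    and \<kappa>: "\<And>x. norm (\<eta>1 x - \<eta>0 x) \<le> \<kappa> * norm x" "\<kappa> \<ge> 0" "\<kappa> < \<epsilon>\<^sup>2"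
  shows "resolvent_dist \<phi> \<epsilon> \<eta>1 b \<eta>0 b \<le> ennreal (\<kappa> / \<epsilon> / (\<epsilon> - \<kappa> / \<epsilon>))"
proof (rule resolvent_dist_le[OF D e])
  interpret D1: dyson_data \<eta>1 \<phi> b by (rule D(1))
  interpret D0: dyson_data \<eta>0 \<phi> b by (rule D(2))
  have e': "\<epsilon> - \<kappa> / \<epsilon> > 0" using \<kappa>(3) e by (simp add: divide_less_eq power2_eq_square)
  then show "0 \<le> \<kappa> / \<epsilon> / (\<epsilon> - \<kappa> / \<epsilon>)" using e \<kappa> by simp
  fix z assume "Im z = \<epsilon>"
  then have z: "Im z > 0" "\<epsilon> \<le> Im z" "Im z = \<epsilon>" using e by auto
  define p where "p = \<eta>1 (D1.G z) - \<eta>0 (D1.G z)"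
  have "norm p \<le> \<kappa> * (1 / \<epsilon>)"
    using \<kappa>(1)[of "D1.G z"] mult_left_mono[OF D1.norm_G_le[OF z(1)] \<kappa>(2)] z(3) by (simp add: p_def)
  then have np: "norm p \<le> \<kappa> / \<epsilon>" by simp
  have eq: "dyson_eq \<eta>0 (z *\<^sub>C 1 - b - p) (D1.G z)"
    using D1.dyson_eq_G[OF z(1)] by (simp add: dyson_eq_def p_def left_diff_distrib)
  have "pos_elem ((\<kappa> / \<epsilon>) *\<^sub>R 1 - im_part p)"
    using np norm_im_part_le[of p] by (intro pos_elem_norm_minus star_im_part) simp
  from pos_elem_add[OF D1.pencil_strict[OF z(2)] this]
  have up: "pos_elem (im_part (z *\<^sub>C 1 - b - p) - (\<epsilon> - \<kappa> / \<epsilon>) *\<^sub>R 1)"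
    unfolding im_part_diff[of "z *\<^sub>C 1 - b" p] scaleR_diff_left by (simp add: algebra_simps)
  have up0: "pos_elem (im_part (z *\<^sub>C 1 - b) - (\<epsilon> - \<kappa> / \<epsilon>) *\<^sub>R 1)"
    using e \<kappa> z by (intro D1.pencil_strict) simp
  show "cmod (\<phi> (D1.G z) - \<phi> (D0.G z)) \<le> \<kappa> / \<epsilon> / (\<epsilon> - \<kappa> / \<epsilon>) / 2 * (- Im (\<phi> (D1.G z)) + - Im (\<phi> (D0.G z)))"
    by (rule D1.phi.phi_dyson_diff_bound[OF D0.block_positive eq D0.dyson_eq_G[OF z(1)] up up0 e']) (simp add: np)
qed

text \<open>
  Along the segment from \<open>\<eta>\<^sub>0\<close> to \<open>\<eta>\<^sub>1\<close> with \<open>N\<close> steps of size \<open>\<kappa> / N\<close> the loss \<open>\<kappa> / (N \<epsilon>)\<close> in each step tends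
  to \<open>0\<close>.
\<close>
lemma resolvent_dist_maps:
  fixes \<eta>0 \<eta>1 :: "'a::cstar_algebra \<Rightarrow> 'a"
  assumes D: "dyson_data \<eta>1 \<phi> b" "dyson_data \<eta>0 \<phi> b" and e: "\<epsilon> > 0"
    and \<kappa>: "\<And>x. norm (\<eta>1 x - \<eta>0 x) \<le> \<kappa> * norm x" "\<kappa> \<ge> 0"
  shows "resolvent_dist \<phi> \<epsilon> \<eta>1 b \<eta>0 b \<le> ennreal (\<kappa> / \<epsilon>\<^sup>2)"
proof -
  interpret D1: dyson_data \<eta>1 \<phi> b by (rule D(1))
  interpret D0: dyson_data \<eta>0 \<phi> b by (rule D(2))
  define \<eta> where "\<eta> t x = (1 - t) *\<^sub>R \<eta>0 x + t *\<^sub>R \<eta>1 x" for t x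
  have data: "dyson_data (\<eta> t) \<phi> b" if "0 \<le> t" "t \<le> 1" for t
    unfolding \<eta>_def using that D1.selfadjoint
    by (intro dyson_data.intro block_positive_map.intro block_positive_convex D0.block_positive D1.block_positive
         D1.phi.cstar_state_axioms dyson_data_axioms.intro) auto
  have dif: "\<eta> s x - \<eta> t x = (s - t) *\<^sub>R (\<eta>1 x - \<eta>0 x)" for s t x
    by (simp add: \<eta>_def algebra_simps)
  have bound: "resolvent_dist \<phi> \<epsilon> \<eta>1 b \<eta>0 b \<le> ennreal (real N * (\<kappa> / real N / \<epsilon> / (\<epsilon> - \<kappa> / real N / \<epsilon>)))"
    if N: "N > 0" "\<kappa> / real N < \<epsilon>\<^sup>2" for N :: nat
  proof -
    define c where "c = \<kappa> / real N / \<epsilon> / (\<epsilon> - \<kappa> / real N / \<epsilon>)"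
    have "\<epsilon> - \<kappa> / real N / \<epsilon> > 0" using N e by (simp add: divide_less_eq power2_eq_square mult_ac)
    then have c: "c \<ge> 0" using \<kappa> e by (simp add: c_def)
    have "resolvent_dist \<phi> \<epsilon> (\<eta> (real k / real N)) b (\<eta> 0) b \<le> ennreal (real k * c)" if "k \<le> N" for k
      using that
    proof (induction k)
      case 0
      show ?case by (simp add: resolvent_dist_def)
    next
      case (Suc k)
      have t: "0 \<le> real k / real N" "real k / real N \<le> 1" "0 \<le> real (Suc k) / real N" "real (Suc k) / real N \<le> 1"
        using Suc.prems by (simp_all add: divide_le_eq)
      have "real (Suc k) / real N - real k / real N = 1 / real N" by (simp flip: diff_divide_distrib)
      then have "norm (\<eta> (real (Suc k) / real N) x - \<eta> (real k / real N) x) \<le> \<kappa> / real N * norm x" for x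
        unfolding dif using \<kappa>(1)[of x] by (simp add: divide_right_mono)
      then have "resolvent_dist \<phi> \<epsilon> (\<eta> (real (Suc k) / real N)) b (\<eta> (real k / real N)) b \<le> ennreal c"
        unfolding c_def using \<kappa>(2) N(2) by (intro resolvent_dist_small_step data t e) auto
      then have "resolvent_dist \<phi> \<epsilon> (\<eta> (real (Suc k) / real N)) b (\<eta> 0) b \<le> ennreal c + ennreal (real k * c)"
        using Suc t by (intro order.trans[OF resolvent_dist_triangle[OF data data data e] add_mono]) auto
      also have "\<dots> = ennreal (real (Suc k) * c)" using c by (simp add: algebra_simps flip: ennreal_plus)
      finally show ?case .
    qed
    from this[of N] have "resolvent_dist \<phi> \<epsilon> (\<eta> 1) b (\<eta> 0) b \<le> ennreal (real N * c)" using N by simp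
    moreover have "\<eta> 1 = \<eta>1" "\<eta> 0 = \<eta>0" by (auto simp: \<eta>_def)
    ultimately show ?thesis by (simp add: c_def)
  qed
  have "(\<lambda>N. real N * (\<kappa> / real N / \<epsilon> / (\<epsilon> - \<kappa> / real N / \<epsilon>))) \<longlonglongrightarrow> \<kappa> / \<epsilon>\<^sup>2"
    using e \<kappa>(2) by real_asymp (simp add: power2_eq_square divide_inverse)
  then have "(\<lambda>N. ennreal (real N * (\<kappa> / real N / \<epsilon> / (\<epsilon> - \<kappa> / real N / \<epsilon>)))) \<longlonglongrightarrow> ennreal (\<kappa> / \<epsilon>\<^sup>2)"
    by (rule tendsto_ennrealI)
  then show ?thesis
  proof (rule tendsto_lowerbound)
    have "(\<lambda>N. \<kappa> / real N) \<longlonglongrightarrow> 0" by real_asymp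
    then have "\<forall>\<^sub>F N in sequentially. \<kappa> / real N < \<epsilon>\<^sup>2" by (rule order_tendstoD) (use e in simp)
    then show "\<forall>\<^sub>F N in sequentially. resolvent_dist \<phi> \<epsilon> \<eta>1 b \<eta>0 b \<le> ennreal (real N * (\<kappa> / real N / \<epsilon> / (\<epsilon> - \<kappa> / real N / \<epsilon>)))"
      using eventually_gt_at_top[of 0] by eventually_elim (rule bound)
  qed simp
qed

theorem corollary5p2:
  fixes \<phi> :: "'b::cstar_algebra \<Rightarrow> complex"
  assumes "state \<phi>"
  shows "(\<forall>\<eta>\<in>two_positive_maps. \<forall>b00\<in>selfadjoint_elems. \<forall>b01\<in>selfadjoint_elems. \<forall>\<epsilon>::real. \<epsilon> > 0 \<longrightarrow>
      ennreal (1 / pi) *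
        (\<integral>\<^sup>+ s. ennreal (cmod
            (cauchy_transform (density_of_states \<phi> (b01, \<eta>)) (complex_of_real s + \<i> * complex_of_real \<epsilon>)
           - cauchy_transform (density_of_states \<phi> (b00, \<eta>)) (complex_of_real s + \<i> * complex_of_real \<epsilon>)))
          \<partial>lborel)
      \<le> ennreal (1 / \<epsilon> * norm (b01 - b00))) \<and>
    (\<forall>b0\<in>selfadjoint_elems. \<forall>\<eta>0\<in>two_positive_maps. \<forall>\<eta>1\<in>two_positive_maps. \<forall>\<epsilon>::real. \<epsilon> > 0 \<longrightarrow>
      ennreal (1 / pi) *
        (\<integral>\<^sup>+ s. ennreal (cmod
            (cauchy_transform (density_of_states \<phi> (b0, \<eta>1)) (complex_of_real s + \<i> * complex_of_real \<epsilon>)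
           - cauchy_transform (density_of_states \<phi> (b0, \<eta>0)) (complex_of_real s + \<i> * complex_of_real \<epsilon>)))
          \<partial>lborel)
      \<le> ennreal (1 / \<epsilon>\<^sup>2 * onorm (\<lambda>b. \<eta>1 b - \<eta>0 b)))"
proof (intro conjI ballI allI impI)
  have data: "dyson_data \<eta> \<phi> b" if "\<eta> \<in> two_positive_maps" "b \<in> selfadjoint_elems" for \<eta> and b :: 'b
    using that assms
    by (intro dyson_data.intro block_positive_map.intro block_positive_of_two_positive cstar_state.intro
          dyson_data_axioms.intro) (simp_all add: selfadjoint_elems_def)
  {
    fix \<eta> :: "'b \<Rightarrow> 'b" and b00 b01 :: 'b and \<epsilon> :: real
    assume h: "\<eta> \<in> two_positive_maps" "b00 \<in> selfadjoint_elems" "b01 \<in> selfadjoint_elems" and e: "\<epsilon> > 0"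
    show "ennreal (1 / pi) *
        (\<integral>\<^sup>+ s. ennreal (cmod
            (cauchy_transform (density_of_states \<phi> (b01, \<eta>)) (complex_of_real s + \<i> * complex_of_real \<epsilon>)
           - cauchy_transform (density_of_states \<phi> (b00, \<eta>)) (complex_of_real s + \<i> * complex_of_real \<epsilon>)))
          \<partial>lborel)
      \<le> ennreal (1 / \<epsilon> * norm (b01 - b00))"
      using resolvent_dist_selfadjoint[OF data[OF h(1,3)] data[OF h(1,2)] e]
      unfolding resolvent_dist_cauchy_transform[OF data[OF h(1,3)] data[OF h(1,2)] e] by simp
  next
    fix b0 :: 'b and \<eta>0 \<eta>1 :: "'b \<Rightarrow> 'b" and \<epsilon> :: real
    assume h: "b0 \<in> selfadjoint_elems" "\<eta>0 \<in> two_positive_maps" "\<eta>1 \<in> two_positive_maps" and e: "\<epsilon> > 0"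
    have bl: "bounded_linear (\<lambda>b. \<eta>1 b - \<eta>0 b)"
      using h by (intro bounded_linear_sub block_positive_map.bounded_linear block_positive_map.intro block_positive_of_two_positive)
    have "norm (\<eta>1 x - \<eta>0 x) \<le> onorm (\<lambda>b. \<eta>1 b - \<eta>0 b) * norm x" for x
      using onorm[OF bl] by simp
    from resolvent_dist_maps[OF data[OF h(3,1)] data[OF h(2,1)] e this onorm_pos_le[OF bl]]
    show "ennreal (1 / pi) *
        (\<integral>\<^sup>+ s. ennreal (cmod
            (cauchy_transform (density_of_states \<phi> (b0, \<eta>1)) (complex_of_real s + \<i> * complex_of_real \<epsilon>)
           - cauchy_transform (density_of_states \<phi> (b0, \<eta>0)) (complex_of_real s + \<i> * complex_of_real \<epsilon>)))
          \<partial>lborel)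
      \<le> ennreal (1 / \<epsilon>\<^sup>2 * onorm (\<lambda>b. \<eta>1 b - \<eta>0 b))"
      unfolding resolvent_dist_cauchy_transform[OF data[OF h(3,1)] data[OF h(2,1)] e] by simp
  }
qed

end
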